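(* Let $(X,T)$ be a minimal Cantor system given by a proper and clean Bratteli-Vershik representation $B=(V,E,\preceq)$ of finite rank $d$. Let $\mu$ be an ergodic $T$-invariant probability measure, let $I_\mu\subseteq\{1,\dots,d\}$ be the associated set of vertices from the definition of clean, and let $\lambda=\exp(2i\pi\alpha)$ with $\alpha\in\mathbb{R}$. Then the following two conditions (1), (2) are equivalent, and $\lambda$ is an eigenvalue of $(X,T)$ for $\mu$ if and only if they hold: (1) for all $v\in I_\mu$, $$\sum_{u\in I_\mu}\frac{h_m(u)}{h_n(v)}\Bigl|\sum_{s\in S_{m,n}(u,v)}\lambda^{\langle s,h_m\rangle}\Bigr|\xrightarrow[m\to+\infty]{}1\quad\text{uniformly for } n>m;$$ (2) for all $u\in\{1,\dots,d\}$ and $v\in I_\mu$, $$\frac{h_m(u)}{h_n(v)}\Bigl[P_{m,n}(u,v)-\Bigl|\sum_{s\in S_{m,n}(u,v)}\lambda^{\langle s,h_m\rangle}\Bigr|\Bigr]\xrightarrow[m\to+\infty]{}0\quad\text{uniformly for } n>m.$$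
   Context: Uniform convergence: $a_{m,n}\to a$ as $m\to+\infty$ uniformly for $n>m$ means: for every $\varepsilon>0$ there is $m_0\ge1$ with $|a_{m,n}-a|\le\varepsilon$ for all $n>m\ge m_0$. $\langle\cdot,\cdot\rangle$ is the Euclidean inner product. Systems. A minimal Cantor system $(X,T)$ is a homeomorphism $T$ of a Cantor set $X$ all of whose orbits are dense. For a $T$-invariant Borel probability measure $\mu$, $\lambda\in\mathbb{C}$ is an eigenvalue of $(X,T)$ for $\mu$ if there is $f\in L^2(X,\mu)$, $f\ne0$, with $f\circ T=\lambda f$. Bratteli diagrams. A Bratteli diagram $(V,E)$ is an infinite graph with finite pairwise disjoint vertex levels $V_0=\{v_0\},V_1,V_2,\dots$ and finite edge levels $E_1,E_2,\dots$; each $e\in E_n$ goes from a source $\mathsf{s}(e)\in V_{n-1}$ to a range $\mathsf{r}(e)\in V_n$; every vertex is the source of some edge and every vertex other than $v_0$ is the range of some edge. $M_n$ is the $V_{n-1}\times V_n$ matrix whose $(u,v)$ entry is the number of edges from $u$ to $v$; $P_{m,n}=M_{m+1}\cdots M_n$, with entries $P_{m,n}(u,v)$; $h_n=(h_n(u);u\in V_n)$ is the row vector with $h_n(u)$ the number of paths from $v_0$ to $u$. $E_{m,n}$ is the set of paths from $V_m$ to $V_n$. The diagram is simple if for every $m\ge1$ there is $n>m$ with all entries of $P_{m,n}$ positive. Orders. An ordered Bratteli diagram $B=(V,E,\preceq)$ carries a partial order on $E$ in which two edges are comparable iff they have the same range. It induces a partial order on each $E_{m,n}$: two distinct paths with the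 same range vertex are compared by the last edge at which they differ. $X_B$ is the space of infinite paths $(x_1,x_2,\dots)$ starting at $v_0$, with the cylinder topology. $B$ is properly ordered if there is a unique $x_{\max}\in X_B$ with all edges maximal and a unique $x_{\min}\in X_B$ with all edges minimal. The Vershik map $V_B$ sends $x_{\max}$ to $x_{\min}$, and sends $x\ne x_{\max}$ to the path obtained by taking the smallest $n$ with $x_n$ not maximal, replacing $x_n$ by its successor $y_n$, replacing $(x_1,\dots,x_{n-1})$ by the minimal path from $v_0$ to $\mathsf{s}(y_n)$, and leaving $x_{n+1},x_{n+2},\dots$ unchanged. $B$ is a Bratteli-Vershik representation of $(X,T)$ if $B$ is properly ordered, $(V,E)$ is simple and $(X,T)$ is topologically conjugate to $(X_B,V_B)$; one identifies $(X,T)=(X_B,V_B)$. A proper representation of finite rank $d$ is one such that: all entries of $h_1$ equal $1$; for all $n\ge2$ all entries of $M_n$ are positive; $\#V_n=d$ for all $n\geq 1$, and $V_n$ is identified with $\{1,\dots,d\}$; for all $n\ge2$ all maximal edges of $E_n$ start at vertex $d$ of $V_{n-1}$. Suffix vectors. For $x\in X$ let $\tau_n(x)=\mathsf{r}(x_n)\in V_n$. For $0\le m<n$, the suffix vector $s_{m,n}(x)\in\mathbb{N}^{V_m}$ has $u$-th coordinate $\#\{e\in E_{m,n}:(x_{m+1},\dots,x_n)\prec e,\ \mathsf{s}(e)=u\}$. For $u\in V_m,v\in V_n$, $S_{m,n}(u,v)=\{s_{m,n}(x):x\in X,\ \tau_m(x)=u,\ \tau_n(x)=v\}$. Clean. A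 proper representation of finite rank $d$ is clean if there is $\delta_0>0$ such that for each ergodic measure $\mu$ there is $I_\mu\subseteq\{1,\dots,d\}$ with $\mu(\tau_n=v)\ge\delta_0$ for all $v\in I_\mu$, $n\ge1$, and $\lim_{n\to\infty}\mu(\tau_n=v)=0$ for all $v\notin I_\mu$; and $I_\mu\cap I_\nu=\emptyset$ for distinct ergodic measures $\mu,\nu$. *)

theory Defs
  imports "HOL-Probability.Probability"
begin

definition cantor_space :: "'x topology \<Rightarrow> bool" where
  "cantor_space X \<longleftrightarrow>
     X homeomorphic_space
       product_topology (\<lambda>_::nat. discrete_topology (UNIV :: bool set)) UNIV"

text \<open>The two-sided orbit; for injective \<open>T\<close> the second disjunct says that \<open>y\<close> is the image of
  \<open>x\<close> under the \<open>k\<close>-th iterate of the inverse of \<open>T\<close>.\<close>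

definition full_orbit :: "'x topology \<Rightarrow> ('x \<Rightarrow> 'x) \<Rightarrow> 'x \<Rightarrow> 'x set" where
  "full_orbit X T x = {y \<in> topspace X. \<exists>k::nat. y = (T ^^ k) x \<or> x = (T ^^ k) y}"

definition minimal_cantor_system :: "'x topology \<Rightarrow> ('x \<Rightarrow> 'x) \<Rightarrow> bool" where
  "minimal_cantor_system X T \<longleftrightarrow>
     cantor_space X \<and> homeomorphic_map X X T \<and>
     (\<forall>x \<in> topspace X. X closure_of (full_orbit X T x) = topspace X)"

definition invariant_prob :: "'x topology \<Rightarrow> ('x \<Rightarrow> 'x) \<Rightarrow> 'x measure \<Rightarrow> bool" where
  "invariant_prob X T \<mu> \<longleftrightarrow>
     prob_space \<mu> \<and> space \<mu> = topspace X \<and>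
     sets \<mu> = sigma_sets (topspace X) {U. openin X U} \<and>
     T \<in> measurable \<mu> \<mu> \<and> distr \<mu> \<mu> T = \<mu>"

definition ergodic_prob :: "'x topology \<Rightarrow> ('x \<Rightarrow> 'x) \<Rightarrow> 'x measure \<Rightarrow> bool" where
  "ergodic_prob X T \<mu> \<longleftrightarrow>
     invariant_prob X T \<mu> \<and>
     (\<forall>A \<in> sets \<mu>. T -` A \<inter> space \<mu> = A \<longrightarrow> measure \<mu> A = 0 \<or> measure \<mu> A = 1)"

text \<open>Equality in \<open>L\<^sup>2\<close> is equality almost everywhere.\<close>

definition eigenvalue_for :: "('x \<Rightarrow> 'x) \<Rightarrow> 'x measure \<Rightarrow> complex \<Rightarrow> bool" where
  "eigenvalue_for T \<mu> c \<longleftrightarrow>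
     (\<exists>f :: 'x \<Rightarrow> complex.
        f \<in> borel_measurable \<mu> \<and> integrable \<mu> (\<lambda>x. (norm (f x))\<^sup>2) \<and>
        \<not> (AE x in \<mu>. f x = 0) \<and>
        (AE x in \<mu>. f (T x) = c * f x))"

definition topological_conjugacy ::
  "'x topology \<Rightarrow> ('x \<Rightarrow> 'x) \<Rightarrow> 'y topology \<Rightarrow> ('y \<Rightarrow> 'y) \<Rightarrow> ('x \<Rightarrow> 'y) \<Rightarrow> bool" where
  "topological_conjugacy X T Y S \<phi> \<longleftrightarrow>
     homeomorphic_map X Y \<phi> \<and> (\<forall>x \<in> topspace X. \<phi> (T x) = S (\<phi> x))"

text \<open>
  Vertices are labelled by natural numbers level by level: the vertices of level \<open>n\<close> are the
  pairs \<open>(n, v)\<close> with \<open>v \<in> verts B n\<close>, so distinct levels are disjoint by construction and may all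
  be labelled by the same set \<open>{1..d}\<close>. An edge in \<open>edges B n\<close>, \<open>n \<ge> 1\<close>, has its source label in
  \<open>verts B (n - 1)\<close> and its range label in \<open>verts B n\<close>; \<open>edges B 0\<close> is never used.
\<close>

record 'e ordered_bratteli =
  verts :: "nat \<Rightarrow> nat set"
  edges :: "nat \<Rightarrow> 'e set"
  src :: "'e \<Rightarrow> nat"
  rng :: "'e \<Rightarrow> nat"
  edge_ord :: "('e \<times> 'e) set"

definition bratteli_diagram :: "'e ordered_bratteli \<Rightarrow> bool" where
  "bratteli_diagram B \<longleftrightarrow>
     is_singleton (verts B 0) \<and>
     (\<forall>n. finite (verts B n) \<and> verts B n \<noteq> {}) \<and>
     (\<forall>n\<ge>1. finite (edges B n)) \<and>
     disjoint_family_on (edges B) {1..} \<and>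
     (\<forall>n\<ge>1. \<forall>e \<in> edges B n. src B e \<in> verts B (n - 1) \<and> rng B e \<in> verts B n) \<and>
     (\<forall>n. \<forall>v \<in> verts B n. \<exists>e \<in> edges B (Suc n). src B e = v) \<and>
     (\<forall>n\<ge>1. \<forall>v \<in> verts B n. \<exists>e \<in> edges B n. rng B e = v)"

text \<open>Two edges have the same range vertex iff they have the same level and the same range label.\<close>

definition ordered_bratteli_diagram :: "'e ordered_bratteli \<Rightarrow> bool" where
  "ordered_bratteli_diagram B \<longleftrightarrow>
     bratteli_diagram B \<and>
     partial_order_on (\<Union>n\<in>{1..}. edges B n) (edge_ord B) \<and>
     (\<forall>m\<ge>1. \<forall>n\<ge>1. \<forall>e \<in> edges B m. \<forall>f \<in> edges B n.
        ((e, f) \<in> edge_ord B \<or> (f, e) \<in> edge_ord B) \<longleftrightarrow> m = n \<and> rng B e = rng B f)"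

definition edge_less :: "'e ordered_bratteli \<Rightarrow> 'e \<Rightarrow> 'e \<Rightarrow> bool" where
  "edge_less B e f \<longleftrightarrow> (e, f) \<in> edge_ord B \<and> e \<noteq> f"

definition maximal_edge :: "'e ordered_bratteli \<Rightarrow> 'e \<Rightarrow> bool" where
  "maximal_edge B e \<longleftrightarrow> \<not> (\<exists>f. edge_less B e f)"

definition minimal_edge :: "'e ordered_bratteli \<Rightarrow> 'e \<Rightarrow> bool" where
  "minimal_edge B e \<longleftrightarrow> \<not> (\<exists>f. edge_less B f e)"

definition incidence :: "'e ordered_bratteli \<Rightarrow> nat \<Rightarrow> nat \<Rightarrow> nat \<Rightarrow> nat" where
  "incidence B n u v = card {e \<in> edges B n. src B e = u \<and> rng B e = v}"

text \<open>\<open>incidence_prod B m n\<close> is the matrix product \<open>M\<^sub>m\<^sub>+\<^sub>1 \<cdots> M\<^sub>n\<close> for \<open>m \<le> n\<close> (the identity if \<open>m = n\<close>).\<close>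

fun incidence_prod :: "'e ordered_bratteli \<Rightarrow> nat \<Rightarrow> nat \<Rightarrow> nat \<Rightarrow> nat \<Rightarrow> nat" where
  "incidence_prod B m 0 u v = (if u = v then 1 else 0)"
| "incidence_prod B m (Suc n) u v =
     (if m \<le> n
      then (\<Sum>w \<in> verts B n. incidence_prod B m n u w * incidence B (Suc n) w v)
      else (if u = v then 1 else 0))"

definition simple_diagram :: "'e ordered_bratteli \<Rightarrow> bool" where
  "simple_diagram B \<longleftrightarrow>
     (\<forall>m\<ge>1. \<exists>n>m. \<forall>u \<in> verts B m. \<forall>v \<in> verts B n. incidence_prod B m n u v > 0)"

text \<open>A path from level \<open>m\<close> to level \<open>n\<close> is a function on \<open>{m<..n}\<close>, the \<open>i\<close>-th edge lying in
  \<open>edges B i\<close>; for \<open>m < n\<close> its source is \<open>src B (p (Suc m))\<close> and its range \<open>rng B (p n)\<close>.\<close>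

definition paths :: "'e ordered_bratteli \<Rightarrow> nat \<Rightarrow> nat \<Rightarrow> (nat \<Rightarrow> 'e) set" where
  "paths B m n =
     {p \<in> (\<Pi>\<^sub>E i\<in>{m<..n}. edges B i). \<forall>i. m < i \<and> i < n \<longrightarrow> rng B (p i) = src B (p (Suc i))}"

definition path_less ::
  "'e ordered_bratteli \<Rightarrow> nat \<Rightarrow> nat \<Rightarrow> (nat \<Rightarrow> 'e) \<Rightarrow> (nat \<Rightarrow> 'e) \<Rightarrow> bool" where
  "path_less B m n p q \<longleftrightarrow>
     p \<in> paths B m n \<and> q \<in> paths B m n \<and> rng B (p n) = rng B (q n) \<and>
     (\<exists>k\<in>{m<..n}. edge_less B (p k) (q k) \<and> (\<forall>j\<in>{k<..n}. p j = q j))"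

text \<open>At level \<open>0\<close> only the empty path is counted.\<close>

definition tower_height :: "'e ordered_bratteli \<Rightarrow> nat \<Rightarrow> nat \<Rightarrow> nat" where
  "tower_height B n u = (if n = 0 then 1 else card {p \<in> paths B 0 n. rng B (p n) = u})"

definition inf_paths :: "'e ordered_bratteli \<Rightarrow> (nat \<Rightarrow> 'e) set" where
  "inf_paths B =
     {x \<in> (\<Pi>\<^sub>E i\<in>{1..}. edges B i). \<forall>i\<ge>1. rng B (x i) = src B (x (Suc i))}"

definition path_topology :: "'e ordered_bratteli \<Rightarrow> (nat \<Rightarrow> 'e) topology" where
  "path_topology B =
     subtopology (product_topology (\<lambda>i. discrete_topology (edges B i)) {1..}) (inf_paths B)"

definition max_path :: "'e ordered_bratteli \<Rightarrow> (nat \<Rightarrow> 'e) \<Rightarrow> bool" where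
  "max_path B x \<longleftrightarrow> x \<in> inf_paths B \<and> (\<forall>i\<ge>1. maximal_edge B (x i))"

definition min_path :: "'e ordered_bratteli \<Rightarrow> (nat \<Rightarrow> 'e) \<Rightarrow> bool" where
  "min_path B x \<longleftrightarrow> x \<in> inf_paths B \<and> (\<forall>i\<ge>1. minimal_edge B (x i))"

definition properly_ordered :: "'e ordered_bratteli \<Rightarrow> bool" where
  "properly_ordered B \<longleftrightarrow>
     ordered_bratteli_diagram B \<and> (\<exists>!x. max_path B x) \<and> (\<exists>!x. min_path B x)"

definition edge_succ :: "'e ordered_bratteli \<Rightarrow> 'e \<Rightarrow> 'e" where
  "edge_succ B e = (THE f. edge_less B e f \<and> (\<forall>g. edge_less B e g \<longrightarrow> (f, g) \<in> edge_ord B))"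

text \<open>The minimal path from \<open>v\<^sub>0\<close> to the vertex \<open>u\<close> of level \<open>n\<close>; for \<open>n = 0\<close> it is the empty path.\<close>

definition min_path_to :: "'e ordered_bratteli \<Rightarrow> nat \<Rightarrow> nat \<Rightarrow> nat \<Rightarrow> 'e" where
  "min_path_to B n u =
     (THE p. p \<in> paths B 0 n \<and> (n > 0 \<longrightarrow> rng B (p n) = u) \<and> \<not> (\<exists>q. path_less B 0 n q p))"

definition vershik_map :: "'e ordered_bratteli \<Rightarrow> (nat \<Rightarrow> 'e) \<Rightarrow> (nat \<Rightarrow> 'e)" where
  "vershik_map B x =
     (if max_path B x then (THE y. min_path B y)
      else (let n = (LEAST n. n \<ge> 1 \<and> \<not> maximal_edge B (x n));
                e = edge_succ B (x n);
                p = min_path_to B (n - 1) (src B e)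
            in (\<lambda>i. if 1 \<le> i \<and> i < n then p i else if i = n then e else x i)))"

text \<open>The conjugacy \<open>\<phi>\<close> is the identification of \<open>(X, T)\<close> with the space of infinite paths and its
  Vershik map.\<close>

definition bratteli_vershik_representation ::
  "'e ordered_bratteli \<Rightarrow> 'x topology \<Rightarrow> ('x \<Rightarrow> 'x) \<Rightarrow> ('x \<Rightarrow> nat \<Rightarrow> 'e) \<Rightarrow> bool" where
  "bratteli_vershik_representation B X T \<phi> \<longleftrightarrow>
     properly_ordered B \<and> simple_diagram B \<and>
     topological_conjugacy X T (path_topology B) (vershik_map B) \<phi>"

definition proper_representation ::
  "'e ordered_bratteli \<Rightarrow> 'x topology \<Rightarrow> ('x \<Rightarrow> 'x) \<Rightarrow> ('x \<Rightarrow> nat \<Rightarrow> 'e) \<Rightarrow> nat \<Rightarrow> bool" where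
  "proper_representation B X T \<phi> d \<longleftrightarrow>
     bratteli_vershik_representation B X T \<phi> \<and>
     (\<forall>u \<in> verts B 1. tower_height B 1 u = 1) \<and>
     (\<forall>n\<ge>2. \<forall>u \<in> verts B (n - 1). \<forall>v \<in> verts B n. incidence B n u v > 0) \<and>
     (\<forall>n\<ge>1. verts B n = {1..d}) \<and>
     (\<forall>n\<ge>2. \<forall>e \<in> edges B n. maximal_edge B e \<longrightarrow> src B e = d)"

definition tau :: "'e ordered_bratteli \<Rightarrow> nat \<Rightarrow> (nat \<Rightarrow> 'e) \<Rightarrow> nat" where
  "tau B n x = (if n = 0 then the_elem (verts B 0) else rng B (x n))"

definition suffix_vector :: "'e ordered_bratteli \<Rightarrow> nat \<Rightarrow> nat \<Rightarrow> (nat \<Rightarrow> 'e) \<Rightarrow> (nat \<Rightarrow> nat)" where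
  "suffix_vector B m n x =
     (\<lambda>u\<in>verts B m.
        card {e \<in> paths B m n. path_less B m n (restrict x {m<..n}) e \<and> src B (e (Suc m)) = u})"

definition suffix_set ::
  "'e ordered_bratteli \<Rightarrow> nat \<Rightarrow> nat \<Rightarrow> nat \<Rightarrow> nat \<Rightarrow> (nat \<Rightarrow> nat) set" where
  "suffix_set B m n u v =
     {suffix_vector B m n x | x. x \<in> inf_paths B \<and> tau B m x = u \<and> tau B n x = v}"

definition height_inner :: "'e ordered_bratteli \<Rightarrow> nat \<Rightarrow> (nat \<Rightarrow> nat) \<Rightarrow> nat" where
  "height_inner B m s = (\<Sum>u \<in> verts B m. s u * tower_height B m u)"

text \<open>\<open>clean_via B X T \<phi> d \<delta> I\<close>: the representation is clean, with constant \<open>\<delta>\<close> and with \<open>I \<mu>\<close> the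
  set of vertices attached to the ergodic measure \<open>\<mu>\<close>. For ergodic \<open>\<mu>\<close> the set \<open>I \<mu>\<close> is
  determined by \<open>\<mu>\<close>.\<close>

definition clean_via ::
  "'e ordered_bratteli \<Rightarrow> 'x topology \<Rightarrow> ('x \<Rightarrow> 'x) \<Rightarrow> ('x \<Rightarrow> nat \<Rightarrow> 'e) \<Rightarrow> nat \<Rightarrow>
   real \<Rightarrow> ('x measure \<Rightarrow> nat set) \<Rightarrow> bool" where
  "clean_via B X T \<phi> d \<delta> I \<longleftrightarrow>
     \<delta> > 0 \<and>
     (\<forall>\<mu>. ergodic_prob X T \<mu> \<longrightarrow>
        I \<mu> \<subseteq> {1..d} \<and>
        (\<forall>v \<in> I \<mu>. \<forall>n\<ge>1. measure \<mu> {x \<in> topspace X. tau B n (\<phi> x) = v} \<ge> \<delta>) \<and>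
        (\<forall>v \<in> {1..d} - I \<mu>.
           (\<lambda>n. measure \<mu> {x \<in> topspace X. tau B n (\<phi> x) = v}) \<longlonglongrightarrow> 0)) \<and>
     (\<forall>\<mu> \<nu>. ergodic_prob X T \<mu> \<longrightarrow> ergodic_prob X T \<nu> \<longrightarrow> \<mu> \<noteq> \<nu> \<longrightarrow> I \<mu> \<inter> I \<nu> = {})"

definition converges_uniformly_above :: "(nat \<Rightarrow> nat \<Rightarrow> real) \<Rightarrow> real \<Rightarrow> bool" where
  "converges_uniformly_above a l \<longleftrightarrow>
     (\<forall>\<epsilon>>0. \<exists>m0\<ge>1. \<forall>m\<ge>m0. \<forall>n>m. \<bar>a m n - l\<bar> \<le> \<epsilon>)"

end

theory Submission
  imports Defs
begin

text \<open>
  Let \<open>R\<^sub>n x\<close> be the number of steps from \<open>x\<close> up to the top of its tower of level \<open>n\<close>. Then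
  \<open>R\<^sub>n = R\<^sub>m + \<langle>s\<^sub>m\<^sub>,\<^sub>n, h\<^sub>m\<rangle>\<close>, and invariance makes all levels of a tower equally large, so that
  \<open>\<mu>(\<tau>\<^sub>m = u, \<tau>\<^sub>n = v) = \<mu>(\<tau>\<^sub>n = v) h\<^sub>m(u) P\<^sub>m\<^sub>,\<^sub>n(u,v) / h\<^sub>n(v)\<close>. As \<open>\<mu>(\<tau>\<^sub>n = v) \<ge> \<delta>\<close> on \<open>I\<^sub>\<mu>\<close> and
  \<open>\<mu>(\<tau>\<^sub>m = u) \<rightarrow> 0\<close> off \<open>I\<^sub>\<mu>\<close>, conditions (1) and (2) are equivalent.

  If \<open>g\<close> is a unimodular eigenfunction, then its integrals over the cells of level \<open>m\<close> have total
  modulus close to \<open>1\<close> for large \<open>m\<close>, because \<open>g\<close> is nearly constant on these cells. Cutting a cell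
  along the towers of level \<open>n\<close> bounds the same total by the \<open>\<mu>(\<tau>\<^sub>n = v)\<close>-average of the sums in (1)
  extended over all \<open>u\<close>; each defect in (2), weighted by \<open>\<mu>(\<tau>\<^sub>n = v)\<close>, is thus small.

  Conversely fix \<open>v \<in> I\<^sub>\<mu>\<close>. The functions \<open>w\<^sub>n = \<lambda>\<^bsup>-R\<^sub>n\<^esup>\<close> on \<open>{\<tau>\<^sub>n = v}\<close>, \<open>0\<close> elsewhere, satisfy
  \<open>w\<^sub>n \<circ> T = \<lambda> w\<^sub>n\<close> away from the tops of the towers, which shrink to the single point \<open>x\<^sub>m\<^sub>a\<^sub>x\<close> of measure
  \<open>0\<close>. Hence every weak limit \<open>f\<close> satisfies \<open>f \<circ> T = \<lambda> f\<close>, and by (1), for one fixed \<open>m\<close>, a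
  subsequence of \<open>w\<^sub>n\<close> has integrals bounded away from \<open>0\<close> on one and the same cell of level \<open>m\<close>,
  which makes \<open>f\<close> nonzero.
\<close>

section \<open>Paths in ordered Bratteli diagrams\<close>

text \<open>Uniformity in n has a different source in each direction. Starting from an eigenfunction
  it comes for free: how well g is approximated on the cells of level m is a statement without n,
  and cutting these cells along any later level gives an estimate for all n > m at once. In the
  converse it is what gets consumed, for m stays fixed while n tends to infinity. The functions
  \<open>w\<^sub>n\<close> need not converge pointwise, because passing to a higher level changes
  the distance to the top by an offset that depends on the point. Hence weak limits, with the danger
  of a zero limit; testing on the cells of the fixed level m averts it. The eigenvalue relation
  survives since it is linear and holds, at almost every point, from some index on, so that it
  passes to combinations of a tail. Ergodicity enters through the support of an eigenfunction, which
  must have full measure; only then can the function be normalised to modulus 1. The analytic half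
  sees the diagram only through towers, distances to their tops and differences of these distances,
  and is therefore carried out in a locale of its own.\<close>

lemma card_above_bij_betw:
  fixes L :: "'a \<Rightarrow> 'a \<Rightarrow> bool"
  assumes fin: "finite A"
    and irrefl: "\<And>x. \<not> L x x"
    and trans: "\<And>x y z. L x y \<Longrightarrow> L y z \<Longrightarrow> L x z"
    and total: "\<And>x y. x \<in> A \<Longrightarrow> y \<in> A \<Longrightarrow> x \<noteq> y \<Longrightarrow> L x y \<or> L y x"
  shows "bij_betw (\<lambda>p. card {q \<in> A. L p q}) A {..<card A}"
proof -
  \<comment> \<open>Moving up to y loses at least y itself from the set counted. Strict decrease
    makes the count injective, and an injection into a set of the same finite size is a
    bijection.\<close>
  have less: "card {q \<in> A. L y q} < card {q \<in> A. L x q}" if "y \<in> A" "L x y" for x y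
  proof (rule psubset_card_mono)
    show "{q \<in> A. L y q} \<subset> {q \<in> A. L x q}"
      using that irrefl trans by blast
  qed (use fin in simp)
  have inj: "inj_on (\<lambda>p. card {q \<in> A. L p q}) A"
  proof (rule inj_onI, rule ccontr)
    fix x y assume "x \<in> A" "y \<in> A" "card {q \<in> A. L x q} = card {q \<in> A. L y q}" "x \<noteq> y"
    then show False using total[of x y] less[of x y] less[of y x] by auto
  qed
  moreover have "(\<lambda>p. card {q \<in> A. L p q}) ` A \<subseteq> {..<card A}"
  proof safe
    fix p assume "p \<in> A"
    then have "{q \<in> A. L p q} \<subset> A" using irrefl by blast
    then show "card {q \<in> A. L p q} < card A" using fin by (rule psubset_card_mono[rotated])
  qed
  ultimately show ?thesis
    unfolding bij_betw_def by (metis card_image card_lessThan card_subset_eq finite_lessThan)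
qed

lemma finite_least_exists:
  assumes "finite A" "A \<noteq> {}"
    and irrefl: "\<And>x. \<not> L x x"
    and trans: "\<And>x y z. L x y \<Longrightarrow> L y z \<Longrightarrow> L x z"
  obtains a where "a \<in> A" "\<And>x. x \<in> A \<Longrightarrow> \<not> L x a"
proof -
  have "\<exists>a\<in>A. \<forall>x\<in>A. \<not> L x a"
    using assms(1,2)
  proof (induction rule: finite_ne_induct)
    case (singleton x) then show ?case using irrefl by blast
  next
    case (insert x F)
    then obtain a where a: "a \<in> F" "\<forall>y\<in>F. \<not> L y a" by blast
    show ?case
    proof (cases "L x a")
      case True
      then have "\<forall>y\<in>insert x F. \<not> L y x" using a irrefl trans by blast
      then show ?thesis by blast
    next
      case False then show ?thesis using a by blast
    qed
  qed
  then show ?thesis using that by blast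
qed

text \<open>Paths are \<open>undefined\<close> outside their interval, so the join of a path on
  \<open>{l<..m}\<close> with one on \<open>{m<..n}\<close> is again extensional and hence literally
  a member of \<open>paths B l n\<close>.\<close>

definition pjoin :: "nat \<Rightarrow> (nat \<Rightarrow> 'e) \<Rightarrow> (nat \<Rightarrow> 'e) \<Rightarrow> nat \<Rightarrow> 'e" where
  "pjoin m p q = (\<lambda>i. if i \<le> m then p i else q i)"

definition paths_to :: "'e ordered_bratteli \<Rightarrow> nat \<Rightarrow> nat \<Rightarrow> nat \<Rightarrow> (nat \<Rightarrow> 'e) set" where
  "paths_to B m n v = {p \<in> paths B m n. rng B (p n) = v}"

definition paths_between ::
  "'e ordered_bratteli \<Rightarrow> nat \<Rightarrow> nat \<Rightarrow> nat \<Rightarrow> nat \<Rightarrow> (nat \<Rightarrow> 'e) set" where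
  "paths_between B m n u v =
     {p \<in> paths B m n. src B (p (Suc m)) = u \<and> rng B (p n) = v}"

definition above :: "'e ordered_bratteli \<Rightarrow> nat \<Rightarrow> nat \<Rightarrow> (nat \<Rightarrow> 'e) \<Rightarrow> (nat \<Rightarrow> 'e) set" where
  "above B m n p = {q. path_less B m n p q}"

text \<open>For the path \<open>q\<close> of \<open>x\<close> this is \<open>\<langle>s\<^sub>m\<^sub>,\<^sub>n(x), h\<^sub>m\<rangle>\<close>, summed over paths instead of vertices; distinct paths
  \<open>q\<close> from \<open>u\<close> to \<open>v\<close> have distinct offsets.\<close>

definition path_offset :: "'e ordered_bratteli \<Rightarrow> nat \<Rightarrow> nat \<Rightarrow> (nat \<Rightarrow> 'e) \<Rightarrow> nat" where
  "path_offset B m n q = (\<Sum>e \<in> above B m n q. tower_height B m (src B (e (Suc m))))"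

text \<open>The numerical counterpart of \<open>suffix_set\<close>. The vectors enter the theorem
  only through their pairing with the heights, so everything after the combinatorial part works with
  these numbers.\<close>

definition offsets :: "'e ordered_bratteli \<Rightarrow> nat \<Rightarrow> nat \<Rightarrow> nat \<Rightarrow> nat \<Rightarrow> nat set" where
  "offsets B m n u v = path_offset B m n ` paths_between B m n u v"

text \<open>The number of steps from \<open>x\<close> up to the top of its tower of level \<open>n\<close>.\<close>

definition depth :: "'e ordered_bratteli \<Rightarrow> nat \<Rightarrow> (nat \<Rightarrow> 'e) \<Rightarrow> nat" where
  "depth B n x = card (above B 0 n (restrict x {0<..n}))"

locale ordered_diagram =
  fixes B :: "'e ordered_bratteli"
  assumes ordered: "ordered_bratteli_diagram B"
begin

lemma diagram: "bratteli_diagram B"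
  using ordered by (simp add: ordered_bratteli_diagram_def)

lemma finite_verts: "finite (verts B n)"
  using diagram by (auto simp: bratteli_diagram_def)

lemma finite_edges: "n \<ge> 1 \<Longrightarrow> finite (edges B n)"
  using diagram by (auto simp: bratteli_diagram_def)

lemma src_in: "n \<ge> 1 \<Longrightarrow> e \<in> edges B n \<Longrightarrow> src B e \<in> verts B (n - 1)"
  and rng_in: "n \<ge> 1 \<Longrightarrow> e \<in> edges B n \<Longrightarrow> rng B e \<in> verts B n"
  using diagram by (auto simp: bratteli_diagram_def)

lemma out_edge: "v \<in> verts B n \<Longrightarrow> \<exists>e \<in> edges B (Suc n). src B e = v"
  using diagram by (auto simp: bratteli_diagram_def)

lemma in_edge: "n \<ge> 1 \<Longrightarrow> v \<in> verts B n \<Longrightarrow> \<exists>e \<in> edges B n. rng B e = v"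
  using diagram by (auto simp: bratteli_diagram_def)

lemma partial_order: "partial_order_on (\<Union>n\<in>{1..}. edges B n) (edge_ord B)"
  using ordered by (simp add: ordered_bratteli_diagram_def)

lemma comparable_iff:
  "m \<ge> 1 \<Longrightarrow> n \<ge> 1 \<Longrightarrow> e \<in> edges B m \<Longrightarrow> f \<in> edges B n \<Longrightarrow>
    ((e, f) \<in> edge_ord B \<or> (f, e) \<in> edge_ord B) \<longleftrightarrow> m = n \<and> rng B e = rng B f"
  using ordered by (simp add: ordered_bratteli_diagram_def)

section \<open>The strict orders on edges and on paths\<close>

lemma edge_less_irrefl: "\<not> edge_less B e e"
  by (simp add: edge_less_def)

lemma edge_less_trans: "edge_less B e f \<Longrightarrow> edge_less B f g \<Longrightarrow> edge_less B e g"
  using partial_order_onD(2,3)[OF partial_order]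
  unfolding edge_less_def by (metis antisymD transD)

text \<open>The order lives on the union of all edge levels and comparable edges share level and
  range, so the level of either edge fixes that of the other.\<close>

lemma edge_less_rng:
  assumes "n \<ge> 1" "edge_less B e f" "e \<in> edges B n \<or> f \<in> edges B n"
  shows "e \<in> edges B n" "f \<in> edges B n" "rng B e = rng B f"
proof -
  have "(e, f) \<in> edge_ord B" using assms by (simp add: edge_less_def)
  then obtain k l where "k \<ge> 1" "e \<in> edges B k" "l \<ge> 1" "f \<in> edges B l"
    using partial_order_onD(4)[OF partial_order] by auto
  with comparable_iff \<open>(e, f) \<in> edge_ord B\<close> assms
  show "e \<in> edges B n" "f \<in> edges B n" "rng B e = rng B f" by blast+
qed

lemma edge_less_total:
  "n \<ge> 1 \<Longrightarrow> e \<in> edges B n \<Longrightarrow> f \<in> edges B n \<Longrightarrow> rng B e = rng B f \<Longrightarrow> e \<noteq> f \<Longrightarrow>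
    edge_less B e f \<or> edge_less B f e"
  using comparable_iff[of n n e f] by (auto simp: edge_less_def)

lemma finite_paths: "finite (paths B m n)"
  unfolding paths_def by (rule finite_subset[OF _ finite_PiE[of "{m<..n}" "edges B"]])
    (use finite_edges in auto)

lemma finite_paths_to: "finite (paths_to B m n v)"
  and finite_paths_between: "finite (paths_between B m n u v)"
  and finite_above: "finite (above B m n p)"
  by (rule finite_subset[OF _ finite_paths[of m n]];
      auto simp: paths_to_def paths_between_def above_def path_less_def)+

lemma paths_edge: "p \<in> paths B m n \<Longrightarrow> m < i \<Longrightarrow> i \<le> n \<Longrightarrow> p i \<in> edges B i"
  by (auto simp: paths_def PiE_def Pi_def)

lemma paths_link: "p \<in> paths B m n \<Longrightarrow> m < i \<Longrightarrow> i < n \<Longrightarrow> rng B (p i) = src B (p (Suc i))"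
  by (auto simp: paths_def)

lemma paths_extensional: "p \<in> paths B m n \<Longrightarrow> \<not> (m < i \<and> i \<le> n) \<Longrightarrow> p i = undefined"
  by (auto simp: paths_def PiE_def extensional_def)

lemma pathsI:
  assumes "\<And>i. m < i \<Longrightarrow> i \<le> n \<Longrightarrow> p i \<in> edges B i"
    and "\<And>i. m < i \<Longrightarrow> i < n \<Longrightarrow> rng B (p i) = src B (p (Suc i))"
    and "\<And>i. \<not> (m < i \<and> i \<le> n) \<Longrightarrow> p i = undefined"
  shows "p \<in> paths B m n"
  using assms unfolding paths_def by (intro CollectI conjI PiE_I) auto

lemma path_less_irrefl: "\<not> path_less B m n p p"
  by (auto simp: path_less_def edge_less_def)

text \<open>The higher of the two deciding levels decides for the pair p, r; if they coincide,
  transitivity on edges does.\<close>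

lemma path_less_trans:
  assumes "path_less B m n p q" "path_less B m n q r"
  shows "path_less B m n p r"
proof -
  obtain k where k: "k \<in> {m<..n}" "edge_less B (p k) (q k)" "\<forall>j\<in>{k<..n}. p j = q j"
    using assms by (auto simp: path_less_def)
  obtain l where l: "l \<in> {m<..n}" "edge_less B (q l) (r l)" "\<forall>j\<in>{l<..n}. q j = r j"
    using assms by (auto simp: path_less_def)
  have "\<exists>k\<in>{m<..n}. edge_less B (p k) (r k) \<and> (\<forall>j\<in>{k<..n}. p j = r j)"
  proof (cases k l rule: linorder_cases)
    case less then show ?thesis using k l by (intro bexI[of _ l]) auto
  next
    case equal then show ?thesis using k l edge_less_trans by (intro bexI[of _ l]) auto
  next
    case greater then show ?thesis using k l by (intro bexI[of _ k]) auto
  qed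
  then show ?thesis using assms by (auto simp: path_less_def)
qed

text \<open>At the last level where p and q differ the two edges have the same range: it is either
  the common end of the paths or the source of the next, common edge. Edges with a common range are
  comparable.\<close>

lemma path_less_total:
  assumes p: "p \<in> paths B m n" and q: "q \<in> paths B m n" and r: "rng B (p n) = rng B (q n)"
    and ne: "p \<noteq> q"
  shows "path_less B m n p q \<or> path_less B m n q p"
proof -
  let ?D = "{i. p i \<noteq> q i}"
  have sub: "?D \<subseteq> {m<..n}"
  proof
    fix i assume "i \<in> ?D"
    then show "i \<in> {m<..n}" using paths_extensional[OF p, of i] paths_extensional[OF q, of i]
      by (cases "m < i \<and> i \<le> n") auto
  qed
  then have fin: "finite ?D" by (rule finite_subset) simp
  have "?D \<noteq> {}" using ne by auto
  define k where "k = Max ?D"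
  have k: "p k \<noteq> q k" using Max_in[OF fin \<open>?D \<noteq> {}\<close>] by (simp add: k_def)
  have above: "p j = q j" if "k < j" for j
    using Max_ge[OF fin, of j] that by (force simp: k_def)
  have kmn: "m < k" "k \<le> n" using sub k by auto
  have "rng B (p k) = rng B (q k)"
  proof (cases "k = n")
    case False
    then show ?thesis using above[of "Suc k"] kmn paths_link[OF p, of k] paths_link[OF q, of k] by simp
  qed (use r in simp)
  then have "edge_less B (p k) (q k) \<or> edge_less B (q k) (p k)"
    using edge_less_total[of k] kmn k paths_edge[OF p kmn] paths_edge[OF q kmn] by simp
  then show ?thesis
    unfolding path_less_def using p q r above kmn by (metis greaterThanAtMost_iff)
qed

text \<open>The paths into one vertex form a finite chain, so each is identified by its rank counted
  from the top. This rank is what becomes the depth.\<close>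

lemma bij_card_above:
  "bij_betw (\<lambda>p. card (above B m n p)) (paths_to B m n v) {..<card (paths_to B m n v)}"
proof -
  have "bij_betw (\<lambda>p. card {q \<in> paths_to B m n v. path_less B m n p q})
      (paths_to B m n v) {..<card (paths_to B m n v)}"
    by (intro card_above_bij_betw finite_paths_to path_less_irrefl)
       (auto simp: paths_to_def intro: path_less_trans dest: path_less_total)
  moreover have "{q \<in> paths_to B m n v. path_less B m n p q} = above B m n p"
    if "p \<in> paths_to B m n v" for p
    using that by (auto simp: paths_to_def above_def path_less_def)
  ultimately show ?thesis by (simp cong: bij_betw_cong)
qed

lemma tower_height_eq: "n \<ge> 1 \<Longrightarrow> tower_height B n u = card (paths_to B 0 n u)"
  by (simp add: tower_height_def paths_to_def)

section \<open>Cutting and joining paths at an intermediate level\<close>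

lemma restrict_paths:
  "r \<in> paths B l n \<Longrightarrow> l \<le> a \<Longrightarrow> b \<le> n \<Longrightarrow> restrict r {a<..b} \<in> paths B a b"
  by (rule pathsI) (auto intro: paths_edge paths_link)

lemma pjoin_paths:
  assumes "p \<in> paths B l m" "q \<in> paths B m n" "l < m" "m < n" "rng B (p m) = src B (q (Suc m))"
  shows "pjoin m p q \<in> paths B l n"
proof (rule pathsI)
  fix i assume "l < i" "i < n"
  then show "rng B (pjoin m p q i) = src B (pjoin m p q (Suc i))"
    using assms paths_link[of p l m i] paths_link[of q m n i] by (cases "i = m") (auto simp: pjoin_def)
qed (use assms paths_edge paths_extensional in \<open>auto simp: pjoin_def\<close>)

lemma pjoin_restrict:
  assumes "r \<in> paths B l n" "l \<le> m" "m \<le> n"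
  shows "pjoin m (restrict r {l<..m}) (restrict r {m<..n}) = r"
  using assms paths_extensional[OF assms(1)] by (auto simp: pjoin_def fun_eq_iff)

lemma pjoin_eqD:
  assumes "p \<in> paths B l m" "q \<in> paths B m n" "p' \<in> paths B l m" "q' \<in> paths B m n"
    "pjoin m p q = pjoin m p' q'"
  shows "p = p'" "q = q'"
proof -
  have *: "pjoin m p q i = pjoin m p' q' i" for i using assms(5) by simp
  show "p = p'"
  proof
    fix i show "p i = p' i"
      using *[of i] paths_extensional[OF assms(1), of i] paths_extensional[OF assms(3), of i]
      by (auto simp: pjoin_def split: if_splits)
  qed
  show "q = q'"
  proof
    fix i show "q i = q' i"
      using *[of i] paths_extensional[OF assms(2), of i] paths_extensional[OF assms(4), of i]
      by (auto simp: pjoin_def split: if_splits)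
  qed
qed

text \<open>The order is lexicographic with the upper segment dominating: the last difference lies
  above level m and concerns only q and q', or it lies at most at m and then q and q' agree.\<close>

lemma path_less_pjoin:
  assumes p: "p \<in> paths B l m" "p' \<in> paths B l m" and q: "q \<in> paths B m n" "q' \<in> paths B m n"
    and lmn: "l < m" "m < n"
    and link: "rng B (p m) = src B (q (Suc m))" "rng B (p' m) = src B (q' (Suc m))"
  shows "path_less B l n (pjoin m p q) (pjoin m p' q') \<longleftrightarrow>
    path_less B m n q q' \<or> q = q' \<and> path_less B l m p p'"
    (is "?L \<longleftrightarrow> ?R")
proof
  assume ?L
  then obtain k where k: "l < k" "k \<le> n" "edge_less B (pjoin m p q k) (pjoin m p' q' k)"
    "\<forall>j\<in>{k<..n}. pjoin m p q j = pjoin m p' q' j" and r: "rng B (q n) = rng B (q' n)"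
    using lmn by (auto simp: path_less_def pjoin_def)
  show ?R
  proof (cases "k \<le> m")
    case True
    have "q j = q' j" for j
      using k(4)[rule_format, of j] paths_extensional[OF q(1), of j] paths_extensional[OF q(2), of j] True
      by (cases "m < j \<and> j \<le> n") (auto simp: pjoin_def)
    then have "q = q'" by auto
    moreover have "path_less B l m p p'"
      unfolding path_less_def
    proof (intro conjI bexI[of _ k] ballI)
      fix j assume "j \<in> {k<..m}"
      then show "p j = p' j" using k(4)[rule_format, of j] lmn by (auto simp: pjoin_def)
    qed (use p link k True \<open>q = q'\<close> in \<open>auto simp: pjoin_def\<close>)
    ultimately show ?thesis by simp
  next
    case False
    have "path_less B m n q q'"
      unfolding path_less_def
    proof (intro conjI bexI[of _ k] ballI)
      fix j assume "j \<in> {k<..n}"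
      then show "q j = q' j" using k(4)[rule_format, of j] False by (auto simp: pjoin_def)
    qed (use q k r False in \<open>auto simp: pjoin_def\<close>)
    then show ?thesis by simp
  qed
next
  assume R: ?R
  have J: "pjoin m p q \<in> paths B l n" "pjoin m p' q' \<in> paths B l n"
    using pjoin_paths p q lmn link by auto
  from R consider (1) "path_less B m n q q'" | (2) "q = q'" "path_less B l m p p'" by blast
  then show ?L
  proof cases
    case 1
    then obtain k where "k \<in> {m<..n}" "edge_less B (q k) (q' k)" "\<forall>j\<in>{k<..n}. q j = q' j"
      "rng B (q n) = rng B (q' n)" by (auto simp: path_less_def)
    then show ?thesis using J lmn unfolding path_less_def
      by (intro conjI bexI[of _ k]) (auto simp: pjoin_def)
  next
    case 2
    then obtain k where "k \<in> {l<..m}" "edge_less B (p k) (p' k)" "\<forall>j\<in>{k<..m}. p j = p' j"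
      by (auto simp: path_less_def)
    then show ?thesis using J lmn 2 unfolding path_less_def
      by (intro conjI bexI[of _ k]) (auto simp: pjoin_def)
  qed
qed

lemma above_pjoin:
  assumes p: "p \<in> paths B l m" and q: "q \<in> paths B m n" and lmn: "l < m" "m < n"
    and link: "rng B (p m) = src B (q (Suc m))"
  shows "above B l n (pjoin m p q) =
    (\<lambda>p'. pjoin m p' q) ` above B l m p \<union>
    (\<lambda>(e, p'). pjoin m p' e) ` (SIGMA e:above B m n q. paths_to B l m (src B (e (Suc m))))"
    (is "?A = ?S \<union> ?U")
proof
  show "?A \<subseteq> ?S \<union> ?U"
  proof
    fix r assume r: "r \<in> ?A"
    let ?p' = "restrict r {l<..m}" and ?q' = "restrict r {m<..n}"
    have rp: "r \<in> paths B l n" using r by (auto simp: above_def path_less_def)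
    have rj: "pjoin m ?p' ?q' = r" using pjoin_restrict[OF rp] lmn by simp
    have P: "?p' \<in> paths B l m" "?q' \<in> paths B m n" using restrict_paths[OF rp] lmn by auto
    have L: "rng B (?p' m) = src B (?q' (Suc m))" using paths_link[OF rp, of m] lmn by simp
    from r rj have "path_less B l n (pjoin m p q) (pjoin m ?p' ?q')" by (simp add: above_def)
    then have "path_less B m n q ?q' \<or> q = ?q' \<and> path_less B l m p ?p'"
      using path_less_pjoin[OF p P(1) q P(2) lmn link L] by blast
    then show "r \<in> ?S \<union> ?U"
    proof
      assume "path_less B m n q ?q'"
      then have "(?q', ?p') \<in> (SIGMA e:above B m n q. paths_to B l m (src B (e (Suc m))))"
        using P L by (auto simp: above_def paths_to_def)
      then have "(case (?q', ?p') of (e, p') \<Rightarrow> pjoin m p' e) \<in> ?U" by (rule imageI)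
      then show ?thesis using rj by simp
    next
      assume "q = ?q' \<and> path_less B l m p ?p'"
      then show ?thesis using rj by (auto simp: above_def intro!: image_eqI[of _ _ ?p'])
    qed
  qed
  show "?S \<union> ?U \<subseteq> ?A"
  proof (intro Un_least image_subsetI)
    fix p' assume "p' \<in> above B l m p"
    then have *: "path_less B l m p p'" by (simp add: above_def)
    then have "p' \<in> paths B l m" "rng B (p' m) = src B (q (Suc m))"
      using link by (auto simp: path_less_def)
    then show "pjoin m p' q \<in> ?A"
      using path_less_pjoin[OF p _ q q lmn link] * by (simp add: above_def)
  next
    fix ep assume "ep \<in> (SIGMA e:above B m n q. paths_to B l m (src B (e (Suc m))))"
    then obtain e p' where ep: "ep = (e, p')" "path_less B m n q e" "p' \<in> paths B l m"
      "rng B (p' m) = src B (e (Suc m))" by (auto simp: above_def paths_to_def)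
    then have "e \<in> paths B m n" by (simp add: path_less_def)
    then show "(case ep of (e, p') \<Rightarrow> pjoin m p' e) \<in> ?A"
      using path_less_pjoin[OF p ep(3) q \<open>e \<in> paths B m n\<close> lmn link ep(4)] ep by (simp add: above_def)
  qed
qed

text \<open>This is the additivity of the distance to the top. The paths above the join either keep
  q and raise p, or replace q by a larger e, below which every path to the source of e is allowed;
  the latter contribute the height of that source.\<close>

lemma card_above_pjoin:
  assumes p: "p \<in> paths B 0 m" and q: "q \<in> paths B m n" and mn: "0 < m" "m < n"
    and link: "rng B (p m) = src B (q (Suc m))"
  shows "card (above B 0 n (pjoin m p q)) = card (above B 0 m p) + path_offset B m n q"
proof -
  let ?S = "(\<lambda>p'. pjoin m p' q) ` above B 0 m p"
  let ?Sig = "SIGMA e:above B m n q. paths_to B 0 m (src B (e (Suc m)))"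
  let ?U = "(\<lambda>(e, p'). pjoin m p' e) ` ?Sig"
  have ab: "above B 0 m p \<subseteq> paths B 0 m" "above B m n q \<subseteq> paths B m n"
    by (auto simp: above_def path_less_def)
  have "card ?S = card (above B 0 m p)"
  proof (rule card_image, rule inj_onI)
    fix x y assume "x \<in> above B 0 m p" "y \<in> above B 0 m p" "pjoin m x q = pjoin m y q"
    then show "x = y" using pjoin_eqD(1)[OF _ q _ q] ab by blast
  qed
  moreover have "card ?U = path_offset B m n q"
  proof -
    have "card ?U = card ?Sig"
    proof (rule card_image, rule inj_onI)
      fix x y assume xy: "x \<in> ?Sig" "y \<in> ?Sig"
        "(case x of (e, p') \<Rightarrow> pjoin m p' e) = (case y of (e, p') \<Rightarrow> pjoin m p' e)"
      obtain a b c d where s: "x = (a, b)" "y = (c, d)" by (metis surj_pair)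
      have "a \<in> paths B m n" "c \<in> paths B m n" "b \<in> paths B 0 m" "d \<in> paths B 0 m"
        using xy s ab by (auto simp: paths_to_def)
      then show "x = y" using pjoin_eqD[of b 0 m a n d c] xy(3) s by simp
    qed
    also have "\<dots> = path_offset B m n q"
      using mn by (simp add: card_SigmaI finite_above finite_paths_to path_offset_def tower_height_eq)
    finally show ?thesis .
  qed
  moreover have "?S \<inter> ?U = {}"
  proof safe
    fix p1 e p2 assume a: "p1 \<in> above B 0 m p" "e \<in> above B m n q"
      "p2 \<in> paths_to B 0 m (src B (e (Suc m)))" "pjoin m p1 q = pjoin m p2 e"
    then have "q = e" using pjoin_eqD(2)[OF _ q, of p1 0 p2 e] ab by (auto simp: paths_to_def)
    then show "pjoin m p1 q \<in> {}" using a path_less_irrefl by (auto simp: above_def)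
  qed
  ultimately show ?thesis
    unfolding above_pjoin[OF p q mn link]
    by (subst card_Un_disjoint) (auto simp: finite_above finite_paths_to)
qed

section \<open>Path counts and incidence matrices\<close>

lemma paths_single:
  "bij_betw (\<lambda>p. p (Suc n)) (paths_between B n (Suc n) u v)
    {e \<in> edges B (Suc n). src B e = u \<and> rng B e = v}"
proof (rule bij_betwI[where g = "\<lambda>e. \<lambda>i\<in>{n<..Suc n}. e"])
  show "(\<lambda>e. \<lambda>i\<in>{n<..Suc n}. e) \<in> {e \<in> edges B (Suc n). src B e = u \<and> rng B e = v} \<rightarrow>
    paths_between B n (Suc n) u v"
  proof
    fix e assume e: "e \<in> {e \<in> edges B (Suc n). src B e = u \<and> rng B e = v}"
    have "(\<lambda>i\<in>{n<..Suc n}. e) \<in> paths B n (Suc n)"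
      by (rule pathsI) (use e in \<open>auto simp: le_Suc_eq\<close>)
    then show "(\<lambda>i\<in>{n<..Suc n}. e) \<in> paths_between B n (Suc n) u v"
      using e by (simp add: paths_between_def)
  qed
  fix p assume p: "p \<in> paths_between B n (Suc n) u v"
  show "(\<lambda>i\<in>{n<..Suc n}. p (Suc n)) = p"
  proof
    fix i show "(\<lambda>i\<in>{n<..Suc n}. p (Suc n)) i = p i"
      using p paths_extensional[of p n "Suc n" i]
      by (cases "i = Suc n") (auto simp: paths_between_def)
  qed
qed (auto simp: paths_between_def intro: paths_edge)

lemma card_paths_single: "card (paths_between B n (Suc n) u v) = incidence B (Suc n) u v"
  unfolding incidence_def by (rule bij_betw_same_card[OF paths_single])

lemma card_paths_split:
  assumes "l < m" "m < n"
  shows "card (paths_between B l n u v) =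
    (\<Sum>w\<in>verts B m. card (paths_between B l m u w) * card (paths_between B m n w v))"
proof -
  let ?Q = "\<lambda>w. paths_between B l m u w \<times> paths_between B m n w v"
  have "bij_betw (\<lambda>r. (restrict r {l<..m}, restrict r {m<..n})) (paths_between B l n u v)
    (\<Union>w\<in>verts B m. ?Q w)"
  proof (rule bij_betwI[where g = "\<lambda>(p, q). pjoin m p q"])
    show "(\<lambda>r. (restrict r {l<..m}, restrict r {m<..n})) \<in> paths_between B l n u v \<rightarrow> (\<Union>w\<in>verts B m. ?Q w)"
    proof
      fix r assume r: "r \<in> paths_between B l n u v"
      then have rp: "r \<in> paths B l n" by (simp add: paths_between_def)
      have "rng B (r m) \<in> verts B m" using rng_in[of m] paths_edge[OF rp, of m] assms by auto
      then show "(restrict r {l<..m}, restrict r {m<..n}) \<in> (\<Union>w\<in>verts B m. ?Q w)"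
        using r restrict_paths[OF rp] paths_link[OF rp, of m] assms
        by (intro UN_I[of "rng B (r m)"]) (auto simp: paths_between_def)
    qed
    show "(\<lambda>(p, q). pjoin m p q) \<in> (\<Union>w\<in>verts B m. ?Q w) \<rightarrow> paths_between B l n u v"
      using assms pjoin_paths by (auto simp: paths_between_def) (auto simp: pjoin_def)
    fix r assume "r \<in> paths_between B l n u v"
    then show "(case (restrict r {l<..m}, restrict r {m<..n}) of (p, q) \<Rightarrow> pjoin m p q) = r"
      using pjoin_restrict[of r l n m] assms by (auto simp: paths_between_def)
  next
    fix y assume "y \<in> (\<Union>w\<in>verts B m. ?Q w)"
    then obtain p q where y: "y = (p, q)" "p \<in> paths B l m" "q \<in> paths B m n"
      by (auto simp: paths_between_def)
    have "restrict (pjoin m p q) {l<..m} = p" "restrict (pjoin m p q) {m<..n} = q"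
      using paths_extensional[OF y(2)] paths_extensional[OF y(3)] assms
      by (auto simp: fun_eq_iff pjoin_def restrict_def)
    then show "(restrict (case y of (p, q) \<Rightarrow> pjoin m p q) {l<..m},
      restrict (case y of (p, q) \<Rightarrow> pjoin m p q) {m<..n}) = y" using y by simp
  qed
  then have "card (paths_between B l n u v) = card (\<Union>w\<in>verts B m. ?Q w)"
    by (rule bij_betw_same_card)
  also have "\<dots> = (\<Sum>w\<in>verts B m. card (?Q w))"
    by (rule card_UN_disjoint)
       (use assms in \<open>auto simp: finite_verts finite_paths_between\<close>, auto simp: paths_between_def)
  finally show ?thesis by (simp add: card_cartesian_product)
qed

text \<open>Splitting off the last edge gives path counts the recursion of the matrix product. In
  the base case the identity matrix picks out the summand u, which occurs because u is a vertex of
  level m.\<close>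

lemma card_paths_between:
  assumes "m < n" "u \<in> verts B m" shows "card (paths_between B m n u v) = incidence_prod B m n u v"
  using assms(1)
proof (induction n arbitrary: v)
  case (Suc n)
  show ?case
  proof (cases "m = n")
    case True
    have id: "incidence_prod B n n u w = (if u = w then 1 else 0)" for w by (cases n) auto
    show ?thesis using True assms(2) by (simp add: card_paths_single id finite_verts if_distrib[of "\<lambda>x. x * _"] cong: if_cong)
  next
    case False
    then have "m < n" using Suc by simp
    then show ?thesis using Suc card_paths_split[of m n "Suc n" u v] by (simp add: card_paths_single)
  qed
qed simp

lemma path_ending_with:
  assumes "n \<ge> 1" "e \<in> edges B n" shows "\<exists>p \<in> paths B 0 n. p n = e"
  using assms
proof (induction n arbitrary: e rule: nat_induct_at_least)
  case base
  have "(\<lambda>i\<in>{0<..Suc 0}. e) \<in> paths B 0 (Suc 0)"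
    by (rule pathsI) (use base in \<open>auto simp: le_Suc_eq\<close>)
  then show ?case by (intro bexI[of _ "\<lambda>i\<in>{0<..Suc 0}. e"]) auto
next
  case (Suc n)
  then have "src B e \<in> verts B n" using src_in[of "Suc n" e] by simp
  then obtain f where "f \<in> edges B n" "rng B f = src B e" using in_edge Suc by blast
  then obtain p where p: "p \<in> paths B 0 n" "rng B (p n) = src B e" using Suc.IH by auto
  have q: "(\<lambda>i\<in>{n<..Suc n}. e) \<in> paths B n (Suc n)"
    by (rule pathsI) (use Suc in \<open>auto simp: le_Suc_eq\<close>)
  have "pjoin n p (\<lambda>i\<in>{n<..Suc n}. e) \<in> paths B 0 (Suc n)"
    using pjoin_paths[OF p(1) q] Suc p by auto
  then show ?case by (rule bexI[rotated]) (simp add: pjoin_def)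
qed

lemma paths_to_nonempty:
  assumes "n \<ge> 1" "v \<in> verts B n" shows "paths_to B 0 n v \<noteq> {}"
  using in_edge[OF assms] path_ending_with[OF assms(1)] by (force simp: paths_to_def)

lemma tower_height_pos: "n \<ge> 1 \<Longrightarrow> v \<in> verts B n \<Longrightarrow> tower_height B n v > 0"
  by (simp add: tower_height_eq card_gt_0_iff finite_paths_to paths_to_nonempty)

section \<open>Infinite paths, their depths and offsets\<close>

lemma inf_paths_edge: "x \<in> inf_paths B \<Longrightarrow> i \<ge> 1 \<Longrightarrow> x i \<in> edges B i"
  and inf_paths_link: "x \<in> inf_paths B \<Longrightarrow> i \<ge> 1 \<Longrightarrow> rng B (x i) = src B (x (Suc i))"
  by (auto simp: inf_paths_def)

lemma restrict_inf_paths: "x \<in> inf_paths B \<Longrightarrow> restrict x {m<..n} \<in> paths B m n"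
  by (rule pathsI) (auto simp: inf_paths_link inf_paths_edge)

lemma extend_path:
  assumes p: "p \<in> paths B 0 n" and n: "n \<ge> 1"
  obtains x where "x \<in> inf_paths B" "restrict x {0<..n} = p"
proof -
  \<comment> \<open>The sequence of chosen edges starts with the last edge of p itself, so that the
    link at level n is covered by the same choice condition as all later links.\<close>
  have "\<exists>f. \<forall>k. (f k \<in> edges B (n + k) \<and> (k = 0 \<longrightarrow> f k = p n)) \<and> src B (f (Suc k)) = rng B (f k)"
  proof (rule dependent_nat_choice)
    show "\<exists>x. x \<in> edges B (n + 0) \<and> (0 = (0::nat) \<longrightarrow> x = p n)" using paths_edge[OF p, of n] n by auto
  next
    fix x k assume x: "x \<in> edges B (n + k) \<and> (k = 0 \<longrightarrow> x = p n)"
    then have "rng B x \<in> verts B (n + k)" using rng_in[of "n+k" x] n by simp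
    then show "\<exists>y. (y \<in> edges B (n + Suc k) \<and> (Suc k = 0 \<longrightarrow> y = p n)) \<and> src B y = rng B x"
      using out_edge by auto
  qed
  then obtain f where f: "\<And>k. f k \<in> edges B (n + k)" "f 0 = p n" "\<And>k. src B (f (Suc k)) = rng B (f k)"
    by blast
  define x where "x i = (if i \<le> n then p i else f (i - n))" for i
  have "x \<in> inf_paths B"
    unfolding inf_paths_def
  proof (intro CollectI conjI PiE_I allI impI)
    fix i :: nat assume i: "i \<in> {1..}"
    then show "x i \<in> edges B i"
      using paths_edge[OF p, of i] f(1)[of "i - n"] by (auto simp: x_def)
  next
    fix i :: nat assume i: "i \<notin> {1..}"
    then show "x i = undefined" using paths_extensional[OF p, of i] n by (auto simp: x_def)
  next
    fix i :: nat assume i: "i \<ge> 1"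
    consider "i < n" | "i = n" | "i > n" by linarith
    then show "rng B (x i) = src B (x (Suc i))"
    proof cases
      case 1 then show ?thesis using paths_link[OF p, of i] i by (simp add: x_def)
    next
      case 2 then show ?thesis using f(2) f(3)[of 0] by (simp add: x_def)
    next
      case 3 then show ?thesis using f(3)[of "i - n"] by (simp add: x_def Suc_diff_le)
    qed
  qed
  moreover have "restrict x {0<..n} = p"
    using paths_extensional[OF p] by (auto simp: x_def fun_eq_iff restrict_def)
  ultimately show ?thesis using that by blast
qed

lemma tau_in: "x \<in> inf_paths B \<Longrightarrow> n \<ge> 1 \<Longrightarrow> tau B n x \<in> verts B n"
  using rng_in inf_paths_edge by (auto simp: tau_def)

lemma prefix_in_paths_to:
  "x \<in> inf_paths B \<Longrightarrow> n \<ge> 1 \<Longrightarrow> restrict x {0<..n} \<in> paths_to B 0 n (tau B n x)"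
  using restrict_inf_paths[of x 0 n] by (auto simp: paths_to_def tau_def)

lemma depth_less: "x \<in> inf_paths B \<Longrightarrow> n \<ge> 1 \<Longrightarrow> depth B n x < tower_height B n (tau B n x)"
  using bij_card_above[of 0 n "tau B n x"] prefix_in_paths_to[of x n]
  by (auto simp: depth_def tower_height_eq bij_betw_def)

text \<open>Rank within a chain is injective. Together with \<open>prefix_eq_imp\<close> this
  identifies the sets of given tower and depth at level n with the cylinders over the first n
  edges.\<close>

lemma depth_inj:
  assumes "x \<in> inf_paths B" "y \<in> inf_paths B" "n \<ge> 1" "tau B n x = tau B n y" "depth B n x = depth B n y"
  shows "restrict x {0<..n} = restrict y {0<..n}"
  using bij_card_above[of 0 n "tau B n x"] prefix_in_paths_to[of x n] prefix_in_paths_to[of y n] assms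
  unfolding depth_def bij_betw_def by (metis inj_onD)

lemma prefix_eq_imp:
  assumes "restrict x {0<..n} = restrict y {0<..n}" "1 \<le> m" "m \<le> n"
  shows "tau B m x = tau B m y" "depth B m x = depth B m y"
proof -
  have *: "x i = y i" if "0 < i" "i \<le> n" for i
    using fun_cong[OF assms(1), of i] that by simp
  then show "tau B m x = tau B m y" using assms by (simp add: tau_def)
  have "restrict x {0<..m} = restrict y {0<..m}" using * assms by (auto simp: fun_eq_iff restrict_def)
  then show "depth B m x = depth B m y" by (simp add: depth_def)
qed

lemma depth_split:
  assumes x: "x \<in> inf_paths B" and mn: "1 \<le> m" "m < n"
  shows "depth B n x = depth B m x + path_offset B m n (restrict x {m<..n})"
    and "restrict x {m<..n} \<in> paths_between B m n (tau B m x) (tau B n x)"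
proof -
  have "pjoin m (restrict x {0<..m}) (restrict x {m<..n}) = restrict x {0<..n}"
    using mn by (auto simp: pjoin_def fun_eq_iff)
  then show "depth B n x = depth B m x + path_offset B m n (restrict x {m<..n})"
    using card_above_pjoin[of "restrict x {0<..m}" m "restrict x {m<..n}" n] mn
      restrict_inf_paths[OF x] inf_paths_link[OF x, of m] by (simp add: depth_def)
  show "restrict x {m<..n} \<in> paths_between B m n (tau B m x) (tau B n x)"
    using restrict_inf_paths[OF x] inf_paths_link[OF x, of m] mn
    by (auto simp: paths_between_def tau_def)
qed

lemma depth_split_offsets:
  assumes "x \<in> inf_paths B" "1 \<le> m" "m < n"
  shows "\<exists>\<sigma>\<in>offsets B m n (tau B m x) (tau B n x). depth B n x = depth B m x + \<sigma>"
  using depth_split[OF assms] by (auto simp: offsets_def)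

text \<open>The converse of \<open>depth_split\<close>: a path p into u with exactly j paths above
  it exists by \<open>bij_card_above\<close>; it is joined with q and continued to infinity.\<close>

lemma realize:
  assumes mn: "1 \<le> m" "m < n" and q: "q \<in> paths_between B m n u v" and j: "j < tower_height B m u"
  obtains x where "x \<in> inf_paths B" "tau B m x = u" "depth B m x = j" "tau B n x = v"
    "restrict x {m<..n} = q" "depth B n x = j + path_offset B m n q"
proof -
  have "j \<in> (\<lambda>p. card (above B 0 m p)) ` paths_to B 0 m u"
    using bij_card_above[of 0 m u] j mn by (auto simp: bij_betw_def tower_height_eq)
  then obtain p where p: "p \<in> paths_to B 0 m u" "j = card (above B 0 m p)" by auto
  have q': "q \<in> paths B m n" using q by (simp add: paths_between_def)
  have p': "p \<in> paths B 0 m" using p by (simp add: paths_to_def)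
  have link: "rng B (p m) = src B (q (Suc m))" using p q by (auto simp: paths_to_def paths_between_def)
  have "pjoin m p q \<in> paths B 0 n" using pjoin_paths[OF p' q' _ _ link] mn by simp
  then obtain x where x: "x \<in> inf_paths B" "restrict x {0<..n} = pjoin m p q"
    using extend_path[of _ n] mn by auto
  have xi: "x i = pjoin m p q i" if "0 < i" "i \<le> n" for i
    using fun_cong[OF x(2), of i] that by simp
  have rm: "restrict x {0<..m} = p"
    using paths_extensional[OF p'] mn xi by (auto simp: fun_eq_iff restrict_def pjoin_def)
  have rq: "restrict x {m<..n} = q"
    using paths_extensional[OF q'] mn xi by (auto simp: fun_eq_iff restrict_def pjoin_def)
  have "tau B m x = u" using xi[of m] mn p by (auto simp: tau_def pjoin_def paths_to_def)
  moreover have "tau B n x = v" using xi[of n] mn q by (auto simp: tau_def pjoin_def paths_between_def)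
  moreover have "depth B m x = j" using rm p by (simp add: depth_def)
  ultimately show ?thesis using that[of x] x rq depth_split(1)[OF x(1) mn] by simp
qed

text \<open>Two paths with equal offset are both realised below by the top of tower u, that is with
  depth 0 at level m. The resulting points then have the same tower and depth at level n, hence the
  same first n edges.\<close>

lemma inj_on_path_offset:
  assumes mn: "1 \<le> m" "m < n" and u: "u \<in> verts B m"
  shows "inj_on (path_offset B m n) (paths_between B m n u v)"
proof (rule inj_onI)
  fix q q' assume q: "q \<in> paths_between B m n u v" "q' \<in> paths_between B m n u v"
    and eq: "path_offset B m n q = path_offset B m n q'"
  have "0 < tower_height B m u" using tower_height_pos mn u by simp
  with q obtain x y where x: "x \<in> inf_paths B" "tau B n x = v" "restrict x {m<..n} = q"
      "depth B n x = 0 + path_offset B m n q"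
    and y: "y \<in> inf_paths B" "tau B n y = v" "restrict y {m<..n} = q'"
      "depth B n y = 0 + path_offset B m n q'"
    using realize[OF mn] by metis
  have "restrict x {0<..n} = restrict y {0<..n}"
    using depth_inj[OF x(1) y(1)] x y eq mn by simp
  from fun_cong[OF this] have "x i = y i" if "0 < i" "i \<le> n" for i
    using that by (metis greaterThanAtMost_iff restrict_apply')
  then have "restrict x {m<..n} = restrict y {m<..n}" by (auto simp: restrict_def fun_eq_iff)
  then show "q = q'" using x y by simp
qed

lemma finite_offsets: "finite (offsets B m n u v)"
  by (simp add: offsets_def finite_paths_between)

lemma card_offsets:
  assumes "1 \<le> m" "m < n" "u \<in> verts B m"
  shows "card (offsets B m n u v) = incidence_prod B m n u v"
  using assms by (simp add: offsets_def card_image[OF inj_on_path_offset] card_paths_between)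

lemma realize_offset:
  assumes "1 \<le> m" "m < n" "\<sigma> \<in> offsets B m n u v" "j < tower_height B m u"
  obtains x where "x \<in> inf_paths B" "tau B m x = u" "depth B m x = j" "tau B n x = v"
    "depth B n x = j + \<sigma>"
  using assms realize[OF assms(1,2)] unfolding offsets_def by blast

lemma height_inner_suffix_vector:
  assumes x: "x \<in> inf_paths B" and mn: "1 \<le> m" "m < n"
  shows "height_inner B m (suffix_vector B m n x) = path_offset B m n (restrict x {m<..n})"
proof -
  let ?A = "above B m n (restrict x {m<..n})"
  have s: "src B (e (Suc m)) \<in> verts B m" if "e \<in> ?A" for e
    using src_in[of "Suc m" "e (Suc m)"] paths_edge[of e m n "Suc m"] that mn
    by (auto simp: above_def path_less_def)
  have "path_offset B m n (restrict x {m<..n}) =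
      (\<Sum>u\<in>verts B m. \<Sum>e\<in>{e\<in>?A. src B (e (Suc m)) = u}. tower_height B m (src B (e (Suc m))))"
    unfolding path_offset_def
    by (rule sum.group[symmetric]) (use s in \<open>auto simp: finite_verts finite_above\<close>)
  also have "\<dots> = (\<Sum>u\<in>verts B m. card {e\<in>?A. src B (e (Suc m)) = u} * tower_height B m u)"
    by (intro sum.cong) auto
  also have "\<dots> = height_inner B m (suffix_vector B m n x)"
    unfolding height_inner_def suffix_vector_def above_def
    by (intro sum.cong arg_cong2[where f = times] refl)
       (auto intro!: arg_cong[where f = card] simp: path_less_def)
  finally show ?thesis by simp
qed

text \<open>Pairing with the heights is a bijection from suffix vectors to offsets: the paired value
  determines the path by \<open>inj_on_path_offset\<close>, and the path determines the vector. So
  nothing is lost by collecting the vectors in a set.\<close>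

lemma sum_suffix_set:
  fixes g :: "nat \<Rightarrow> complex"
  assumes mn: "1 \<le> m" "m < n" and u: "u \<in> verts B m"
  shows "(\<Sum>s \<in> suffix_set B m n u v. g (height_inner B m s)) = (\<Sum>\<sigma> \<in> offsets B m n u v. g \<sigma>)"
proof (rule sum.reindex_bij_betw)
  have img: "height_inner B m ` suffix_set B m n u v = offsets B m n u v"
  proof
    show "height_inner B m ` suffix_set B m n u v \<subseteq> offsets B m n u v"
      using height_inner_suffix_vector[OF _ mn] depth_split(2)[OF _ mn]
      by (auto simp: suffix_set_def offsets_def)
    show "offsets B m n u v \<subseteq> height_inner B m ` suffix_set B m n u v"
    proof
      fix \<sigma> assume "\<sigma> \<in> offsets B m n u v"
      then obtain q where q: "q \<in> paths_between B m n u v" "\<sigma> = path_offset B m n q"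
        by (auto simp: offsets_def)
      obtain x where "x \<in> inf_paths B" "tau B m x = u" "tau B n x = v" "restrict x {m<..n} = q"
        using realize[OF mn q(1) tower_height_pos[OF mn(1) u]] by metis
      then have "suffix_vector B m n x \<in> suffix_set B m n u v"
        and "\<sigma> = height_inner B m (suffix_vector B m n x)"
        using height_inner_suffix_vector[OF _ mn, of x] q by (auto simp: suffix_set_def)
      then show "\<sigma> \<in> height_inner B m ` suffix_set B m n u v" by blast
    qed
  qed
  moreover have "inj_on (height_inner B m) (suffix_set B m n u v)"
  proof (rule inj_onI)
    fix s t assume st: "s \<in> suffix_set B m n u v" "t \<in> suffix_set B m n u v"
      and eq: "height_inner B m s = height_inner B m t"
    then obtain x y where x: "x \<in> inf_paths B" "tau B m x = u" "tau B n x = v" "s = suffix_vector B m n x"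
      and y: "y \<in> inf_paths B" "tau B m y = u" "tau B n y = v" "t = suffix_vector B m n y"
      by (auto simp: suffix_set_def)
    have "restrict x {m<..n} = restrict y {m<..n}"
      using inj_onD[OF inj_on_path_offset[OF mn u]] eq x y height_inner_suffix_vector[OF _ mn]
        depth_split(2)[OF _ mn] by metis
    then show "s = t" using x y by (simp add: suffix_vector_def)
  qed
  ultimately show "bij_betw (height_inner B m) (suffix_set B m n u v) (offsets B m n u v)"
    by (simp add: bij_betw_def)
qed

section \<open>The Vershik map in terms of depth\<close>

lemma edge_succ_least:
  assumes "n \<ge> 1" "e \<in> edges B n" "\<not> maximal_edge B e"
  shows "edge_less B e (edge_succ B e)"
    and "edge_less B e g \<Longrightarrow> g = edge_succ B e \<or> edge_less B (edge_succ B e) g"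
proof -
  let ?A = "{f. edge_less B e f}"
  have sub: "?A \<subseteq> {f \<in> edges B n. rng B f = rng B e}" using edge_less_rng[OF assms(1)] assms(2) by auto
  then have fin: "finite ?A" using finite_edges[OF assms(1)] by (auto intro: finite_subset)
  have ne: "?A \<noteq> {}" using assms(3) by (auto simp: maximal_edge_def)
  obtain a where a: "a \<in> ?A" "\<And>x. x \<in> ?A \<Longrightarrow> \<not> edge_less B x a"
    by (rule finite_least_exists[of ?A "edge_less B"]) (use fin ne edge_less_irrefl edge_less_trans in blast)+
  \<comment> \<open>All edges above e share its range and are pairwise comparable, so a minimal one
    among them is least.\<close>
  have least: "(a, g) \<in> edge_ord B" if "edge_less B e g" for g
  proof (cases "a = g")
    case True
    then show ?thesis
      using partial_order_onD(1)[OF partial_order] a(1) sub assms(1) by (auto simp: refl_on_def)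
  next
    case False
    have "edge_less B a g \<or> edge_less B g a"
      using edge_less_total[OF assms(1), of a g] False a(1) that subsetD[OF sub] by simp
    then show ?thesis using a(2)[of g] that by (auto simp: edge_less_def)
  qed
  have "edge_less B e (edge_succ B e) \<and> (\<forall>g. edge_less B e g \<longrightarrow> (edge_succ B e, g) \<in> edge_ord B)"
    unfolding edge_succ_def
  proof (rule theI[of _ a], intro conjI allI impI)
    fix f assume f: "edge_less B e f \<and> (\<forall>g. edge_less B e g \<longrightarrow> (f, g) \<in> edge_ord B)"
    then show "f = a"
      using a(1) least[of f] partial_order_onD(3)[OF partial_order] by (auto dest: antisymD)
  qed (use a(1) least in auto)
  then show "edge_less B e (edge_succ B e)"
    and "edge_less B e g \<Longrightarrow> g = edge_succ B e \<or> edge_less B (edge_succ B e) g"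
    by (auto simp: edge_less_def)
qed

lemma min_path_to_least:
  assumes "n \<ge> 1" "w \<in> verts B n"
  shows "min_path_to B n w \<in> paths_to B 0 n w" and "\<not> path_less B 0 n q (min_path_to B n w)"
proof -
  obtain a where a: "a \<in> paths_to B 0 n w" "\<And>x. x \<in> paths_to B 0 n w \<Longrightarrow> \<not> path_less B 0 n x a"
    by (rule finite_least_exists[of "paths_to B 0 n w" "path_less B 0 n"])
       (use finite_paths_to paths_to_nonempty[OF assms] path_less_irrefl path_less_trans in blast)+
  have "min_path_to B n w \<in> paths B 0 n \<and> (n > 0 \<longrightarrow> rng B (min_path_to B n w n) = w) \<and>
      \<not> (\<exists>q. path_less B 0 n q (min_path_to B n w))"
    unfolding min_path_to_def
  proof (rule theI[of _ a])
    show "a \<in> paths B 0 n \<and> (n > 0 \<longrightarrow> rng B (a n) = w) \<and> \<not> (\<exists>q. path_less B 0 n q a)"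
      using a by (auto simp: paths_to_def path_less_def)
    fix p assume p: "p \<in> paths B 0 n \<and> (n > 0 \<longrightarrow> rng B (p n) = w) \<and> \<not> (\<exists>q. path_less B 0 n q p)"
    show "p = a"
      using path_less_total[of p 0 n a] p a assms(1) by (auto simp: paths_to_def)
  qed
  then show "min_path_to B n w \<in> paths_to B 0 n w" "\<not> path_less B 0 n q (min_path_to B n w)"
    using assms(1) by (auto simp: paths_to_def)
qed

lemma depth_minimal_prefix:
  assumes x: "x \<in> inf_paths B" and n: "n \<ge> 1" and mn: "\<And>q. \<not> path_less B 0 n q (restrict x {0<..n})"
  shows "depth B n x = tower_height B n (tau B n x) - 1"
proof -
  have "above B 0 n (restrict x {0<..n}) = paths_to B 0 n (tau B n x) - {restrict x {0<..n}}"
  proof (intro equalityI subsetI)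
    fix q assume "q \<in> above B 0 n (restrict x {0<..n})"
    then show "q \<in> paths_to B 0 n (tau B n x) - {restrict x {0<..n}}"
      using path_less_irrefl[of 0 n q] n by (auto simp: above_def paths_to_def path_less_def tau_def)
  next
    fix q assume "q \<in> paths_to B 0 n (tau B n x) - {restrict x {0<..n}}"
    then show "q \<in> above B 0 n (restrict x {0<..n})"
      using path_less_total[of q 0 n "restrict x {0<..n}"] mn[of q] prefix_in_paths_to[OF x n]
      by (auto simp: above_def paths_to_def)
  qed
  then show ?thesis
    using prefix_in_paths_to[OF x n] n by (simp add: depth_def tower_height_eq finite_paths_to)
qed

text \<open>A smaller path into the end of the initial segment could replace that segment and would
  make the whole prefix smaller. This transfers minimality from the prefix inserted by the Vershik
  map to all shorter ones.\<close>

lemma prefix_minimal_mono: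
  assumes x: "x \<in> inf_paths B" and n: "1 \<le> n" "n \<le> N"
    and mn: "\<And>q. \<not> path_less B 0 N q (restrict x {0<..N})"
  shows "\<not> path_less B 0 n q (restrict x {0<..n})"
proof
  assume less: "path_less B 0 n q (restrict x {0<..n})"
  then have q: "q \<in> paths B 0 n" "rng B (q n) = rng B (x n)" using n by (auto simp: path_less_def)
  show False
  proof (cases "n = N")
    case False
    then have "n < N" using n by simp
    have "pjoin n (restrict x {0<..n}) (restrict x {n<..N}) = restrict x {0<..N}"
      using n by (auto simp: pjoin_def fun_eq_iff)
    then show False
      using path_less_pjoin[OF q(1) restrict_inf_paths[OF x, of 0 n] restrict_inf_paths[OF x, of n N]
        restrict_inf_paths[OF x, of n N]] inf_paths_link[OF x, of n] less mn q n \<open>n < N\<close> by auto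
  qed (use less mn in auto)
qed

text \<open>If the edge at level i is not maximal, a larger edge with the same range, preceded by
  any path that ends with it and followed by the old edges, gives a path above the prefix.\<close>

lemma depth_eq_0_iff:
  assumes x: "x \<in> inf_paths B" and n: "n \<ge> 1"
  shows "depth B n x = 0 \<longleftrightarrow> (\<forall>i. 1 \<le> i \<and> i \<le> n \<longrightarrow> maximal_edge B (x i))"
proof
  assume "\<forall>i. 1 \<le> i \<and> i \<le> n \<longrightarrow> maximal_edge B (x i)"
  then have "above B 0 n (restrict x {0<..n}) = {}"
    by (auto simp: above_def path_less_def maximal_edge_def)
  then show "depth B n x = 0" by (simp add: depth_def)
next
  assume d: "depth B n x = 0"
  show "\<forall>i. 1 \<le> i \<and> i \<le> n \<longrightarrow> maximal_edge B (x i)"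
  proof (intro allI impI, rule ccontr)
    fix i assume i: "1 \<le> i \<and> i \<le> n" and nm: "\<not> maximal_edge B (x i)"
    then obtain f where f: "edge_less B (x i) f" by (auto simp: maximal_edge_def)
    then have fi: "f \<in> edges B i" "rng B f = rng B (x i)"
      using edge_less_rng[of i "x i" f] inf_paths_edge[OF x] i by auto
    then obtain p where p: "p \<in> paths B 0 i" "p i = f" using path_ending_with i by blast
    have less: "path_less B 0 i (restrict x {0<..i}) p"
      using p f fi i restrict_inf_paths[OF x] unfolding path_less_def by (auto intro!: bexI[of _ i])
    have "\<exists>q. path_less B 0 n (restrict x {0<..n}) q"
    proof (cases "i = n")
      case False
      then have "i < n" using i by simp
      have "pjoin i (restrict x {0<..i}) (restrict x {i<..n}) = restrict x {0<..n}"
        using i by (auto simp: pjoin_def fun_eq_iff)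
      then show ?thesis
        using path_less_pjoin[OF restrict_inf_paths[OF x, of 0 i] p(1) restrict_inf_paths[OF x, of i n]
          restrict_inf_paths[OF x, of i n]] inf_paths_link[OF x, of i] less p fi i \<open>i < n\<close> by auto
    qed (use less in auto)
    then show False using d by (auto simp: depth_def above_def[symmetric] finite_above
       card_eq_0_iff) (auto simp: above_def)
  qed
qed

lemma vershik_nonmax:
  assumes x: "x \<in> inf_paths B" and nm: "N \<ge> 1" "\<not> maximal_edge B (x N)"
    and mx: "\<And>i. 1 \<le> i \<Longrightarrow> i < N \<Longrightarrow> maximal_edge B (x i)"
  shows "vershik_map B x = (\<lambda>i. if 1 \<le> i \<and> i < N then min_path_to B (N - 1) (src B (edge_succ B (x N))) i
           else if i = N then edge_succ B (x N) else x i)"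
proof -
  have "(LEAST n. n \<ge> 1 \<and> \<not> maximal_edge B (x n)) = N"
    using nm mx by (intro Least_equality) (auto simp: not_less[symmetric])
  moreover have "\<not> max_path B x" using nm by (auto simp: max_path_def)
  ultimately show ?thesis unfolding vershik_map_def Let_def by (simp only: if_False)
qed

text \<open>Positive depth puts the first non-maximal edge at a level N at most n, so the change
  stays inside the prefix. The new prefix is the immediate successor of the old one, whence the set
  above the old prefix gains exactly one element.\<close>

lemma depth_vershik_pos:
  assumes x: "x \<in> inf_paths B" and y: "vershik_map B x \<in> inf_paths B" and n: "n \<ge> 1"
    and pos: "depth B n x > 0"
  shows "depth B n x = Suc (depth B n (vershik_map B x))" "tau B n (vershik_map B x) = tau B n x"
proof -
  define y where "y = vershik_map B x"
  have yi: "y \<in> inf_paths B" using assms(2) by (simp add: y_def)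
  have ex: "\<exists>i. 1 \<le> i \<and> i \<le> n \<and> \<not> maximal_edge B (x i)"
    using depth_eq_0_iff[OF x n] pos by auto
  define N where "N = (LEAST i. 1 \<le> i \<and> i \<le> n \<and> \<not> maximal_edge B (x i))"
  have N: "1 \<le> N" "N \<le> n" "\<not> maximal_edge B (x N)" using LeastI_ex[OF ex] by (auto simp: N_def)
  have mx: "maximal_edge B (x i)" if "1 \<le> i" "i < N" for i
    using not_less_Least[of i "\<lambda>i. 1 \<le> i \<and> i \<le> n \<and> \<not> maximal_edge B (x i)"] that N
    by (auto simp: N_def)
  let ?w = "src B (edge_succ B (x N))"
  have yeq: "y i = (if 1 \<le> i \<and> i < N then min_path_to B (N - 1) ?w i
           else if i = N then edge_succ B (x N) else x i)" for i
    unfolding y_def using vershik_nonmax[OF x N(1,3) mx] by simp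
  have xN: "x N \<in> edges B N" using inf_paths_edge[OF x N(1)] .
  note succ = edge_succ_least[OF N(1) xN N(3)]
  have sN: "edge_succ B (x N) \<in> edges B N" "rng B (edge_succ B (x N)) = rng B (x N)"
    using edge_less_rng[OF N(1) succ(1)] xN by auto
  show tau: "tau B n (vershik_map B x) = tau B n x"
    using yeq[of n] N n sN unfolding tau_def y_def[symmetric] by auto
  let ?x = "restrict x {0<..n}" and ?y = "restrict y {0<..n}"
  have P: "?x \<in> paths B 0 n" "?y \<in> paths B 0 n" using restrict_inf_paths x yi by auto
  have r: "rng B (?x n) = rng B (?y n)" using tau n by (simp add: tau_def y_def)
  have xy: "path_less B 0 n ?x ?y"
    unfolding path_less_def using P r N succ(1) by (auto intro!: bexI[of _ N] simp: yeq)
  \<comment> \<open>Let k and l be the deciding levels of x against p and of p against y. Maximality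
    of the edges of x below N excludes k < N, and agreement of x and y above N excludes N < k. With
    k = N, the case l = N would put an edge strictly between \<open>x N\<close> and its successor,
    and l < N would undercut the minimal path inserted below N.\<close>
  have no_between: "\<not> path_less B 0 n p ?y" if "path_less B 0 n ?x p" for p
  proof
    assume py: "path_less B 0 n p ?y"
    obtain k where k: "0 < k" "k \<le> n" "edge_less B (x k) (p k)" "\<And>j. k < j \<Longrightarrow> j \<le> n \<Longrightarrow> x j = p j"
      and pp: "p \<in> paths B 0 n"
    proof -
      from \<open>path_less B 0 n ?x p\<close> obtain k where "k \<in> {0<..n}" "edge_less B (?x k) (p k)"
        "\<forall>j\<in>{k<..n}. ?x j = p j" "p \<in> paths B 0 n" unfolding path_less_def by blast
      then show thesis by (intro that[of k]) auto
    qed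
    obtain l where l: "0 < l" "l \<le> n" "edge_less B (p l) (y l)" "\<And>j. l < j \<Longrightarrow> j \<le> n \<Longrightarrow> p j = y j"
      using py by (auto simp: path_less_def)
    have "\<not> k < N" using mx[of k] k by (auto simp: maximal_edge_def)
    moreover have "\<not> N < k"
    proof
      assume "N < k"
      then have yk: "y j = x j" if "k \<le> j" for j using that by (simp add: yeq)
      have "\<not> k < l"
        using l(3) k(4)[of l] l(2) yk[of l] edge_less_irrefl by (metis less_imp_le)
      moreover have "\<not> l < k" using l(4)[of k] yk[of k] k(2,3) edge_less_irrefl by (metis order_refl)
      moreover have "l \<noteq> k"
        using l(3) yk[of k] edge_less_trans[OF k(3), of "x k"] edge_less_irrefl[of "x k"] by auto
      ultimately show False by simp
    qed
    ultimately have kN: "k = N" by simp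
    have pN: "p j = y j" if "N < j" "j \<le> n" for j using k(4)[of j] kN that by (simp add: yeq)
    have ys: "y N = edge_succ B (x N)" using N by (simp add: yeq)
    have "\<not> N < l" using l(2,3) pN edge_less_irrefl by metis
    moreover have "l \<noteq> N"
    proof
      assume "l = N"
      then have a: "edge_less B (p N) (edge_succ B (x N))" using l(3) ys by simp
      have "edge_less B (x N) (p N)" using k(3) kN by simp
      from succ(2)[OF this] show False
        using a edge_less_trans[OF a] edge_less_irrefl by metis
    qed
    ultimately have lN: "l < N" by simp
    then have N1: "1 \<le> N - 1" "N - 1 \<le> n" using l N by auto
    have w: "?w \<in> verts B (N - 1)" using src_in[OF N(1) sN(1)] .
    have pyN: "p N = y N" using l(4)[of N] lN N by simp
    have yrest: "restrict y {0<..N - 1} = min_path_to B (N - 1) ?w"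
    proof
      fix i show "restrict y {0<..N - 1} i = min_path_to B (N - 1) ?w i"
        using paths_extensional[of "min_path_to B (N - 1) ?w" 0 "N - 1" i]
          min_path_to_least(1)[OF N1(1) w] by (cases "0 < i \<and> i \<le> N - 1") (auto simp: yeq paths_to_def)
    qed
    \<comment> \<open>As p and y share the edge at level N, their initial segments end at the same
      vertex and are comparable.\<close>
    have "path_less B 0 (N - 1) (restrict p {0<..N - 1}) (restrict y {0<..N - 1})"
      unfolding path_less_def
    proof (intro conjI bexI[of _ l] ballI)
      show "restrict p {0<..N - 1} \<in> paths B 0 (N - 1)"
        using restrict_paths[OF pp] N1 by simp
      show "restrict y {0<..N - 1} \<in> paths B 0 (N - 1)"
        using restrict_inf_paths[OF yi] by simp
      have "rng B (p (N - 1)) = src B (p N)" using paths_link[OF pp, of "N - 1"] N1 N by simp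
      moreover have "rng B (y (N - 1)) = src B (y N)" using inf_paths_link[OF yi, of "N - 1"] N1 N by simp
      ultimately show "rng B (restrict p {0<..N - 1} (N - 1)) = rng B (restrict y {0<..N - 1} (N - 1))"
        using N1 pyN by simp
    qed (use l lN N in auto)
    then show False using min_path_to_least(2)[OF N1(1) w] yrest by simp
  qed
  have "above B 0 n ?x = insert ?y (above B 0 n ?y)"
  proof (intro equalityI subsetI)
    fix p assume "p \<in> above B 0 n ?x"
    then have p: "path_less B 0 n ?x p" by (simp add: above_def)
    show "p \<in> insert ?y (above B 0 n ?y)"
    proof (cases "p = ?y")
      case False
      have "p \<in> paths B 0 n" "rng B (p n) = rng B (?y n)" using p r by (auto simp: path_less_def)
      then show ?thesis
        using path_less_total[OF _ P(2) _ False] no_between[OF p] by (auto simp: above_def)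
    qed simp
  next
    fix p assume "p \<in> insert ?y (above B 0 n ?y)"
    then show "p \<in> above B 0 n ?x" using xy path_less_trans by (auto simp: above_def)
  qed
  moreover have "?y \<notin> above B 0 n ?y" by (simp add: above_def path_less_irrefl)
  ultimately show "depth B n x = Suc (depth B n (vershik_map B x))"
    by (simp add: depth_def finite_above y_def[symmetric])
qed

text \<open>At the top of a tower of level n all edges up to n are maximal, so the first change
  occurs at some N > n and the prefix of level n lies inside the inserted minimal path of level N -
  1. For the maximal path the image is the minimal path, and every prefix is minimal.\<close>

lemma depth_vershik_top:
  assumes x: "x \<in> inf_paths B" and y: "vershik_map B x \<in> inf_paths B" and n: "n \<ge> 1"
    and top: "depth B n x = 0" and un: "\<exists>!z. min_path B z"
  shows "depth B n (vershik_map B x) = tower_height B n (tau B n (vershik_map B x)) - 1"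
proof (rule depth_minimal_prefix[OF y n])
  fix q
  have mx: "maximal_edge B (x i)" if "1 \<le> i" "i \<le> n" for i
    using depth_eq_0_iff[OF x n] top that by auto
  show "\<not> path_less B 0 n q (restrict (vershik_map B x) {0<..n})"
  proof (cases "max_path B x")
    case True
    then have "min_path B (vershik_map B x)" using theI'[OF un] by (simp add: vershik_map_def)
    then have "minimal_edge B (vershik_map B x i)" if "1 \<le> i" for i
      using that by (simp add: min_path_def)
    then show ?thesis by (auto simp: path_less_def minimal_edge_def)
  next
    case False
    then have ex: "\<exists>i. 1 \<le> i \<and> \<not> maximal_edge B (x i)" using x by (auto simp: max_path_def)
    define N where "N = (LEAST i. 1 \<le> i \<and> \<not> maximal_edge B (x i))"
    have N: "1 \<le> N" "\<not> maximal_edge B (x N)" using LeastI_ex[OF ex] by (auto simp: N_def)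
    have mxN: "maximal_edge B (x i)" if "1 \<le> i" "i < N" for i
      using not_less_Least[of i "\<lambda>i. 1 \<le> i \<and> \<not> maximal_edge B (x i)"] that
      by (auto simp: N_def)
    have "n < N" using mx[of N] N by (meson not_le)
    then have nN: "n \<le> N - 1" "1 \<le> N - 1" using n by auto
    let ?w = "src B (edge_succ B (x N))"
    have xN: "x N \<in> edges B N" using inf_paths_edge[OF x N(1)] .
    have "edge_succ B (x N) \<in> edges B N"
      using edge_less_rng[OF N(1) edge_succ_least(1)[OF N(1) xN N(2)]] xN by auto
    then have w: "?w \<in> verts B (N - 1)" using src_in[OF N(1)] by blast
    have "restrict (vershik_map B x) {0<..N - 1} = min_path_to B (N - 1) ?w"
    proof
      fix i show "restrict (vershik_map B x) {0<..N - 1} i = min_path_to B (N - 1) ?w i"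
        using paths_extensional[of "min_path_to B (N - 1) ?w" 0 "N - 1" i]
          min_path_to_least(1)[OF nN(2) w] vershik_nonmax[OF x N mxN]
        by (cases "0 < i \<and> i \<le> N - 1") (auto simp: paths_to_def)
    qed
    then show ?thesis
      using prefix_minimal_mono[OF y n nN(1)] min_path_to_least(2)[OF nN(2) w] by simp
  qed
qed

end

section \<open>Weak limits of bounded sequences of functions\<close>

lemma converges_uniformly_above_iff:
  "converges_uniformly_above a l \<longleftrightarrow>
    (\<forall>\<epsilon>>0. \<forall>\<^sub>F m in sequentially. \<forall>n>m. \<bar>a m n - l\<bar> \<le> \<epsilon>)"
proof -
  have "(\<exists>m0\<ge>1. \<forall>m\<ge>m0. P m) \<longleftrightarrow> (\<exists>m0. \<forall>m\<ge>m0. P m)" for P :: "nat \<Rightarrow> bool"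
    by (meson le_trans nat_le_linear)
  then show ?thesis by (simp add: converges_uniformly_above_def eventually_sequentially)
qed

text \<open>The finite midpoint closure of a tail of a sequence replaces its convex hull.\<close>

inductive_set midhull :: "(nat \<Rightarrow> 'x \<Rightarrow> complex) \<Rightarrow> nat \<Rightarrow> ('x \<Rightarrow> complex) set"
  for w n where
  base: "k \<ge> n \<Longrightarrow> w k \<in> midhull w n"
| mid: "f \<in> midhull w n \<Longrightarrow> g \<in> midhull w n \<Longrightarrow> (\<lambda>x. (f x + g x) / 2) \<in> midhull w n"

lemma midhull_antimono: "f \<in> midhull w n \<Longrightarrow> m \<le> n \<Longrightarrow> f \<in> midhull w m"
  by (induction rule: midhull.induct) (auto intro: midhull.intros)

lemma midhull_measurable:
  "f \<in> midhull w n \<Longrightarrow> (\<And>k. w k \<in> borel_measurable M) \<Longrightarrow> f \<in> borel_measurable M"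
  by (induction rule: midhull.induct) auto

lemma midhull_norm_le:
  "f \<in> midhull w n \<Longrightarrow> (\<And>k. norm (w k x) \<le> C) \<Longrightarrow> norm (f x) \<le> C"
proof (induction rule: midhull.induct)
  case (mid f g)
  then have "norm (f x) \<le> C" "norm (g x) \<le> C" by auto
  then have "norm (f x + g x) \<le> 2 * C" using norm_triangle_ineq[of "f x" "g x"] by linarith
  then show ?case by (simp add: norm_divide)
qed auto

text \<open>The point y stands for the image of x under T. Only indices from n on enter, so a linear
  relation that holds eventually at the given point is inherited by the hulls of late tails.\<close>

lemma midhull_eigen:
  "f \<in> midhull w n \<Longrightarrow> (\<And>k. k \<ge> n \<Longrightarrow> w k y = c * w k x) \<Longrightarrow> f y = c * f x"
  by (induction rule: midhull.induct) (auto simp: algebra_simps)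

context prob_space
begin

lemma bounded_integrable:
  fixes f :: "'a \<Rightarrow> 'b::{banach, second_countable_topology}"
  assumes "f \<in> borel_measurable M" "\<And>x. norm (f x) \<le> C"
  shows "integrable M f"
  by (rule integrable_const_bound[of _ C]) (use assms in auto)

text \<open>A closed ball around z is convex and the integral over A is linear.\<close>

lemma midhull_integral:
  assumes w: "\<And>k. w k \<in> borel_measurable M" "\<And>k x. norm (w k x) \<le> 1" and A: "A \<in> sets M"
  shows "f \<in> midhull w n \<Longrightarrow> (\<And>k. k \<ge> n \<Longrightarrow> norm ((LINT x:A|M. w k x) - z) \<le> e) \<Longrightarrow>
    norm ((LINT x:A|M. f x) - z) \<le> e"
proof (induction rule: midhull.induct)
  case (mid f g)
  have i: "set_integrable M A h" if "h \<in> midhull w n" for h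
    unfolding set_integrable_def
  proof (rule bounded_integrable[of _ 1])
    show "norm (indicator A x *\<^sub>R h x) \<le> 1" for x
      using midhull_norm_le[OF that w(2), of x] by (simp add: indicator_def)
    show "(\<lambda>x. indicator A x *\<^sub>R h x) \<in> borel_measurable M"
      using midhull_measurable[OF that w(1)] A by auto
  qed
  have nm: "norm ((a + b) / 2) \<le> (norm a + norm b) / 2" for a b :: complex
    by (simp add: norm_divide norm_triangle_ineq)
  have "(LINT x:A|M. (f x + g x) / 2) - z = (((LINT x:A|M. f x) - z) + ((LINT x:A|M. g x) - z)) / 2"
    using i mid by (simp add: set_integral_add field_simps)
  also have "norm \<dots> \<le> (norm ((LINT x:A|M. f x) - z) + norm ((LINT x:A|M. g x) - z)) / 2"
    using nm by blast
  also have "\<dots> \<le> (e + e) / 2" by (intro divide_right_mono add_mono mid) auto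
  also have "\<dots> = e" by simp
  finally show ?case .
qed auto

text \<open>The bounds on the squares give summable L1 norms of the increments, so the series of
  their moduli has finite integral and is finite almost everywhere; the sequence then converges by
  telescoping.\<close>

lemma AE_convergent_if_fast_Cauchy:
  fixes g :: "nat \<Rightarrow> 'a \<Rightarrow> complex"
  assumes g: "\<And>k. g k \<in> borel_measurable M" "\<And>k x. norm (g k x) \<le> 1"
    and fast: "\<And>k. (\<integral>x. (norm (g (Suc k) x - g k x))\<^sup>2 \<partial>M) \<le> (1/4) ^ k"
  shows "AE x in M. convergent (\<lambda>k. g k x)"
proof -
  let ?D = "\<lambda>k x. norm (g (Suc k) x - g k x)"
  have D2: "?D k x \<le> 2" for k x
    using norm_triangle_ineq4[of "g (Suc k) x" "g k x"] g(2)[of "Suc k" x] g(2)[of k x] by linarith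
  have iD: "integrable M (?D k)" for k
    by (rule bounded_integrable[of _ 2]) (use g D2 in auto)
  have iD2: "integrable M (\<lambda>x. (?D k x)\<^sup>2)" for k
  proof (rule bounded_integrable[of _ 4])
    show "norm ((?D k x)\<^sup>2) \<le> 4" for x using power_mono[OF D2[of k x], of 2] by simp
  qed (use g in auto)
  have int: "(\<integral>x. ?D k x \<partial>M) \<le> (1/2) ^ k" for k
  proof -
    \<comment> \<open>The inequality of arithmetic and geometric means with weight
      \<open>2^k\<close> takes the place of Cauchy-Schwarz: applied under the integral it turns the
      bound \<open>(1/4)^k\<close> for squares into \<open>(1/2)^k\<close>.\<close>
    have young: "a \<le> ((1/2)^k + 2^k * a\<^sup>2) / 2" for a :: real
    proof -
      have "0 \<le> (2^k * a - 1)\<^sup>2 * (1/2)^k" by simp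
      also have "\<dots> = ((2^k * a)^2 - 2 * (2^k * a) + 1) * (1/2)^k" by (simp add: power2_diff)
      also have "\<dots> = 2^k * a\<^sup>2 - 2 * a + (1/2)^k"
        by (simp add: field_simps power2_eq_square)
      finally show ?thesis by simp
    qed
    have "(\<integral>x. ?D k x \<partial>M) \<le> (\<integral>x. ((1/2)^k + 2^k * (?D k x)\<^sup>2) / 2 \<partial>M)"
      by (rule integral_mono[OF iD]) (use iD2 young in auto)
    also have "\<dots> = ((1/2)^k + 2^k * (\<integral>x. (?D k x)\<^sup>2 \<partial>M)) / 2"
      using iD2 by (simp add: prob_space)
    also have "\<dots> \<le> ((1/2)^k + 2^k * (1/4)^k) / 2"
      using fast[of k] by (simp add: divide_right_mono)
    also have "2^k * (1/4)^k = (1/2::real)^k" by (simp flip: power_mult_distrib)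
    finally show ?thesis by simp
  qed
  have "(\<integral>\<^sup>+x. (\<Sum>k. ennreal (?D k x)) \<partial>M) = (\<Sum>k. \<integral>\<^sup>+x. ennreal (?D k x) \<partial>M)"
    using g by (intro nn_integral_suminf) auto
  also have "\<dots> = (\<Sum>k. ennreal (\<integral>x. ?D k x \<partial>M))"
    using iD by (intro suminf_cong nn_integral_eq_integral) auto
  also have "\<dots> \<le> (\<Sum>k. ennreal ((1/2)^k))"
    using int by (intro suminf_le) (auto simp: ennreal_leI)
  also have "\<dots> = ennreal (\<Sum>k. (1/2)^k)"
    by (intro suminf_ennreal2) (auto simp: summable_geometric)
  also have "\<dots> < \<infinity>" by simp
  finally have "(\<integral>\<^sup>+x. (\<Sum>k. ennreal (?D k x)) \<partial>M) \<noteq> \<infinity>" by simp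
  then have "AE x in M. (\<Sum>k. ennreal (?D k x)) \<noteq> \<infinity>"
    using g by (intro nn_integral_PInf_AE) auto
  then show ?thesis
  proof eventually_elim
    case (elim x)
    then have "summable (\<lambda>k. ?D k x)" by (intro summable_suminf_not_top) auto
    then have "summable (\<lambda>k. g (Suc k) x - g k x)" by (rule summable_norm_cancel)
    then have "convergent (\<lambda>n. \<Sum>k<n. g (Suc k) x - g k x)" by (simp add: summable_iff_convergent)
    then have "convergent (\<lambda>n. g n x - g 0 x)" 
      by (simp only: sum_lessThan_telescope[of "\<lambda>k. g k x"])
    then show ?case using convergent_add[OF _ convergent_const[of "g 0 x"]] by force
  qed
qed

text \<open>A weak limit of a bounded sequence, realised (Mazur) as an almost everywhere limit of
  midpoint combinations of almost minimal \<open>L\<^sup>2\<close> norm; the parallelogram law makes them Cauchy.\<close>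

lemma weak_limit_exists:
  fixes w :: "nat \<Rightarrow> 'a \<Rightarrow> complex"
  assumes w: "\<And>k. w k \<in> borel_measurable M" "\<And>k x. norm (w k x) \<le> 1" and A: "A \<in> sets M"
    and lim: "(\<lambda>k. LINT x:A|M. w k x) \<longlonglongrightarrow> z"
  obtains f g where "f \<in> borel_measurable M" "\<And>n. g n \<in> midhull w n"
    "AE x in M. (\<lambda>n. g n x) \<longlonglongrightarrow> f x" "(LINT x:A|M. f x) = z"
proof -
  let ?N = "\<lambda>f. \<integral>x. (norm (f x))\<^sup>2 \<partial>M"
  \<comment> \<open>The squared L2 distance from 0 to the hull of the tail. It grows with n because
    the hulls shrink, and it is at most 1, so it is Cauchy.\<close>
  define e where "e n = (INF f\<in>midhull w n. ?N f)" for n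
  have mh: "f \<in> borel_measurable M" "norm (f x) \<le> 1" if "f \<in> midhull w n" for f n x
    using midhull_measurable[OF that w(1)] midhull_norm_le[OF that w(2)] by auto
  have ne: "midhull w n \<noteq> {}" for n using midhull.base[of n n w] by auto
  have bdd: "bdd_below (?N ` midhull w n)" for n
    by (rule bdd_belowI[of _ 0]) auto
  have sq: "integrable M (\<lambda>x. (norm (f x))\<^sup>2)"
    if "f \<in> borel_measurable M" "\<And>x. norm (f x) \<le> 2" for f :: "'a \<Rightarrow> complex"
  proof (rule bounded_integrable[of _ 4])
    show "norm ((norm (f x))\<^sup>2) \<le> 4" for x using power_mono[OF that(2)[of x], of 2] by simp
  qed (use that in auto)
  have e_le: "e n \<le> ?N f" if "f \<in> midhull w n" for f n
    unfolding e_def using that bdd by (intro cINF_lower)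
  have mono: "e m \<le> e n" if "m \<le> n" for m n
    unfolding e_def using that ne bdd midhull_antimono by (intro cINF_superset_mono) auto
  have N_le1: "?N f \<le> 1" if "f \<in> midhull w n" for f n
  proof -
    have "(norm (f x))\<^sup>2 \<le> 1" for x using power_le_one[OF _ mh(2)[OF that, of x], of 2] by simp
    then have "?N f \<le> (\<integral>x. 1 \<partial>M)"
      using mh[OF that] by (intro integral_mono sq) (auto intro: order_trans[of _ 1])
    then show ?thesis by (simp add: prob_space)
  qed
  have e_le1: "e n \<le> 1" for n using e_le N_le1 ne by (meson all_not_in_conv order_trans)
  have Ce: "Cauchy e"
    using incseq_convergent[of e 1] mono e_le1 by (metis LIMSEQ_imp_Cauchy incseq_def)
  have "\<exists>f\<in>midhull w n. ?N f < e n + 1 / Suc n" for n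
  proof (rule ccontr)
    assume "\<not> ?thesis"
    then have "e n + 1 / Suc n \<le> e n"
      by (subst (2) e_def, intro cINF_greatest ne) (auto simp: not_less)
    then show False by simp
  qed
  then obtain G where G: "\<And>n. G n \<in> midhull w n" "\<And>n. ?N (G n) < e n + 1 / Suc n" by metis
  \<comment> \<open>For m \<le> n the midpoint of \<open>G n\<close> and \<open>G m\<close> lies in
    the hull of tail m, so its squared norm is at least \<open>e m\<close>. The excess
    \<open>1 / Suc n\<close> is estimated by \<open>1 / Suc m\<close>, which leads to the term
    \<open>4 / Suc m\<close>.\<close>
  have close: "(\<integral>x. (norm (G n x - G m x))\<^sup>2 \<partial>M) \<le> 2 * (e n - e m) + 4 / Suc m" if "m \<le> n" for m n
  proof -
    have Gm: "G n \<in> midhull w m" using midhull_antimono[OF G(1) that] .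
    have par: "(norm (G n x - G m x))\<^sup>2 =
        2 * (norm (G n x))\<^sup>2 + 2 * (norm (G m x))\<^sup>2 - 4 * (norm ((G n x + G m x) / 2))\<^sup>2" for x
      by (simp only: cmod_power2) (simp add: power2_eq_square field_simps)
    have i: "integrable M (\<lambda>x. (norm (f x))\<^sup>2)" if "f \<in> midhull w m" for f
      using mh[OF that] by (intro sq) (auto intro: order_trans[of _ 1])
    have ml: "(\<lambda>x. (G n x + G m x) / 2) \<in> midhull w m" using midhull.mid[OF Gm G(1)] .
    have "(\<integral>x. (norm (G n x - G m x))\<^sup>2 \<partial>M) = 2 * ?N (G n) + 2 * ?N (G m) - 4 * ?N (\<lambda>x. (G n x + G m x) / 2)"
      unfolding par using i[OF Gm] i[OF G(1)] i[OF ml] by simp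
    also have "\<dots> \<le> 2 * (e n + 1 / Suc n) + 2 * (e m + 1 / Suc m) - 4 * e m"
      by (intro diff_mono add_mono mult_left_mono less_imp_le[OF G(2)] e_le[OF ml]) auto
    also have "\<dots> \<le> 2 * (e n + 1 / Suc m) + 2 * (e m + 1 / Suc m) - 4 * e m"
      by (intro diff_right_mono add_right_mono mult_left_mono add_left_mono divide_left_mono) (use that in auto)
    also have "\<dots> = 2 * (e n - e m) + 4 / Suc m"
      by (simp add: distrib_left right_diff_distrib)
    finally show ?thesis .
  qed
  have small: "\<exists>m0. \<forall>m\<ge>m0. \<forall>n\<ge>m. (\<integral>x. (norm (G n x - G m x))\<^sup>2 \<partial>M) \<le> c" if "c > 0" for c
  proof -
    have "0 < c / 4" using that by simp
    from CauchyD[OF Ce this] obtain m1 where m1: "\<forall>m\<ge>m1. \<forall>n\<ge>m1. norm (e m - e n) < c / 4"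
      by blast
    \<comment> \<open>The threshold makes \<open>4 / Suc m\<close> at most c/2; the other half comes
      from twice the Cauchy bound c/4.\<close>
    obtain m2 where m2: "8 / c < real m2" using reals_Archimedean2 by blast
    show ?thesis
    proof (intro exI[of _ "max m1 m2"] allI impI)
      fix m n assume mn: "max m1 m2 \<le> m" "m \<le> n"
      have "8 / c < Suc m" using m2 mn by linarith
      then have "4 / Suc m \<le> c / 2" using that by (simp add: field_simps)
      moreover have "e n - e m \<le> c / 4" using m1[rule_format, of n m] mn by (auto simp: abs_if split: if_splits)
      ultimately have "2 * (e n - e m) + 4 / Suc m \<le> 2 * (c / 4) + c / 2"
        by (intro add_mono mult_left_mono) auto
      then have "2 * (e n - e m) + 4 / Suc m \<le> c" by simp
      with close[OF mn(2)] show "(\<integral>x. (norm (G n x - G m x))\<^sup>2 \<partial>M) \<le> c" by (rule order_trans)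
    qed
  qed
  have "\<exists>M0. \<forall>k. \<forall>m\<ge>M0 k. \<forall>n\<ge>m. (\<integral>x. (norm (G n x - G m x))\<^sup>2 \<partial>M) \<le> (1/4)^k"
    by (rule choice, rule allI, rule small) simp
  then obtain M0 where M0: "\<And>k m n. m \<ge> M0 k \<Longrightarrow> n \<ge> m \<Longrightarrow> (\<integral>x. (norm (G n x - G m x))\<^sup>2 \<partial>M) \<le> (1/4)^k"
    by blast
  \<comment> \<open>The index passes both its predecessor and the threshold for
    \<open>(1/4)^k\<close>. Strict growth gives k \<le> \<open>r k\<close>, which keeps
    \<open>g k\<close> in the hull of tail k.\<close>
  define r where "r = rec_nat (M0 0) (\<lambda>k rk. max (Suc rk) (M0 (Suc k)))"
  have rM: "M0 k \<le> r k" for k by (cases k) (auto simp: r_def)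
  have rS: "r k < r (Suc k)" for k by (simp add: r_def less_max_iff_disj)
  have rk: "k \<le> r k" for k
    using strict_mono_imp_increasing[of r k] rS by (simp add: strict_mono_Suc_iff)
  define g where "g k = G (r k)" for k
  have gh: "g k \<in> midhull w k" for k unfolding g_def using midhull_antimono[OF G(1) rk] .
  have conv: "AE x in M. convergent (\<lambda>k. g k x)"
    by (rule AE_convergent_if_fast_Cauchy) (use mh[OF gh] M0[OF rM] rS in \<open>auto simp: g_def less_imp_le\<close>)
  define f where "f x = lim (\<lambda>k. g k x)" for x
  have f: "f \<in> borel_measurable M"
    unfolding f_def by (rule borel_measurable_lim_metric) (use mh[OF gh] in auto)
  have gf: "AE x in M. (\<lambda>k. g k x) \<longlonglongrightarrow> f x"
    using conv by eventually_elim (simp add: f_def convergent_LIMSEQ_iff)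
  have "(\<lambda>k. LINT x:A|M. g k x) \<longlonglongrightarrow> (LINT x:A|M. f x)"
    unfolding set_lebesgue_integral_def
  proof (rule integral_dominated_convergence[where w = "\<lambda>_. 1"])
    show "AE x in M. (\<lambda>k. indicator A x *\<^sub>R g k x) \<longlonglongrightarrow> indicator A x *\<^sub>R f x"
      using gf by eventually_elim (auto intro: tendsto_scaleR)
    show "AE x in M. norm (indicator A x *\<^sub>R g k x) \<le> 1" for k
      using mh(2)[OF gh] by (auto simp: indicator_def)
  qed (use f A mh(1)[OF gh] in auto)
  moreover have "(\<lambda>k. LINT x:A|M. g k x) \<longlonglongrightarrow> z"
  proof (rule LIMSEQ_I)
    fix c :: real assume "c > 0"
    then obtain n0 where n0: "\<And>k. k \<ge> n0 \<Longrightarrow> norm ((LINT x:A|M. w k x) - z) < c / 2"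
      using LIMSEQ_D[OF lim, of "c/2"] by auto
    have "norm ((LINT x:A|M. g n x) - z) \<le> c / 2" if "n \<ge> n0" for n
      by (rule midhull_integral[OF w A gh]) (use n0 that in \<open>auto intro!: less_imp_le\<close>)
    then show "\<exists>no. \<forall>n\<ge>no. norm ((LINT x:A|M. g n x) - z) < c"
      using \<open>c > 0\<close> by (intro exI[of _ n0]) force
  qed
  ultimately have "(LINT x:A|M. f x) = z" by (rule LIMSEQ_unique)
  with that[OF f gh gf] show ?thesis by blast
qed

end

section \<open>Eigenvalues of systems of towers\<close>

text \<open>\<open>R n x\<close> is the distance of \<open>x\<close> to the top of its tower \<open>\<tau> n x\<close> of level \<open>n\<close>, which has height
  \<open>H n (\<tau> n x)\<close>; \<open>Off m n u v\<close> collects the values of \<open>R n - R m\<close> on the points that lie in tower \<open>u\<close> of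
  level \<open>m\<close> and in tower \<open>v\<close> of level \<open>n\<close>. The sets in \<open>G\<close> play the role of the open sets.\<close>

locale ergodic_towers = prob_space M for M :: "'x measure" +
  fixes T :: "'x \<Rightarrow> 'x" and d :: nat and \<tau> R :: "nat \<Rightarrow> 'x \<Rightarrow> nat"
    and H :: "nat \<Rightarrow> nat \<Rightarrow> nat" and Off :: "nat \<Rightarrow> nat \<Rightarrow> nat \<Rightarrow> nat \<Rightarrow> nat set"
    and G :: "'x set set"
  assumes T_measurable[measurable]: "T \<in> measurable M M"
    and T_invariant: "distr M M T = M"
    and ergodic: "A \<in> sets M \<Longrightarrow> T -` A \<inter> space M = A \<Longrightarrow> measure M A = 0 \<or> measure M A = 1"
    and cell_sets: "n \<ge> 1 \<Longrightarrow> {x \<in> space M. \<tau> n x = v \<and> R n x = k} \<in> sets M"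
    and tau_range: "n \<ge> 1 \<Longrightarrow> x \<in> space M \<Longrightarrow> \<tau> n x \<in> {1..d}"
    and R_less: "n \<ge> 1 \<Longrightarrow> x \<in> space M \<Longrightarrow> R n x < H n (\<tau> n x)"
    and H_pos: "n \<ge> 1 \<Longrightarrow> v \<in> {1..d} \<Longrightarrow> H n v > 0"
    and R_step: "n \<ge> 1 \<Longrightarrow> x \<in> space M \<Longrightarrow> R n x > 0 \<Longrightarrow>
      R n x = Suc (R n (T x)) \<and> \<tau> n (T x) = \<tau> n x"
    and R_top: "n \<ge> 1 \<Longrightarrow> x \<in> space M \<Longrightarrow> R n x = 0 \<Longrightarrow> R n (T x) = H n (\<tau> n (T x)) - 1"
    and finite_Off: "finite (Off m n u v)"
    and split: "1 \<le> m \<Longrightarrow> m < n \<Longrightarrow> x \<in> space M \<Longrightarrow>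
      \<exists>\<sigma>\<in>Off m n (\<tau> m x) (\<tau> n x). R n x = R m x + \<sigma>"
    and merge: "1 \<le> m \<Longrightarrow> m < n \<Longrightarrow> \<sigma> \<in> Off m n u v \<Longrightarrow> j < H m u \<Longrightarrow>
      \<exists>x\<in>space M. \<tau> m x = u \<and> R m x = j \<and> \<tau> n x = v \<and> R n x = j + \<sigma>"
    and determined: "1 \<le> m \<Longrightarrow> m \<le> n \<Longrightarrow> x \<in> space M \<Longrightarrow> y \<in> space M \<Longrightarrow>
      \<tau> n x = \<tau> n y \<Longrightarrow> R n x = R n y \<Longrightarrow> \<tau> m x = \<tau> m y \<and> R m x = R m y"
    and top_null: "AE x in M. \<exists>n0. \<forall>n\<ge>n0. R n x > 0"
    and Int_stable_G: "Int_stable G"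
    and sets_G: "G \<subseteq> Pow (space M)" "sets M = sigma_sets (space M) G"
    and G_open: "U \<in> G \<Longrightarrow> x \<in> U \<Longrightarrow>
      \<exists>n\<ge>1. \<forall>y\<in>space M. \<tau> n y = \<tau> n x \<and> R n y = R n x \<longrightarrow> y \<in> U"
begin

definition cell :: "nat \<Rightarrow> nat \<Rightarrow> nat \<Rightarrow> 'x set" where
  "cell n v k = {x \<in> space M. \<tau> n x = v \<and> R n x = k}"

definition tower :: "nat \<Rightarrow> nat \<Rightarrow> 'x set" where
  "tower n v = {x \<in> space M. \<tau> n x = v}"

text \<open>By \<open>measure_tower_tower\<close> this is the conditional probability of tower u of
  level m given tower v of level n, provided the latter has positive measure.\<close>

definition weight :: "nat \<Rightarrow> nat \<Rightarrow> nat \<Rightarrow> nat \<Rightarrow> real" where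
  "weight m n u v = real (H m u) / real (H n v) * real (card (Off m n u v))"

text \<open>A single term of the sum in (1). It is \<open>weight\<close> with the count of offsets
  replaced by the modulus of their phase sum, so \<open>weight - osc\<close> is the defect in
  (2).\<close>

definition osc :: "complex \<Rightarrow> nat \<Rightarrow> nat \<Rightarrow> nat \<Rightarrow> nat \<Rightarrow> real" where
  "osc c m n u v = real (H m u) / real (H n v) * norm (\<Sum>\<sigma>\<in>Off m n u v. c ^ \<sigma>)"

definition index_set :: "nat \<Rightarrow> (nat \<times> nat) set" where
  "index_set n = (SIGMA v:{1..d}. {..<H n v})"

section \<open>Measures of cells and towers\<close>

lemma cell_measurable[measurable]: "n \<ge> 1 \<Longrightarrow> cell n v k \<in> sets M"
  by (simp add: cell_def cell_sets)

lemma T_space: "x \<in> space M \<Longrightarrow> T x \<in> space M"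
  using T_measurable by (rule measurable_space)

lemma integral_T:
  fixes f :: "'x \<Rightarrow> 'b::{banach, second_countable_topology}"
  assumes "f \<in> borel_measurable M"
  shows "(\<integral>x. f (T x) \<partial>M) = (\<integral>x. f x \<partial>M)"
  using integral_distr[OF T_measurable assms] by (simp add: T_invariant)

lemma AE_T:
  assumes "AE x in M. P x" shows "AE x in M. P (T x)"
  using AE_distrD[OF T_measurable, of P] assms by (simp only: T_invariant)

text \<open>The image of a top lands at a bottom, where the depth is one less than the height. The
  bound on \<open>Suc k\<close> excludes this depth, so a point that arrives at depth k comes from
  depth k + 1 of the same tower.\<close>

lemma cell_vimage:
  assumes "n \<ge> 1" "Suc k < H n v" "x \<in> space M"
  shows "T x \<in> cell n v k \<longleftrightarrow> x \<in> cell n v (Suc k)"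
  using R_step[of n x] R_top[of n x] assms T_space[of x] by (cases "R n x = 0") (auto simp: cell_def)

lemma tower_eq: "n \<ge> 1 \<Longrightarrow> tower n v = (\<Union>k<H n v. cell n v k)"
  using R_less by (auto simp: tower_def cell_def)

lemma tower_measurable[measurable]: "n \<ge> 1 \<Longrightarrow> tower n v \<in> sets M"
  by (simp add: tower_eq)

lemma cell_disjoint: "disjoint_family_on (cell n v) K"
  by (auto simp: disjoint_family_on_def cell_def)

text \<open>Invariance moves the integral at depth k to depth k + 1, and the eigenvalue relation
  costs a factor c per step. Taken with the constant function 1 and c = 1, this also shows that all
  levels of a tower are equally large.\<close>

lemma cell_integral:
  fixes g :: "'x \<Rightarrow> complex"
  assumes g: "integrable M g" and eig: "AE x in M. g (T x) = c * g x"
    and n: "n \<ge> 1" and k: "k < H n v"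
  shows "(LINT x:cell n v 0|M. g x) = c ^ k * (LINT x:cell n v k|M. g x)"
  using k
proof (induction k)
  case (Suc k)
  have [measurable]: "g \<in> borel_measurable M" using g by auto
  have [measurable]: "cell n v k \<in> sets M" "cell n v (Suc k) \<in> sets M" using n by measurable
  have "(LINT x:cell n v k|M. g x) = (\<integral>x. indicator (cell n v k) (T x) *\<^sub>R g (T x) \<partial>M)"
    unfolding set_lebesgue_integral_def by (rule integral_T[symmetric]) measurable
  also have "\<dots> = (\<integral>x. indicator (cell n v (Suc k)) x *\<^sub>R (c * g x) \<partial>M)"
  proof (rule integral_cong_AE)
    show "AE x in M. indicator (cell n v k) (T x) *\<^sub>R g (T x) = indicator (cell n v (Suc k)) x *\<^sub>R (c * g x)"
      using eig AE_space by eventually_elim (use cell_vimage[OF n Suc.prems] in \<open>auto simp: indicator_def\<close>)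
  qed measurable
  also have "\<dots> = c * (LINT x:cell n v (Suc k)|M. g x)"
    unfolding set_lebesgue_integral_def mult_scaleR_right[symmetric] by (rule integral_mult_right_zero)
  finally show ?case using Suc by (simp add: mult.assoc)
qed simp

lemma cell_measure:
  assumes n: "n \<ge> 1" and k: "k < H n v"
  shows "measure M (cell n v k) = measure M (tower n v) / H n v"
proof -
  have eq: "measure M (cell n v i) = measure M (cell n v 0)" if "i < H n v" for i
  proof -
    have int: "(LINT x:cell n v k|M. 1) = complex_of_real (measure M (cell n v k))" for k
      using cell_measurable[OF n] by (simp add: set_lebesgue_integral_def scaleR_conv_of_real)
    have "(LINT x:cell n v 0|M. 1) = 1 ^ i * (LINT x:cell n v i|M. 1 :: complex)"
      by (rule cell_integral[OF _ _ n that]) auto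
    then show ?thesis unfolding int by (simp only: power_one mult_1_left of_real_eq_iff)
  qed
  have "measure M (tower n v) = (\<Sum>i<H n v. measure M (cell n v i))"
    unfolding tower_eq[OF n]
    by (rule finite_measure_finite_Union) (use n cell_disjoint in auto)
  also have "\<dots> = (\<Sum>i<H n v. measure M (cell n v 0))" by (intro sum.cong refl eq) simp
  finally show ?thesis using k eq[OF k] by simp
qed

text \<open>One inclusion is \<open>split\<close>. For the other, \<open>merge\<close> supplies one
  point with the prescribed positions at both levels, and \<open>determined\<close> carries its
  position at level m to every point of the same cell of level n.\<close>

lemma tower_decomp:
  assumes mn: "1 \<le> m" "m < n" and j: "j < H m u"
  shows "cell m u j \<inter> tower n v = (\<Union>\<sigma>\<in>Off m n u v. cell n v (j + \<sigma>))"
    and "\<sigma> \<in> Off m n u v \<Longrightarrow> j + \<sigma> < H n v"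
proof -
  show "j + \<sigma> < H n v" if "\<sigma> \<in> Off m n u v" for \<sigma>
    using merge[OF mn that j] R_less[of n] mn by force
  show "cell m u j \<inter> tower n v = (\<Union>\<sigma>\<in>Off m n u v. cell n v (j + \<sigma>))"
  proof (intro equalityI subsetI)
    fix x assume "x \<in> cell m u j \<inter> tower n v"
    then show "x \<in> (\<Union>\<sigma>\<in>Off m n u v. cell n v (j + \<sigma>))"
      using split[OF mn, of x] by (auto simp: cell_def tower_def)
  next
    fix x assume "x \<in> (\<Union>\<sigma>\<in>Off m n u v. cell n v (j + \<sigma>))"
    then obtain \<sigma> where s: "\<sigma> \<in> Off m n u v" "x \<in> space M" "\<tau> n x = v" "R n x = j + \<sigma>"
      by (auto simp: cell_def)
    obtain y where "y \<in> space M" "\<tau> m y = u" "R m y = j" "\<tau> n y = v" "R n y = j + \<sigma>"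
      using merge[OF mn s(1) j] by blast
    then show "x \<in> cell m u j \<inter> tower n v"
      using determined[of m n x y] mn s by (simp add: cell_def tower_def)
  qed
qed

lemma cell_shift_disjoint: "disjoint_family_on (\<lambda>\<sigma>. cell n v (j + \<sigma>)) K"
  by (auto simp: disjoint_family_on_def cell_def)

lemma measure_cell_tower:
  assumes mn: "1 \<le> m" "m < n" and j: "j < H m u"
  shows "measure M (cell m u j \<inter> tower n v) = card (Off m n u v) * (measure M (tower n v) / H n v)"
proof -
  have "measure M (cell m u j \<inter> tower n v) = (\<Sum>\<sigma>\<in>Off m n u v. measure M (cell n v (j + \<sigma>)))"
    unfolding tower_decomp(1)[OF mn j]
    by (rule finite_measure_finite_Union) (use mn cell_shift_disjoint finite_Off in auto)
  also have "\<dots> = (\<Sum>\<sigma>\<in>Off m n u v. measure M (tower n v) / H n v)"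
    using tower_decomp(2)[OF mn j] cell_measure mn by (intro sum.cong) auto
  finally show ?thesis by simp
qed

lemma measure_tower_tower:
  assumes mn: "1 \<le> m" "m < n"
  shows "measure M (tower m u \<inter> tower n v) = measure M (tower n v) * weight m n u v"
proof -
  have "tower m u \<inter> tower n v = (\<Union>j<H m u. cell m u j \<inter> tower n v)"
    using tower_eq[OF mn(1)] by auto
  also have "measure M \<dots> = (\<Sum>j<H m u. measure M (cell m u j \<inter> tower n v))"
    by (rule finite_measure_finite_Union) (use mn in \<open>auto simp: disjoint_family_on_def\<close>, auto simp: cell_def)
  also have "\<dots> = (\<Sum>j<H m u. card (Off m n u v) * (measure M (tower n v) / H n v))"
    using measure_cell_tower[OF mn] by (intro sum.cong) auto
  finally show ?thesis by (simp add: weight_def)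
qed

lemma weight_le:
  assumes "1 \<le> m" "m < n"
  shows "measure M (tower n v) * weight m n u v \<le> measure M (tower m u)"
  unfolding measure_tower_tower[OF assms, symmetric]
  by (rule finite_measure_mono) (use assms in auto)

lemma sum_weight:
  assumes mn: "1 \<le> m" "m < n" and p: "measure M (tower n v) > 0"
  shows "(\<Sum>u\<in>{1..d}. weight m n u v) = 1"
proof -
  have "measure M (tower n v) = measure M (\<Union>u\<in>{1..d}. tower m u \<inter> tower n v)"
    by (rule arg_cong[where f = "measure M"]) (use tau_range[OF mn(1)] in \<open>auto simp: tower_def\<close>)
  also have "\<dots> = (\<Sum>u\<in>{1..d}. measure M (tower m u \<inter> tower n v))"
    by (rule finite_measure_finite_Union) (use mn in \<open>auto simp: disjoint_family_on_def\<close>, auto simp: tower_def)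
  also have "\<dots> = measure M (tower n v) * (\<Sum>u\<in>{1..d}. weight m n u v)"
    by (simp add: measure_tower_tower[OF mn] sum_distrib_left)
  finally show ?thesis using p by simp
qed

lemma sum_tower: assumes "n \<ge> 1" shows "(\<Sum>v\<in>{1..d}. measure M (tower n v)) = 1"
proof -
  have "space M = (\<Union>v\<in>{1..d}. tower n v)" using tau_range[OF assms] by (auto simp: tower_def)
  then have "1 = measure M (\<Union>v\<in>{1..d}. tower n v)" by (simp flip: prob_space)
  also have "\<dots> = (\<Sum>v\<in>{1..d}. measure M (tower n v))"
    by (rule finite_measure_finite_Union) (use assms in \<open>auto simp: disjoint_family_on_def\<close>, auto simp: tower_def)
  finally show ?thesis by simp
qed

lemma osc_nonneg: "0 \<le> osc c m n u v"
  by (simp add: osc_def)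

lemma osc_le_weight:
  assumes "norm c = 1" shows "osc c m n u v \<le> weight m n u v"
proof -
  have "norm (\<Sum>\<sigma>\<in>Off m n u v. c ^ \<sigma>) \<le> (\<Sum>\<sigma>\<in>Off m n u v. norm (c ^ \<sigma>))" by (rule norm_sum)
  also have "\<dots> = card (Off m n u v)" using assms by (simp add: norm_power)
  finally show ?thesis unfolding osc_def weight_def by (intro mult_left_mono) auto
qed

section \<open>Integrals over the partition into cells, and approximation in L1\<close>

lemma index_set_finite: "finite (index_set n)"
  by (simp add: index_set_def)

lemma sum_index_set: "(\<Sum>(u, j)\<in>index_set n. f u j) = (\<Sum>u\<in>{1..d}. \<Sum>j<H n u. f u j)"
  unfolding index_set_def by (rule sum.Sigma[symmetric]) auto

lemma sum_indicator_cell: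
  assumes "n \<ge> 1" "x \<in> space M"
  shows "(\<Sum>(u, j)\<in>index_set n. indicator (cell n u j) x *\<^sub>R (y :: 'b::real_vector)) = y"
proof -
  have i: "(\<tau> n x, R n x) \<in> index_set n"
    using assms tau_range[of n x] R_less[of n x] by (simp add: index_set_def)
  have "(\<Sum>(u, j)\<in>index_set n. indicator (cell n u j) x *\<^sub>R y) =
      (\<Sum>p\<in>index_set n. if p = (\<tau> n x, R n x) then y else 0)"
    by (intro sum.cong) (use assms in \<open>auto simp: cell_def indicator_def\<close>)
  also have "\<dots> = y" using i by (simp add: index_set_finite)
  finally show ?thesis .
qed

lemma sum_cell_integral:
  fixes f :: "'x \<Rightarrow> 'b::{banach, second_countable_topology}"
  assumes f: "integrable M f" and n: "n \<ge> 1"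
  shows "(\<Sum>(u, j)\<in>index_set n. LINT x:cell n u j|M. f x) = (\<integral>x. f x \<partial>M)"
proof -
  have i: "integrable M (\<lambda>x. indicator (cell n u j) x *\<^sub>R f x)" for u j
    using f n by (intro integrable_mult_indicator) auto
  have "(\<Sum>(u, j)\<in>index_set n. LINT x:cell n u j|M. f x) =
      (\<integral>x. (\<Sum>p\<in>index_set n. indicator (cell n (fst p) (snd p)) x *\<^sub>R f x) \<partial>M)"
    unfolding set_lebesgue_integral_def using i by (subst Bochner_Integration.integral_sum) (auto simp: case_prod_beta)
  also have "\<dots> = (\<integral>x. f x \<partial>M)"
    by (intro Bochner_Integration.integral_cong refl)
       (use sum_indicator_cell[OF n] in \<open>simp add: case_prod_beta\<close>)
  finally show ?thesis .
qed

lemma level_fun_integrable: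
  fixes a :: "nat \<Rightarrow> nat \<Rightarrow> complex"
  assumes n: "n \<ge> 1" shows "integrable M (\<lambda>x. a (\<tau> n x) (R n x))"
proof -
  have "integrable M (\<lambda>x. \<Sum>p\<in>index_set n. indicator (cell n (fst p) (snd p)) x *\<^sub>R a (fst p) (snd p))"
    using n by (intro Bochner_Integration.integrable_sum integrable_mult_indicator) auto
  moreover have "(\<Sum>p\<in>index_set n. indicator (cell n (fst p) (snd p)) x *\<^sub>R a (fst p) (snd p)) =
      a (\<tau> n x) (R n x)" if x: "x \<in> space M" for x
  proof -
    have "(\<Sum>p\<in>index_set n. indicator (cell n (fst p) (snd p)) x *\<^sub>R a (fst p) (snd p)) =
      (\<Sum>(u, j)\<in>index_set n. indicator (cell n u j) x *\<^sub>R a (\<tau> n x) (R n x))"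
      by (intro sum.cong) (auto simp: cell_def indicator_def)
    then show ?thesis using sum_indicator_cell[OF n x] by simp
  qed
  ultimately show ?thesis
    by (rule iffD1[OF Bochner_Integration.integrable_cong[OF refl], rotated]) simp
qed

text \<open>Approximation by functions constant on cells is demanded at every level from some m0 on,
  not just at one: m0 later serves as the threshold for all m in the uniform convergence.\<close>

definition approximable :: "('x \<Rightarrow> complex) \<Rightarrow> bool" where
  "approximable g \<longleftrightarrow> integrable M g \<and>
    (\<forall>\<epsilon>>0. \<exists>m0\<ge>1. \<forall>m\<ge>m0. \<exists>a. (\<integral>x. norm (g x - a (\<tau> m x) (R m x)) \<partial>M) < \<epsilon>)"

lemma approximable_add:
  assumes f: "approximable f" and g: "approximable g" shows "approximable (\<lambda>x. f x + g x)"
  unfolding approximable_def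
proof (intro conjI allI impI)
  have i: "integrable M f" "integrable M g" using f g by (auto simp: approximable_def)
  then show "integrable M (\<lambda>x. f x + g x)" by simp
  fix \<epsilon> :: real assume "\<epsilon> > 0"
  then have e2: "\<epsilon> / 2 > 0" by simp
  obtain m1 where m1: "m1 \<ge> 1" "\<forall>m\<ge>m1. \<exists>a. (\<integral>x. norm (f x - a (\<tau> m x) (R m x)) \<partial>M) < \<epsilon> / 2"
    using f e2 unfolding approximable_def by meson
  obtain m2 where m2: "m2 \<ge> 1" "\<forall>m\<ge>m2. \<exists>a. (\<integral>x. norm (g x - a (\<tau> m x) (R m x)) \<partial>M) < \<epsilon> / 2"
    using g e2 unfolding approximable_def by meson
  show "\<exists>m0\<ge>1. \<forall>m\<ge>m0. \<exists>a. (\<integral>x. norm (f x + g x - a (\<tau> m x) (R m x)) \<partial>M) < \<epsilon>"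
  proof (intro exI[of _ "max m1 m2"] conjI allI impI)
    fix m assume m: "m \<ge> max m1 m2"
    then have m': "m \<ge> 1" using m1 by simp
    obtain a b where a: "(\<integral>x. norm (f x - a (\<tau> m x) (R m x)) \<partial>M) < \<epsilon> / 2"
      and b: "(\<integral>x. norm (g x - b (\<tau> m x) (R m x)) \<partial>M) < \<epsilon> / 2"
      using m1(2) m2(2) m by (meson max.bounded_iff)
    note ia = level_fun_integrable[OF m', of a] and ib = level_fun_integrable[OF m', of b]
    have "(\<integral>x. norm (f x + g x - (a (\<tau> m x) (R m x) + b (\<tau> m x) (R m x))) \<partial>M) \<le>
        (\<integral>x. norm (f x - a (\<tau> m x) (R m x)) + norm (g x - b (\<tau> m x) (R m x)) \<partial>M)"
      using i ia ib by (intro integral_mono) (auto simp: norm_diff_triangle_ineq)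
    also have "\<dots> < \<epsilon>" using i ia ib a b by simp
    finally show "\<exists>a. (\<integral>x. norm (f x + g x - a (\<tau> m x) (R m x)) \<partial>M) < \<epsilon>"
      by (intro exI[of _ "\<lambda>u j. a u j + b u j"])
  qed (use m1 in auto)
qed

lemma approximable_mult:
  assumes f: "approximable f" shows "approximable (\<lambda>x. c * f x)"
  unfolding approximable_def
proof (intro conjI allI impI)
  have i: "integrable M f" using f by (auto simp: approximable_def)
  then show "integrable M (\<lambda>x. c * f x)" by simp
  fix \<epsilon> :: real assume "\<epsilon> > 0"
  \<comment> \<open>The summand 1 keeps the denominator positive when c = 0.\<close>
  then have "\<epsilon> / (norm c + 1) > 0" by (simp add: add_nonneg_pos)
  then obtain m1 where m1: "m1 \<ge> 1"
    "\<forall>m\<ge>m1. \<exists>a. (\<integral>x. norm (f x - a (\<tau> m x) (R m x)) \<partial>M) < \<epsilon> / (norm c + 1)"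
    using f unfolding approximable_def by meson
  show "\<exists>m0\<ge>1. \<forall>m\<ge>m0. \<exists>a. (\<integral>x. norm (c * f x - a (\<tau> m x) (R m x)) \<partial>M) < \<epsilon>"
  proof (intro exI[of _ m1] conjI allI impI)
    fix m assume m: "m \<ge> m1"
    then obtain a where a: "(\<integral>x. norm (f x - a (\<tau> m x) (R m x)) \<partial>M) < \<epsilon> / (norm c + 1)"
      using m1(2) by blast
    have "(\<integral>x. norm (c * f x - c * a (\<tau> m x) (R m x)) \<partial>M) =
        norm c * (\<integral>x. norm (f x - a (\<tau> m x) (R m x)) \<partial>M)"
      by (simp flip: right_diff_distrib add: norm_mult)
    also have "\<dots> \<le> (norm c + 1) * (\<integral>x. norm (f x - a (\<tau> m x) (R m x)) \<partial>M)"
      by (intro mult_right_mono) auto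
    also have "\<dots> < \<epsilon>"
      using a by (subst (asm) pos_less_divide_eq) (auto simp: mult.commute add_nonneg_pos)
    finally show "\<exists>a. (\<integral>x. norm (c * f x - a (\<tau> m x) (R m x)) \<partial>M) < \<epsilon>"
      by (intro exI[of _ "\<lambda>u j. c * a u j"])
  qed (use m1 in auto)
qed

lemma approximable_lim:
  assumes s: "\<And>i. approximable (s i)" and g: "integrable M g"
    and lim: "(\<lambda>i. \<integral>x. norm (s i x - g x) \<partial>M) \<longlonglongrightarrow> 0"
  shows "approximable g"
  unfolding approximable_def
proof (intro conjI allI impI g)
  fix \<epsilon> :: real assume "\<epsilon> > 0"
  then have e2: "\<epsilon> / 2 > 0" by simp
  have "\<forall>\<^sub>F i in sequentially. (\<integral>x. norm (s i x - g x) \<partial>M) < \<epsilon> / 2"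
    using order_tendstoD(2)[OF lim e2] .
  then obtain i where si: "(\<integral>x. norm (s i x - g x) \<partial>M) < \<epsilon> / 2"
    by (auto simp: eventually_sequentially)
  have ii: "integrable M (s i)" using s by (auto simp: approximable_def)
  obtain m1 where m1: "m1 \<ge> 1" "\<forall>m\<ge>m1. \<exists>a. (\<integral>x. norm (s i x - a (\<tau> m x) (R m x)) \<partial>M) < \<epsilon> / 2"
    using s[of i] e2 unfolding approximable_def by meson
  show "\<exists>m0\<ge>1. \<forall>m\<ge>m0. \<exists>a. (\<integral>x. norm (g x - a (\<tau> m x) (R m x)) \<partial>M) < \<epsilon>"
  proof (intro exI[of _ m1] conjI allI impI)
    fix m assume m: "m \<ge> m1"
    then obtain a where a: "(\<integral>x. norm (s i x - a (\<tau> m x) (R m x)) \<partial>M) < \<epsilon> / 2"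
      using m1(2) by blast
    have ia: "integrable M (\<lambda>x. a (\<tau> m x) (R m x))" using level_fun_integrable m m1 by simp
    have "norm (g x - a (\<tau> m x) (R m x)) \<le> norm (s i x - g x) + norm (s i x - a (\<tau> m x) (R m x))" for x
      using norm_triangle_ineq4[of "s i x - a (\<tau> m x) (R m x)" "s i x - g x"] by simp
    then have "(\<integral>x. norm (g x - a (\<tau> m x) (R m x)) \<partial>M) \<le>
        (\<integral>x. norm (s i x - g x) + norm (s i x - a (\<tau> m x) (R m x)) \<partial>M)"
      using g ii ia by (intro integral_mono) auto
    also have "\<dots> < \<epsilon>" using g ii ia a si by simp
    finally show "\<exists>a. (\<integral>x. norm (g x - a (\<tau> m x) (R m x)) \<partial>M) < \<epsilon>" by blast
  qed (use m1 in auto)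
qed

lemma approximable_lim_dominated:
  assumes s: "\<And>i. approximable (s i)" and g[measurable]: "g \<in> borel_measurable M" and w: "integrable M w"
    and lim: "\<And>x. x \<in> space M \<Longrightarrow> (\<lambda>i. s i x) \<longlonglongrightarrow> g x"
    and bound: "\<And>i x. x \<in> space M \<Longrightarrow> norm (s i x) \<le> w x"
  shows "approximable g"
proof (rule approximable_lim[OF s])
  have [measurable]: "s i \<in> borel_measurable M" for i using s[of i] by (auto simp: approximable_def)
  have gw: "norm (g x) \<le> w x" if "x \<in> space M" for x
    using LIMSEQ_le_const2[OF tendsto_norm[OF lim[OF that]]] bound[OF that] by blast
  then show "integrable M g"
    by (intro Bochner_Integration.integrable_bound[OF w]) (auto intro!: AE_I2 order_trans[OF gw abs_ge_self])
  have "(\<lambda>i. \<integral>x. norm (s i x - g x) \<partial>M) \<longlonglongrightarrow> (\<integral>x. 0 \<partial>M)"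
  proof (rule integral_dominated_convergence[where w = "\<lambda>x. 2 * w x"])
    show "AE x in M. (\<lambda>i. norm (s i x - g x)) \<longlonglongrightarrow> 0"
      using lim by (intro AE_I2) (simp add: tendsto_norm_zero_iff LIM_zero_iff)
    show "AE x in M. norm (norm (s i x - g x)) \<le> 2 * w x" for i
    proof (intro AE_I2)
      fix x assume "x \<in> space M"
      then show "norm (norm (s i x - g x)) \<le> 2 * w x"
        using norm_triangle_ineq4[of "s i x" "g x"] bound[of x i] gw[of x] by simp
    qed
  qed (use w in auto)
  then show "(\<lambda>i. \<integral>x. norm (s i x - g x) \<partial>M) \<longlonglongrightarrow> 0" by simp
qed

text \<open>Cells of a level m \<ge> n refine those of level n by \<open>determined\<close>, so b is
  exactly a function of the label at each such level and the error is 0.\<close>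

lemma approximable_level:
  fixes b :: "'x \<Rightarrow> complex"
  assumes n: "n \<ge> 1"
    and b: "\<And>x y. x \<in> space M \<Longrightarrow> y \<in> space M \<Longrightarrow> \<tau> n x = \<tau> n y \<Longrightarrow> R n x = R n y \<Longrightarrow> b x = b y"
  shows "approximable b"
proof -
  have lev: "\<exists>a. \<forall>x\<in>space M. b x = a (\<tau> m x) (R m x)" if "m \<ge> n" for m
  \<comment> \<open>A label is turned into a value by evaluating b at a chosen point of the cell;
    for empty cells the value is arbitrary and never met.\<close>
  proof (intro exI[of _ "\<lambda>v k. b (SOME y. y \<in> space M \<and> \<tau> m y = v \<and> R m y = k)"] ballI)
    fix x assume x: "x \<in> space M"
    define y where "y = (SOME y. y \<in> space M \<and> \<tau> m y = \<tau> m x \<and> R m y = R m x)"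
    have y: "y \<in> space M \<and> \<tau> m y = \<tau> m x \<and> R m y = R m x"
      unfolding y_def by (rule someI[of _ x]) (use x in simp)
    then have "b x = b y"
      using determined[OF n that, of y x] x by (intro b) auto
    then show "b x = b (SOME y. y \<in> space M \<and> \<tau> m y = \<tau> m x \<and> R m y = R m x)"
      by (simp add: y_def)
  qed
  show ?thesis
    unfolding approximable_def
  proof (intro conjI allI impI)
    obtain a where a: "\<forall>x\<in>space M. b x = a (\<tau> n x) (R n x)" using lev[OF order_refl] by blast
    then show "integrable M b"
      using level_fun_integrable[OF n, of a] Bochner_Integration.integrable_cong[OF refl, of M b "\<lambda>x. a (\<tau> n x) (R n x)"]
      by simp
    fix \<epsilon> :: real assume "\<epsilon> > 0"
    show "\<exists>m0\<ge>1. \<forall>m\<ge>m0. \<exists>a. (\<integral>x. norm (b x - a (\<tau> m x) (R m x)) \<partial>M) < \<epsilon>"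
    proof (rule exI[of _ n], intro conjI n allI impI)
      fix m assume "n \<le> m"
      from lev[OF this] obtain a where a: "\<forall>x\<in>space M. b x = a (\<tau> m x) (R m x)" by blast
      have "(\<integral>x. norm (b x - a (\<tau> m x) (R m x)) \<partial>M) = (\<integral>x. 0 \<partial>M)"
        by (rule Bochner_Integration.integral_cong) (simp_all add: a)
      then show "\<exists>a. (\<integral>x. norm (b x - a (\<tau> m x) (R m x)) \<partial>M) < \<epsilon>" using \<open>\<epsilon> > 0\<close>
        by (intro exI[of _ a]) simp
    qed
  qed
qed

lemma approximable_indicator:
  assumes "A \<in> sets M" shows "approximable (indicator A)"
proof -
  have "A \<in> sigma_sets (space M) G" using assms sets_G by simp
  from Int_stable_G sets_G(1) this show ?thesis
  proof (induction rule: sigma_sets_induct_disjoint)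
    case (basic U)
    have US: "U \<subseteq> space M" "U \<in> sets M" using basic sets_G by auto
    \<comment> \<open>The union of the cells of level n contained in U. By \<open>G_open\<close> and
      \<open>determined\<close> each point of U lies in all of these sets from some level
      on.\<close>
    define U' where "U' n = {x \<in> space M. \<forall>y\<in>space M. \<tau> n y = \<tau> n x \<and> R n y = R n x \<longrightarrow> y \<in> U}" for n
    show ?case
    proof (rule approximable_lim_dominated[where s = "\<lambda>i. indicator (U' (Suc i))" and w = "\<lambda>_. 1"])
      show "approximable (indicator (U' (Suc i)))" for i
        by (rule approximable_level[of "Suc i"]) (auto simp: U'_def indicator_def)
      fix x assume x: "x \<in> space M"
      have "\<forall>\<^sub>F i in sequentially. indicator (U' (Suc i)) x = (indicator U x :: complex)"
      proof (cases "x \<in> U")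
        case True
        then obtain n where n: "n \<ge> 1" "\<forall>y\<in>space M. \<tau> n y = \<tau> n x \<and> R n y = R n x \<longrightarrow> y \<in> U"
          using G_open[OF basic] by blast
        have "x \<in> U' i" if "n \<le> i" for i
          using n x determined[OF n(1) that] unfolding U'_def by blast
        then show ?thesis
          using True by (intro eventually_sequentiallyI[of n]) (simp add: indicator_def)
      next
        case False
        then have "x \<notin> U' i" for i using x by (auto simp: U'_def)
        then show ?thesis using False by simp
      qed
      then show "(\<lambda>i. indicator (U' (Suc i)) x) \<longlonglongrightarrow> (indicator U x :: complex)"
        by (rule tendsto_eventually)
    qed (use US in \<open>auto simp: indicator_def\<close>)
  next
    case empty
    show ?case by (rule approximable_level[of 1]) auto
  next
    case (compl A)
    have "approximable (\<lambda>x. indicator (space M) x + (- 1) * indicator A x)"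
      by (intro approximable_add approximable_mult compl)
         (rule approximable_level[of 1], auto)
    moreover have "(\<lambda>x. indicator (space M) x + (- 1) * indicator A x) = (indicator (space M - A) :: 'x \<Rightarrow> complex)"
    proof
      have "A \<subseteq> space M" using compl(1) sets_G sets.sets_into_space by metis
      then show "indicator (space M) x + (- 1) * indicator A x = (indicator (space M - A) x :: complex)" for x
        by (auto simp: indicator_def)
    qed
    ultimately show ?case by simp
  next
    case (union A)
    have AM: "A i \<in> sets M" for i using union(2) sets_G by auto
    have *: "(\<Sum>i<n. indicator (A i) x) = (indicator (\<Union>i<n. A i) x :: complex)" for n x
      using union(1) by (subst indicator_UN_disjoint) (auto simp: disjoint_family_on_def)
    show ?case
    proof (rule approximable_lim_dominated[where s = "\<lambda>n. indicator (\<Union>i<n. A i)" and w = "\<lambda>_. 1"])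
      have "approximable (\<lambda>x. \<Sum>i<n. indicator (A i) x)" for n
      proof (induction n)
        case 0 show ?case by (rule approximable_level[of 1]) auto
      next
        case (Suc n) then show ?case by (simp add: approximable_add union)
      qed
      then show "approximable (indicator (\<Union>i<n. A i))" for n by (simp add: *)
      show "(\<lambda>n. indicator (\<Union>i<n. A i) x) \<longlonglongrightarrow> (indicator (\<Union>i. A i) x :: complex)" for x
        by (rule LIMSEQ_indicator_UN)
    qed (use AM in \<open>auto simp: indicator_def\<close>)
  qed
qed

lemma approximable:
  fixes g :: "'x \<Rightarrow> complex"
  assumes "integrable M g" shows "approximable g"
  using assms
proof (induction rule: integrable_induct)
  case (base A c)
  have "approximable (\<lambda>x. c * indicator A x)"
    by (intro approximable_mult approximable_indicator base)
  moreover have "(\<lambda>x. c * indicator A x) = (\<lambda>x. indicat_real A x *\<^sub>R c)"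
    by (auto simp: indicator_def)
  ultimately show ?case by simp
next
  case (add f g) then show ?case by (intro approximable_add)
next
  case (lim f s)
  then show ?case
    by (intro approximable_lim_dominated[of s f "\<lambda>x. 2 * norm (f x)"]) auto
qed

section \<open>From an eigenfunction to small defects\<close>

lemma integral_indicator_scaleR:
  fixes c :: "'b::{banach, second_countable_topology}"
  assumes "A \<in> sets M"
  shows "(\<integral>x. indicat_real A x *\<^sub>R c \<partial>M) = measure M A *\<^sub>R c"
  using assms by (simp add: less_top[symmetric])

lemma AE_funpow:
  assumes "AE x in M. P x" shows "AE x in M. P ((T ^^ k) x)"
proof (induction k)
  case (Suc k)
  from AE_T[OF Suc] show ?case by (simp add: funpow_swap1)
qed (use assms in simp)

text \<open>The locale assumption concerns strictly invariant sets. The set of points that visit A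
  infinitely often is strictly invariant, and it equals A up to a null set because almost every
  orbit lies entirely inside or entirely outside A.\<close>

lemma invariant_zero_one:
  assumes A: "A \<in> sets M" and inv: "AE x in M. T x \<in> A \<longleftrightarrow> x \<in> A"
  shows "measure M A = 0 \<or> measure M A = 1"
proof -
  define A' where "A' = {x \<in> space M. \<forall>N. \<exists>k\<ge>N. (T ^^ k) x \<in> A}"
  have eq: "A' = (\<Inter>N. \<Union>k\<in>{N..}. (T ^^ k) -` A \<inter> space M)"
    by (rule set_eqI) (simp add: A'_def Bex_def, blast)
  have "(T ^^ k) -` A \<inter> space M \<in> sets M" for k
    using measurable_compose_n[OF T_measurable] A by (rule measurable_sets)
  then have A'm: "A' \<in> sets M" unfolding eq
    by (intro sets.countable_INT' sets.countable_UN' image_subsetI) auto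
  have "T x \<in> A' \<longleftrightarrow> x \<in> A'" if x: "x \<in> space M" for x
  proof -
    have "(\<forall>N. \<exists>k\<ge>N. (T ^^ k) (T x) \<in> A) \<longleftrightarrow> (\<forall>N. \<exists>k\<ge>N. (T ^^ Suc k) x \<in> A)"
      by (simp add: funpow_swap1)
    also have "\<dots> \<longleftrightarrow> (\<forall>N. \<exists>k\<ge>N. (T ^^ k) x \<in> A)"
      by (metis Suc_le_D Suc_le_mono le_SucI)
    finally show ?thesis using x T_space by (simp add: A'_def)
  qed
  then have "T -` A' \<inter> space M = A'" by (auto simp: A'_def)
  then have 01: "measure M A' = 0 \<or> measure M A' = 1" by (rule ergodic[OF A'm])
  have "AE x in M. \<forall>k. (T ^^ k) (T x) \<in> A \<longleftrightarrow> (T ^^ k) x \<in> A"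
    unfolding AE_all_countable using AE_funpow[OF inv] by (simp add: funpow_swap1)
  then have "AE x in M. x \<in> A' \<longleftrightarrow> x \<in> A"
    using AE_space
  proof eventually_elim
    case (elim x)
    have "(T ^^ k) x \<in> A \<longleftrightarrow> x \<in> A" for k
      by (induction k) (use elim in \<open>auto simp: funpow_swap1\<close>)
    then show ?case using elim by (auto simp: A'_def)
  qed
  then have "measure M A' = measure M A" by (rule measure_eq_AE[OF _ A'm A])
  with 01 show ?thesis by simp
qed

text \<open>The set where f is nonzero is invariant up to null sets and not null, so it has measure
  1. Then \<open>sgn\<close> normalises f: it is multiplicative and fixes c, and its value 0 at 0
  makes the bound 1 valid everywhere.\<close>

lemma unimodular_eigenfunction:
  assumes "eigenvalue_for T M c" and c: "norm c = 1"
  obtains g where "g \<in> borel_measurable M" "\<And>x. norm (g x) \<le> 1"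
    "AE x in M. norm (g x) = 1" "AE x in M. g (T x) = c * g x"
proof -
  obtain f where f[measurable]: "f \<in> borel_measurable M" and nz: "\<not> (AE x in M. f x = 0)"
    and eig: "AE x in M. f (T x) = c * f x"
    using assms by (auto simp: eigenvalue_for_def)
  define A where "A = {x \<in> space M. f x \<noteq> 0}"
  have A: "A \<in> sets M" unfolding A_def by measurable
  have "AE x in M. T x \<in> A \<longleftrightarrow> x \<in> A"
    using eig AE_space by eventually_elim (use c T_space in \<open>auto simp: A_def\<close>)
  then have "measure M A = 0 \<or> measure M A = 1" by (rule invariant_zero_one[OF A])
  moreover have "measure M A \<noteq> 0"
  proof
    assume "measure M A = 0"
    then have "AE x in M. x \<notin> A" using A by (simp add: prob_eq_0)
    then have "AE x in M. f x = 0" using AE_space by eventually_elim (auto simp: A_def)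
    then show False using nz by simp
  qed
  ultimately have "AE x in M. x \<in> A" using A by (simp add: prob_eq_1)
  then have 1: "AE x in M. norm (sgn (f x)) = 1" by eventually_elim (simp add: A_def norm_sgn)
  have "sgn c = c" using c by (simp add: sgn_div_norm)
  have 2: "AE x in M. sgn (f (T x)) = c * sgn (f x)"
    using eig by eventually_elim (simp add: sgn_mult \<open>sgn c = c\<close>)
  have 3: "(\<lambda>x. sgn (f x)) \<in> borel_measurable M" unfolding sgn_div_norm by measurable
  have 4: "norm (sgn (f x)) \<le> 1" for x by (simp add: norm_sgn)
  show ?thesis by (rule that[OF 3 4 1 2])
qed

text \<open>On the unit circle 1 / c is the conjugate of c, and the common factor of exponent j has
  modulus 1.\<close>

lemma norm_unit_sum:
  fixes c :: complex
  assumes c: "norm c = 1"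
  shows "norm (\<Sum>\<sigma>\<in>S. (1 / c) ^ (j + \<sigma>)) = norm (\<Sum>\<sigma>\<in>S. c ^ \<sigma>)"
proof -
  have "1 / c = cnj c" using c by (metis complex_norm_square div_by_1 divide_divide_eq_left mult_cancel_left1
      nonzero_mult_div_cancel_left norm_zero of_real_1 power_one zero_neq_one)
  then have "(\<Sum>\<sigma>\<in>S. (1 / c) ^ (j + \<sigma>)) = cnj c ^ j * cnj (\<Sum>\<sigma>\<in>S. c ^ \<sigma>)"
    by (simp add: power_add sum_distrib_left)
  then show ?thesis by (simp only: norm_mult norm_power complex_mod_cnj c power_one mult_1_left)
qed

text \<open>The pieces of the cell are cells of level n at depths \<open>j + \<sigma>\<close>;
  \<open>cell_integral\<close> transports each of them to the top cell, leaving only a power of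
  c.\<close>

lemma cell_tower_integral:
  fixes g :: "'x \<Rightarrow> complex"
  assumes g: "integrable M g" and eig: "AE x in M. g (T x) = c * g x" and c: "norm c = 1"
    and mn: "1 \<le> m" "m < n" and j: "j < H m u"
  shows "(LINT x:cell m u j \<inter> tower n v|M. g x) =
    (LINT x:cell n v 0|M. g x) * (\<Sum>\<sigma>\<in>Off m n u v. (1 / c) ^ (j + \<sigma>))"
proof -
  have n: "n \<ge> 1" using mn by simp
  have "(LINT x:cell m u j \<inter> tower n v|M. g x) = (\<Sum>\<sigma>\<in>Off m n u v. LINT x:cell n v (j + \<sigma>)|M. g x)"
    unfolding tower_decomp(1)[OF mn j]
  proof (rule set_integral_finite_Union)
    show "set_integrable M (cell n v (j + \<sigma>)) g" for \<sigma>
      unfolding set_integrable_def using g n by (intro integrable_mult_indicator) auto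
  qed (use n finite_Off cell_shift_disjoint in auto)
  also have "\<dots> = (\<Sum>\<sigma>\<in>Off m n u v. (LINT x:cell n v 0|M. g x) * (1 / c) ^ (j + \<sigma>))"
  proof (intro sum.cong refl)
    fix \<sigma> assume "\<sigma> \<in> Off m n u v"
    then have "(LINT x:cell n v 0|M. g x) = c ^ (j + \<sigma>) * (LINT x:cell n v (j + \<sigma>)|M. g x)"
      using cell_integral[OF g eig n] tower_decomp(2)[OF mn j] by blast
    moreover have "c \<noteq> 0" using c by auto
    ultimately show "(LINT x:cell n v (j + \<sigma>)|M. g x) = (LINT x:cell n v 0|M. g x) * (1 / c) ^ (j + \<sigma>)"
      by (simp add: power_one_over)
  qed
  finally show ?thesis by (simp add: sum_distrib_left)
qed

lemma norm_cell_integral_le: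
  fixes g :: "'x \<Rightarrow> complex"
  assumes g: "g \<in> borel_measurable M" "\<And>x. norm (g x) \<le> 1" and A: "A \<in> sets M"
  shows "norm (LINT x:A|M. g x) \<le> measure M A"
proof -
  have "norm (LINT x:A|M. g x) \<le> (\<integral>x. norm (indicator A x *\<^sub>R g x) \<partial>M)"
    unfolding set_lebesgue_integral_def by (rule integral_norm_bound)
  also have "\<dots> \<le> (\<integral>x. indicator A x \<partial>M)"
  proof (rule integral_mono)
    show "integrable M (\<lambda>x. norm (indicator A x *\<^sub>R g x))"
    proof (rule bounded_integrable[of _ 1])
      show "norm (norm (indicat_real A x *\<^sub>R g x)) \<le> 1" for x using g(2)[of x] by (simp add: indicator_def)
    qed (use g A in auto)
    show "norm (indicator A x *\<^sub>R g x) \<le> indicator A x" for x using g(2)[of x] by (simp add: indicator_def)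
  qed (use A in \<open>auto simp: less_top[symmetric]\<close>)
  finally show ?thesis using A by simp
qed

text \<open>Each piece has modulus at most the measure of one level of tower v times the modulus of
  the phase sum. This bound does not depend on the depth j, and the \<open>H m u\<close> values of j
  produce \<open>osc\<close>.\<close>

lemma sum_norm_cell_integral_le:
  fixes g :: "'x \<Rightarrow> complex"
  assumes g: "g \<in> borel_measurable M" "\<And>x. norm (g x) \<le> 1"
    and eig: "AE x in M. g (T x) = c * g x" and c: "norm c = 1" and mn: "1 \<le> m" "m < n"
  shows "(\<Sum>(u, j)\<in>index_set m. norm (LINT x:cell m u j|M. g x)) \<le>
    (\<Sum>v\<in>{1..d}. measure M (tower n v) * (\<Sum>u\<in>{1..d}. osc c m n u v))"
proof -
  have n: "n \<ge> 1" using mn by simp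
  have gi: "integrable M g" by (rule bounded_integrable[of _ 1]) (use g in auto)
  have "norm (LINT x:cell m u j|M. g x) \<le>
      (\<Sum>v\<in>{1..d}. measure M (tower n v) / H n v * norm (\<Sum>\<sigma>\<in>Off m n u v. c ^ \<sigma>))"
    if uj: "(u, j) \<in> index_set m" for u j
  proof -
    have j: "j < H m u" using uj by (simp add: index_set_def)
    have "cell m u j = (\<Union>v\<in>{1..d}. cell m u j \<inter> tower n v)"
      using tau_range[OF n] by (auto simp: cell_def tower_def)
    then have "(LINT x:cell m u j|M. g x) = (LINT x:(\<Union>v\<in>{1..d}. cell m u j \<inter> tower n v)|M. g x)"
      by simp
    also have "\<dots> = (\<Sum>v\<in>{1..d}. LINT x:cell m u j \<inter> tower n v|M. g x)"
    proof (rule set_integral_finite_Union)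
      show "set_integrable M (cell m u j \<inter> tower n v) g" for v
        unfolding set_integrable_def using gi mn n by (intro integrable_mult_indicator) auto
      show "disjoint_family_on (\<lambda>v. cell m u j \<inter> tower n v) {1..d}"
        by (auto simp: disjoint_family_on_def tower_def)
    qed (use mn n in auto)
    also have "norm \<dots> \<le> (\<Sum>v\<in>{1..d}. norm (LINT x:cell m u j \<inter> tower n v|M. g x))" by (rule norm_sum)
    also have "\<dots> \<le> (\<Sum>v\<in>{1..d}. measure M (tower n v) / H n v * norm (\<Sum>\<sigma>\<in>Off m n u v. c ^ \<sigma>))"
    proof (rule sum_mono)
      fix v assume v: "v \<in> {1..d}"
      have "norm (LINT x:cell n v 0|M. g x) \<le> measure M (tower n v) / H n v"
        using norm_cell_integral_le[OF g cell_measurable[OF n], of v 0] cell_measure[OF n H_pos[OF n v]] by simp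
      then show "norm (LINT x:cell m u j \<inter> tower n v|M. g x) \<le>
          measure M (tower n v) / H n v * norm (\<Sum>\<sigma>\<in>Off m n u v. c ^ \<sigma>)"
        unfolding cell_tower_integral[OF gi eig c mn j] norm_mult norm_unit_sum[OF c]
        by (intro mult_right_mono) auto
    qed
    finally show ?thesis .
  qed
  then have "(\<Sum>(u, j)\<in>index_set m. norm (LINT x:cell m u j|M. g x)) \<le>
      (\<Sum>(u, j)\<in>index_set m. \<Sum>v\<in>{1..d}. measure M (tower n v) / H n v * norm (\<Sum>\<sigma>\<in>Off m n u v. c ^ \<sigma>))"
    by (intro sum_mono) auto
  also have "\<dots> = (\<Sum>u\<in>{1..d}. \<Sum>v\<in>{1..d}. measure M (tower n v) * osc c m n u v)"
    unfolding sum_index_set by (simp add: sum_distrib_left osc_def mult_ac)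
  also have "\<dots> = (\<Sum>v\<in>{1..d}. measure M (tower n v) * (\<Sum>u\<in>{1..d}. osc c m n u v))"
    by (subst sum.swap) (simp add: sum_distrib_left)
  finally show ?thesis .
qed

text \<open>For towers of positive measure the conditional probabilities add up to 1; towers of
  measure 0 contribute nothing to either side.\<close>

lemma weight_sum_total:
  assumes "1 \<le> m" "m < n"
  shows "(\<Sum>v\<in>{1..d}. measure M (tower n v) * (\<Sum>u\<in>{1..d}. weight m n u v)) = 1"
proof -
  have "measure M (tower n v) * (\<Sum>u\<in>{1..d}. weight m n u v) = measure M (tower n v)" for v
    using sum_weight[OF assms, of v] measure_nonneg[of M "tower n v"]
    by (cases "measure M (tower n v) = 0") auto
  then show ?thesis using sum_tower[of n] assms by (simp only:)
qed

text \<open>A function constant on a cell loses no modulus under integration over it. Passing from g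
  to such a function and back costs the L1 error twice, which explains the factor 2.\<close>

lemma sum_norm_cell_integral_ge:
  fixes g :: "'x \<Rightarrow> complex"
  assumes g: "g \<in> borel_measurable M" "\<And>x. norm (g x) \<le> 1" and g1: "AE x in M. norm (g x) = 1"
    and m: "m \<ge> 1" and a: "(\<integral>x. norm (g x - a (\<tau> m x) (R m x)) \<partial>M) < \<epsilon>"
  shows "(\<Sum>(u, j)\<in>index_set m. norm (LINT x:cell m u j|M. g x)) \<ge> 1 - 2 * \<epsilon>"
proof -
  let ?a = "\<lambda>x. a (\<tau> m x) (R m x)"
  have gi: "integrable M g" by (rule bounded_integrable[of _ 1]) (use g in auto)
  have ai: "integrable M ?a" using level_fun_integrable[OF m] .
  have si: "set_integrable M (cell m u j) f" if "integrable M f" for u j and f :: "'x \<Rightarrow> 'b::{banach, second_countable_topology}"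
    unfolding set_integrable_def using that m by (intro integrable_mult_indicator) auto
  have "norm (LINT x:cell m u j|M. g x) \<ge>
      (LINT x:cell m u j|M. norm (g x)) - 2 * (LINT x:cell m u j|M. norm (g x - ?a x))" for u j
  proof -
    let ?C = "cell m u j"
    have int_a: "(LINT x:?C|M. ?a x) = measure M ?C *\<^sub>R a u j"
    proof -
      have "(LINT x:?C|M. ?a x) = (\<integral>x. indicat_real ?C x *\<^sub>R a u j \<partial>M)"
        unfolding set_lebesgue_integral_def
        by (intro Bochner_Integration.integral_cong) (auto simp: cell_def indicator_def)
      also have "\<dots> = measure M ?C *\<^sub>R a u j"
        using m by (intro integral_indicator_scaleR) simp
      finally show ?thesis .
    qed
    have int_na: "(LINT x:?C|M. norm (?a x)) = measure M ?C * norm (a u j)"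
    proof -
      have "(LINT x:?C|M. norm (?a x)) = (\<integral>x. indicat_real ?C x *\<^sub>R norm (a u j) \<partial>M)"
        unfolding set_lebesgue_integral_def
        by (intro Bochner_Integration.integral_cong) (auto simp: cell_def indicator_def)
      also have "\<dots> = measure M ?C *\<^sub>R norm (a u j)"
        using m by (intro integral_indicator_scaleR) simp
      finally show ?thesis by simp
    qed
    have "norm (LINT x:?C|M. ?a x) - norm (LINT x:?C|M. g x) \<le> norm (LINT x:?C|M. ?a x - g x)"
      using norm_triangle_ineq2[of "LINT x:?C|M. ?a x" "LINT x:?C|M. g x"] si[OF gi] si[OF ai]
      by (simp add: set_integral_diff)
    also have "\<dots> \<le> (LINT x:?C|M. norm (?a x - g x))"
      using si[OF Bochner_Integration.integrable_diff[OF ai gi]] by (rule set_integral_norm_bound)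
    finally have 1: "measure M ?C * norm (a u j) - (LINT x:?C|M. norm (g x - ?a x)) \<le> norm (LINT x:?C|M. g x)"
      by (simp add: int_a norm_minus_commute)
    have "(LINT x:?C|M. norm (g x)) \<le> (LINT x:?C|M. norm (?a x) + norm (g x - ?a x))"
    proof (rule set_integral_mono)
      show "set_integrable M ?C (\<lambda>x. norm (g x))" using gi by (intro si) auto
      show "set_integrable M ?C (\<lambda>x. norm (?a x) + norm (g x - ?a x))" using gi ai by (intro si) auto
      show "norm (g x) \<le> norm (?a x) + norm (g x - ?a x)" for x
        using norm_triangle_ineq[of "?a x" "g x - ?a x"] by simp
    qed
    also have "\<dots> = measure M ?C * norm (a u j) + (LINT x:?C|M. norm (g x - ?a x))"
      using gi ai by (subst set_integral_add(2)) (auto intro!: si simp: int_na)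
    finally show ?thesis using 1 by linarith
  qed
  then have "(\<Sum>(u, j)\<in>index_set m. (LINT x:cell m u j|M. norm (g x)) - 2 * (LINT x:cell m u j|M. norm (g x - ?a x)))
      \<le> (\<Sum>(u, j)\<in>index_set m. norm (LINT x:cell m u j|M. g x))"
    by (intro sum_mono) auto
  moreover have "(\<Sum>(u, j)\<in>index_set m. (LINT x:cell m u j|M. norm (g x)) - 2 * (LINT x:cell m u j|M. norm (g x - ?a x)))
      = (\<integral>x. norm (g x) \<partial>M) - 2 * (\<integral>x. norm (g x - ?a x) \<partial>M)"
    using sum_cell_integral[OF integrable_norm[OF gi] m]
      sum_cell_integral[OF integrable_norm[OF Bochner_Integration.integrable_diff[OF gi ai]] m]
    by (simp add: case_prod_beta sum_subtractf flip: sum_distrib_left)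
  moreover have "(\<integral>x. norm (g x) \<partial>M) = (\<integral>x. 1 \<partial>M)"
    by (rule integral_cong_AE) (use g g1 in auto)
  ultimately show ?thesis using a by (simp add: prob_space)
qed

text \<open>All weighted defects are nonnegative, so each is at most their total, which is 1 minus
  the average of the sums of \<open>osc\<close>. The threshold m0 comes from approximating g and
  does not involve n, u or v.\<close>

lemma eigenvalue_imp_small_defect:
  assumes ev: "eigenvalue_for T M c" and c: "norm c = 1" and "\<epsilon> > 0"
  shows "\<exists>m0\<ge>1. \<forall>m\<ge>m0. \<forall>n>m. \<forall>u\<in>{1..d}. \<forall>v\<in>{1..d}.
    measure M (tower n v) * (weight m n u v - osc c m n u v) \<le> \<epsilon>"
proof -
  obtain g where g: "g \<in> borel_measurable M" "\<And>x. norm (g x) \<le> 1" and g1: "AE x in M. norm (g x) = 1"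
    and eig: "AE x in M. g (T x) = c * g x"
    using unimodular_eigenfunction[OF ev c] by blast
  have "integrable M g" by (rule bounded_integrable[of _ 1]) (use g in auto)
  then have "approximable g" by (rule approximable)
  moreover have "\<epsilon> / 2 > 0" using \<open>\<epsilon> > 0\<close> by simp
  ultimately obtain m0 where m0: "m0 \<ge> 1"
    "\<forall>m\<ge>m0. \<exists>a. (\<integral>x. norm (g x - a (\<tau> m x) (R m x)) \<partial>M) < \<epsilon> / 2"
    unfolding approximable_def by blast
  show ?thesis
  proof (intro exI[of _ m0] conjI allI impI ballI m0(1))
    fix m n u v assume m: "m \<ge> m0" and n: "m < n" and u: "u \<in> {1..d}" and v: "v \<in> {1..d}"
    have m1: "1 \<le> m" using m m0 by simp
    let ?D = "\<lambda>v u. measure M (tower n v) * (weight m n u v - osc c m n u v)"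
    obtain a where a: "(\<integral>x. norm (g x - a (\<tau> m x) (R m x)) \<partial>M) < \<epsilon> / 2" using m0 m by blast
    have D0: "0 \<le> ?D v u" for u v
      using osc_le_weight[OF c] by (intro mult_nonneg_nonneg) auto
    have "?D v u \<le> (\<Sum>u\<in>{1..d}. ?D v u)"
      using u D0 by (intro member_le_sum) auto
    also have "\<dots> \<le> (\<Sum>v\<in>{1..d}. \<Sum>u\<in>{1..d}. ?D v u)"
      using v D0 by (intro member_le_sum[of v "{1..d}" "\<lambda>v. \<Sum>u\<in>{1..d}. ?D v u"] sum_nonneg) auto
    also have "\<dots> = (\<Sum>v\<in>{1..d}. measure M (tower n v) * (\<Sum>u\<in>{1..d}. weight m n u v)) -
        (\<Sum>v\<in>{1..d}. measure M (tower n v) * (\<Sum>u\<in>{1..d}. osc c m n u v))"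
      by (simp add: sum_distrib_left sum_subtractf right_diff_distrib)
    also have "\<dots> \<le> 1 - (1 - 2 * (\<epsilon> / 2))"
      using weight_sum_total[OF m1 n] sum_norm_cell_integral_le[OF g eig c m1 n]
        sum_norm_cell_integral_ge[OF g g1 m1 a] by linarith
    finally show "?D v u \<le> \<epsilon>" by simp
  qed
qed

section \<open>Equivalence of the two conditions\<close>

lemma cond_sum_iff_cond_each:
  assumes c: "norm c = 1" and I: "I \<subseteq> {1..d}" and \<delta>: "\<delta> > 0"
    and big: "\<And>v n. v \<in> I \<Longrightarrow> n \<ge> 1 \<Longrightarrow> measure M (tower n v) \<ge> \<delta>"
    and small: "\<And>u. u \<in> {1..d} - I \<Longrightarrow> (\<lambda>n. measure M (tower n u)) \<longlonglongrightarrow> 0"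
    and v: "v \<in> I"
  shows "converges_uniformly_above (\<lambda>m n. \<Sum>u\<in>I. osc c m n u v) 1 \<longleftrightarrow>
    (\<forall>u\<in>{1..d}. converges_uniformly_above (\<lambda>m n. weight m n u v - osc c m n u v) 0)"
    (is "?L \<longleftrightarrow> ?R")
proof -
  have fI: "finite I" using I finite_subset by blast
  have d: "d \<ge> 1" using v I by auto
  have pos: "measure M (tower n v) > 0" if "n \<ge> 1" for n using big[OF v that] \<delta> by linarith
  \<comment> \<open>The weight is at most the measure of tower u of level m divided by \<delta>.
    This bound does not mention n, hence the uniformity.\<close>
  have out: "\<forall>\<^sub>F m in sequentially. \<forall>n>m. weight m n u v \<le> \<epsilon>" if u: "u \<in> {1..d} - I" and e: "\<epsilon> > 0" for u \<epsilon>
  proof -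
    have "\<forall>\<^sub>F m in sequentially. measure M (tower m u) < \<epsilon> * \<delta>"
      using order_tendstoD(2)[OF small[OF u], of "\<epsilon> * \<delta>"] e \<delta> by simp
    then show ?thesis
      using eventually_ge_at_top[of 1]
    proof eventually_elim
      case (elim m)
      show ?case
      proof (intro allI impI)
        fix n assume n: "m < n"
        have w0: "0 \<le> weight m n u v" by (simp add: weight_def)
        have "\<delta> * weight m n u v \<le> measure M (tower n v) * weight m n u v"
          using big[OF v, of n] n elim w0 by (intro mult_right_mono) auto
        also have "\<dots> \<le> measure M (tower m u)" using weight_le[of m n v u] elim n by simp
        also have "\<dots> < \<delta> * \<epsilon>" using elim by (simp add: mult.commute)
        finally show "weight m n u v \<le> \<epsilon>" using \<delta> by simp
      qed
    qed
  qed
  \<comment> \<open>Both implications are read off this identity, in which all summands on the right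
    are nonnegative.\<close>
  have key: "1 - (\<Sum>u\<in>I. osc c m n u v) =
      (\<Sum>u\<in>I. weight m n u v - osc c m n u v) + (\<Sum>u\<in>{1..d} - I. weight m n u v)"
    if "1 \<le> m" "m < n" for m n
    using sum_weight[OF that pos] that sum.subset_diff[OF I, of "\<lambda>u. weight m n u v"]
    by (simp add: sum_subtractf)
  have w0: "0 \<le> weight m n u v" for m n u by (simp add: weight_def)
  have D0: "0 \<le> weight m n u v - osc c m n u v" for m n u using osc_le_weight[OF c] by simp
  show ?thesis
  proof
    assume L: ?L
    show ?R
    proof
      fix u assume u: "u \<in> {1..d}"
      show "converges_uniformly_above (\<lambda>m n. weight m n u v - osc c m n u v) 0"
      proof (cases "u \<in> I")
        case True
        show ?thesis
          unfolding converges_uniformly_above_iff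
        proof (intro allI impI)
          fix \<epsilon> :: real assume "\<epsilon> > 0"
          with L have "\<forall>\<^sub>F m in sequentially. \<forall>n>m. \<bar>(\<Sum>u\<in>I. osc c m n u v) - 1\<bar> \<le> \<epsilon>"
            by (simp add: converges_uniformly_above_iff)
          then show "\<forall>\<^sub>F m in sequentially. \<forall>n>m. \<bar>weight m n u v - osc c m n u v - 0\<bar> \<le> \<epsilon>"
            using eventually_ge_at_top[of 1]
          proof eventually_elim
            case (elim m)
            show ?case
            proof (intro allI impI)
              fix n assume n: "m < n"
              have "weight m n u v - osc c m n u v \<le> (\<Sum>u\<in>I. weight m n u v - osc c m n u v)"
                by (rule member_le_sum[OF True _ fI]) (rule D0)
              also have "\<dots> \<le> 1 - (\<Sum>u\<in>I. osc c m n u v)"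
                using key[OF elim(2) n] sum_nonneg[of "{1..d} - I" "\<lambda>u. weight m n u v"] w0 by simp
              also have "\<dots> \<le> \<epsilon>" using elim(1) n by (auto simp: abs_le_iff)
              finally show "\<bar>weight m n u v - osc c m n u v - 0\<bar> \<le> \<epsilon>" using D0[of m n u] by simp
            qed
          qed
        qed
      next
        case False
        show ?thesis
          unfolding converges_uniformly_above_iff
        proof (intro allI impI)
          fix \<epsilon> :: real assume "\<epsilon> > 0"
          with u False have "\<forall>\<^sub>F m in sequentially. \<forall>n>m. weight m n u v \<le> \<epsilon>" using out by simp
          then show "\<forall>\<^sub>F m in sequentially. \<forall>n>m. \<bar>weight m n u v - osc c m n u v - 0\<bar> \<le> \<epsilon>"
          proof eventually_elim
            case (elim m)
            then show ?case using D0[of m _ u] osc_nonneg[of c m _ u v] by (auto simp: abs_le_iff intro: order_trans[rotated])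
          qed
        qed
      qed
    qed
  next
    assume R: ?R
    show ?L
      unfolding converges_uniformly_above_iff
    proof (intro allI impI)
      fix \<epsilon> :: real assume "\<epsilon> > 0"
      \<comment> \<open>The d vertices, inside and outside \<open>I\<close>, share the tolerance
        equally.\<close>
      then have e: "\<epsilon> / d > 0" using d by simp
      have "\<forall>\<^sub>F m in sequentially. \<forall>u\<in>I. \<forall>n>m. weight m n u v - osc c m n u v \<le> \<epsilon> / d"
      proof (intro eventually_ball_finite fI ballI)
        fix u assume "u \<in> I"
        then have "\<forall>\<^sub>F m in sequentially. \<forall>n>m. \<bar>weight m n u v - osc c m n u v - 0\<bar> \<le> \<epsilon> / d"
          using R I e unfolding converges_uniformly_above_iff by blast
        then show "\<forall>\<^sub>F m in sequentially. \<forall>n>m. weight m n u v - osc c m n u v \<le> \<epsilon> / d"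
          by eventually_elim (auto simp: abs_le_iff)
      qed
      moreover have "\<forall>\<^sub>F m in sequentially. \<forall>u\<in>{1..d} - I. \<forall>n>m. weight m n u v \<le> \<epsilon> / d"
        by (intro eventually_ball_finite ballI out e) auto
      ultimately show "\<forall>\<^sub>F m in sequentially. \<forall>n>m. \<bar>(\<Sum>u\<in>I. osc c m n u v) - 1\<bar> \<le> \<epsilon>"
        using eventually_ge_at_top[of 1]
      proof eventually_elim
        case (elim m)
        show ?case
        proof (intro allI impI)
          fix n assume n: "m < n"
          have "1 - (\<Sum>u\<in>I. osc c m n u v) \<le> (\<Sum>u\<in>I. \<epsilon> / d) + (\<Sum>u\<in>{1..d} - I. \<epsilon> / d)"
            unfolding key[OF elim(3) n] by (intro add_mono sum_mono) (use elim n in auto)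
          also have "\<dots> = (\<Sum>u\<in>{1..d}. \<epsilon> / d)" using sum.subset_diff[OF I, of "\<lambda>_. \<epsilon> / d"] by simp
          also have "\<dots> = \<epsilon>" using d by simp
          finally have "1 - (\<Sum>u\<in>I. osc c m n u v) \<le> \<epsilon>" .
          moreover have "0 \<le> 1 - (\<Sum>u\<in>I. osc c m n u v)"
            unfolding key[OF elim(3) n] by (intro add_nonneg_nonneg sum_nonneg D0 w0)
          ultimately show "\<bar>(\<Sum>u\<in>I. osc c m n u v) - 1\<bar> \<le> \<epsilon>" by simp
        qed
      qed
    qed
  qed
qed

text \<open>The bound 1/2 for one m and all later n says that a fixed share of the phases at v does
  not cancel on the cells of level m; this is what keeps the weak limit from being 0.\<close>

lemma cond_imp_eigenvalue:
  assumes c: "norm c = 1" and \<delta>: "\<delta> > 0"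
    and big: "\<And>n. n \<ge> 1 \<Longrightarrow> measure M (tower n v) \<ge> \<delta>" and v: "v \<in> {1..d}"
    and m: "m \<ge> 1" and I: "I \<subseteq> {1..d}" and osc: "\<And>n. n > m \<Longrightarrow> (\<Sum>u\<in>I. osc c m n u v) \<ge> 1 / 2"
  shows "eigenvalue_for T M c"
proof -
  have c0: "c \<noteq> 0" using c by auto
  \<comment> \<open>The shift to level \<open>Suc (m + n)\<close> keeps every level above m. The sum
    of indicators makes measurability evident; \<open>w_eq\<close> gives the pointwise form.\<close>
  define w :: "nat \<Rightarrow> 'x \<Rightarrow> complex"
    where "w n x = (\<Sum>k<H (Suc (m + n)) v. indicator (cell (Suc (m + n)) v k) x *\<^sub>R (1 / c) ^ k)" for n x
  let ?N = "\<lambda>n. Suc (m + n)"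
  have w_eq: "w n x = (if x \<in> space M \<and> \<tau> (?N n) x = v then (1 / c) ^ R (?N n) x else 0)" for n x
  proof (cases "x \<in> space M \<and> \<tau> (?N n) x = v")
    case True
    then have "R (?N n) x < H (?N n) v" using R_less[of "?N n" x] by auto
    moreover have "w n x = (\<Sum>k<H (?N n) v. if k = R (?N n) x then (1 / c) ^ R (?N n) x else 0)"
      unfolding w_def by (intro sum.cong) (use True in \<open>auto simp: cell_def indicator_def\<close>)
    ultimately show ?thesis using True by simp
  next
    case False
    then have "w n x = (\<Sum>k<H (?N n) v. 0)"
      unfolding w_def by (intro sum.cong) (auto simp: cell_def indicator_def)
    then show ?thesis using False by auto
  qed
  have w1: "norm (w n x) \<le> 1" for n x using c by (simp add: w_eq norm_power norm_divide)
  have wm: "w n \<in> borel_measurable M" for n unfolding w_def by measurable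
  have w_T: "w n (T x) = c * w n x" if "x \<in> space M" "R (?N n) x > 0" for n x
    using R_step[of "?N n" x] that T_space[of x] c0 by (auto simp: w_eq)
  \<comment> \<open>On the cell at depth 0 of level m the depth at the higher level is the offset
    itself, so the integral is a multiple of the conjugate of the phase sum in
    \<open>osc\<close>.\<close>
  have w_int: "(LINT x:cell m u 0|M. w n x) =
      of_real (measure M (tower (?N n) v) / H (?N n) v) * (\<Sum>\<sigma>\<in>Off m (?N n) u v. (1 / c) ^ \<sigma>)"
    if u: "u \<in> {1..d}" for u n
  proof -
    have Hu: "0 < H m u" using H_pos[OF m u] .
    have mn: "m < ?N n" by simp
    have wi: "integrable M (w n)" by (rule bounded_integrable[of _ 1]) (use w1 wm in auto)
    have "(LINT x:cell m u 0|M. w n x) = (LINT x:cell m u 0 \<inter> tower (?N n) v|M. w n x)"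
      unfolding set_lebesgue_integral_def
      by (intro Bochner_Integration.integral_cong) (auto simp: indicator_def tower_def cell_def w_eq)
    also have "\<dots> = (\<Sum>\<sigma>\<in>Off m (?N n) u v. LINT x:cell (?N n) v (0 + \<sigma>)|M. w n x)"
      unfolding tower_decomp(1)[OF m mn Hu]
    proof (rule set_integral_finite_Union)
      show "set_integrable M (cell (?N n) v (0 + \<sigma>)) (w n)" for \<sigma>
        unfolding set_integrable_def using wi by (intro integrable_mult_indicator) auto
    qed (use finite_Off cell_shift_disjoint[of _ _ 0] in auto)
    also have "\<dots> = (\<Sum>\<sigma>\<in>Off m (?N n) u v. of_real (measure M (tower (?N n) v) / H (?N n) v) * (1 / c) ^ \<sigma>)"
    proof (intro sum.cong refl)
      fix \<sigma> assume \<sigma>: "\<sigma> \<in> Off m (?N n) u v"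
      have "(LINT x:cell (?N n) v (0 + \<sigma>)|M. w n x) = (\<integral>x. indicat_real (cell (?N n) v \<sigma>) x *\<^sub>R (1 / c) ^ \<sigma> \<partial>M)"
        unfolding set_lebesgue_integral_def
        by (intro Bochner_Integration.integral_cong) (auto simp: indicator_def cell_def w_eq)
      also have "\<dots> = measure M (cell (?N n) v \<sigma>) *\<^sub>R (1 / c) ^ \<sigma>"
        by (intro integral_indicator_scaleR) simp
      also have "measure M (cell (?N n) v \<sigma>) = measure M (tower (?N n) v) / H (?N n) v"
        using tower_decomp(2)[OF m mn Hu \<sigma>] by (intro cell_measure) auto
      finally show "(LINT x:cell (?N n) v (0 + \<sigma>)|M. w n x) =
          of_real (measure M (tower (?N n) v) / H (?N n) v) * (1 / c) ^ \<sigma>"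
        by (simp add: scaleR_conv_of_real)
    qed
    finally show ?thesis by (simp add: sum_distrib_left)
  qed
  define K where "K = (\<Sum>u\<in>{1..d}. real (H m u))"
  have K0: "K > 0" unfolding K_def using H_pos[OF m] v by (intro sum_pos2[of _ v]) auto
  \<comment> \<open>The integrals weighted by heights add up to at least \<delta>/2, while K is the
    total height; so not all of them can stay below \<delta>/(2K).\<close>
  have some_large: "\<exists>u\<in>{1..d}. norm (LINT x:cell m u 0|M. w n x) \<ge> \<delta> / (2 * K)" for n
  proof (rule ccontr)
    assume "\<not> ?thesis"
    then have lt: "norm (LINT x:cell m u 0|M. w n x) < \<delta> / (2 * K)" if "u \<in> {1..d}" for u using that by force
    have oe: "measure M (tower (?N n) v) * osc c m (?N n) u v = H m u * norm (LINT x:cell m u 0|M. w n x)"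
      if "u \<in> {1..d}" for u
      using norm_unit_sum[OF c, of 0 "Off m (?N n) u v"]
      by (simp add: w_int[OF that] osc_def norm_mult norm_divide)
    have "\<delta> * (1 / 2) \<le> measure M (tower (?N n) v) * (\<Sum>u\<in>I. osc c m (?N n) u v)"
      using big[of "?N n"] osc[of "?N n"] \<delta> by (intro mult_mono) auto
    also have "\<dots> \<le> measure M (tower (?N n) v) * (\<Sum>u\<in>{1..d}. osc c m (?N n) u v)"
      using I by (intro mult_left_mono sum_mono2) (auto simp: osc_nonneg)
    also have "\<dots> = (\<Sum>u\<in>{1..d}. H m u * norm (LINT x:cell m u 0|M. w n x))"
      by (simp add: sum_distrib_left oe)
    also have "\<dots> < (\<Sum>u\<in>{1..d}. H m u * (\<delta> / (2 * K)))"
      using lt H_pos[OF m] v by (intro sum_strict_mono mult_strict_left_mono) auto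
    also have "\<dots> = \<delta> * (1 / 2)" using K0 by (simp add: K_def flip: sum_divide_distrib sum_distrib_right)
    finally show False by simp
  qed
  \<comment> \<open>Pigeonhole over the finitely many vertices: one and the same cell is large for
    infinitely many n.\<close>
  have "\<exists>u\<in>{1..d}. \<not> (\<forall>\<^sub>F n in sequentially. norm (LINT x:cell m u 0|M. w n x) < \<delta> / (2 * K))"
  proof (rule ccontr)
    assume "\<not> ?thesis"
    then have "\<forall>\<^sub>F n in sequentially. \<forall>u\<in>{1..d}. norm (LINT x:cell m u 0|M. w n x) < \<delta> / (2 * K)"
      by (intro eventually_ball_finite) auto
    then obtain n where "\<forall>u\<in>{1..d}. norm (LINT x:cell m u 0|M. w n x) < \<delta> / (2 * K)"
      by (auto simp: eventually_sequentially)
    then show False using some_large[of n] by force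
  qed
  then obtain u where u: "u \<in> {1..d}"
    and "\<not> (\<forall>\<^sub>F n in sequentially. norm (LINT x:cell m u 0|M. w n x) < \<delta> / (2 * K))" by blast
  from not_eventually_sequentiallyD[OF this(2)] obtain r :: "nat \<Rightarrow> nat" where r: "strict_mono r"
    and large: "\<And>n. norm (LINT x:cell m u 0|M. w (r n) x) \<ge> \<delta> / (2 * K)" by (auto simp: not_less)
  have cm: "cell m u 0 \<in> sets M" using m by simp
  have "norm (LINT x:cell m u 0|M. w (r n) x) \<le> 1" for n
    using norm_cell_integral_le[OF wm w1 cm, of "r n"] prob_le_1[of "cell m u 0"] by linarith
  then have "bounded (range (\<lambda>n. LINT x:cell m u 0|M. w (r n) x))" by (auto simp: bounded_iff)
  from bounded_imp_convergent_subsequence[OF this] obtain z s where s: "strict_mono s"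
    and lim: "((\<lambda>n. LINT x:cell m u 0|M. w (r n) x) \<circ> s) \<longlonglongrightarrow> z" by blast
  have "norm z \<ge> \<delta> / (2 * K)"
    using large by (intro tendsto_lowerbound[OF tendsto_norm[OF lim]]) (auto simp: o_def)
  moreover have "\<delta> / (2 * K) > 0" using \<delta> K0 by simp
  ultimately have z0: "z \<noteq> 0" by auto
  let ?w = "\<lambda>n. w (r (s n))"
  obtain f g where f: "f \<in> borel_measurable M" and g: "\<And>n. g n \<in> midhull ?w n"
    and gf: "AE x in M. (\<lambda>n. g n x) \<longlonglongrightarrow> f x" and fz: "(LINT x:cell m u 0|M. f x) = z"
    by (rule weak_limit_exists[of ?w "cell m u 0" z]) (use wm w1 cm lim in \<open>auto simp: o_def\<close>)
  \<comment> \<open>The subsequences only raise the level, so members of a late tail live on levels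
    where the point is no longer at a top.\<close>
  have rs: "n \<le> r (s n)" for n
    using r s strict_mono_imp_increasing strict_mono_o[OF r s] by (metis comp_apply)
  have eig: "AE x in M. f (T x) = c * f x"
    \<comment> \<open>Convergence is used at x and at its image simultaneously. The combinations
      satisfy the relation exactly from some index on, so the two limits satisfy it too.\<close>
    using gf AE_T[OF gf] top_null AE_space
  proof eventually_elim
    case (elim x)
    then obtain n0 where n0: "\<And>n. n \<ge> n0 \<Longrightarrow> R n x > 0" by blast
    have "g n (T x) = c * g n x" if n: "n \<ge> n0" for n
    proof (rule midhull_eigen[OF g])
      fix k assume "k \<ge> n"
      then have "n0 \<le> ?N (r (s k))" using rs[of k] n by linarith
      then show "w (r (s k)) (T x) = c * w (r (s k)) x" using w_T elim(4) n0 by blast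
    qed
    then have "\<forall>\<^sub>F n in sequentially. g n (T x) = c * g n x" by (auto simp: eventually_sequentially)
    then have "(\<lambda>n. g n (T x)) \<longlonglongrightarrow> c * f x"
      using tendsto_mult_left[OF elim(1), of c] by (simp add: tendsto_cong)
    then show ?case using elim(2) LIMSEQ_unique by blast
  qed
  have f1: "AE x in M. norm (f x) \<le> 1"
    using gf
  proof eventually_elim
    case (elim x)
    show ?case
      by (rule LIMSEQ_le_const2[OF tendsto_norm[OF elim]]) (use midhull_norm_le[OF g w1] in auto)
  qed
  have "AE x in M. norm ((norm (f x))\<^sup>2) \<le> 1"
    using f1 by eventually_elim (simp add: power_le_one)
  then have "integrable M (\<lambda>x. (norm (f x))\<^sup>2)"
    by (rule integrable_const_bound) (use f in auto)
  moreover have "\<not> (AE x in M. f x = 0)"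
  proof
    assume "AE x in M. f x = 0"
    then have "AE x in M. indicator (cell m u 0) x *\<^sub>R f x = 0" by eventually_elim simp
    then have "(LINT x:cell m u 0|M. f x) = 0"
      unfolding set_lebesgue_integral_def by (rule integral_eq_zero_AE)
    then show False using fz z0 by simp
  qed
  ultimately show ?thesis unfolding eigenvalue_for_def using f eig by blast
qed

end

section \<open>The Vershik map as a system of towers\<close>

lemma cantor_space_Hausdorff: "cantor_space X \<Longrightarrow> Hausdorff_space X"
  unfolding cantor_space_def
  by (metis Hausdorff_space_discrete_topology Hausdorff_space_product_topology homeomorphic_Hausdorff_space)

lemma cantor_space_infinite:
  assumes "cantor_space X" shows "infinite (topspace X)"
proof -
  let ?C = "product_topology (\<lambda>_::nat. discrete_topology (UNIV :: bool set)) UNIV"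
  obtain f where "homeomorphic_map X ?C f"
    using assms by (auto simp: cantor_space_def homeomorphic_space)
  then have "f ` topspace X = topspace ?C" by (rule homeomorphic_imp_surjective_map)
  moreover have "topspace ?C = UNIV" by (simp add: topspace_product_topology)
  moreover have "infinite (UNIV :: (nat \<Rightarrow> bool) set)"
    using finite_fun_UNIVD1[where 'a = nat and 'b = bool] by auto
  ultimately show ?thesis by (metis finite_imageI)
qed

text \<open>The backward half of the orbit is absorbed by the forward half: if the k-th iterate of y
  is x, then y and the iterate of x of order \<open>p * k - k\<close> have the same k-th iterate and
  coincide by injectivity.\<close>

lemma periodic_full_orbit_finite:
  assumes T: "inj_on T (topspace X)" "T ` topspace X \<subseteq> topspace X"
    and x: "x \<in> topspace X" and p: "p > 0" "(T ^^ p) x = x"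
  shows "finite (full_orbit X T x)"
proof -
  have inT: "(T ^^ k) y \<in> topspace X" if "y \<in> topspace X" for k y
    by (induction k) (use that T(2) in auto)
  have injT: "y = z" if "(T ^^ k) y = (T ^^ k) z" "y \<in> topspace X" "z \<in> topspace X" for k y z
    using that(1)
  proof (induction k)
    case (Suc k)
    then have "(T ^^ k) y = (T ^^ k) z"
      using inj_onD[OF T(1)] inT that by simp
    then show ?case by (rule Suc.IH)
  qed simp
  have mult: "(T ^^ (p * k)) x = x" for k
    by (induction k) (auto simp: funpow_add p)
  have red: "(T ^^ k) x = (T ^^ (k mod p)) x" for k
  proof -
    have "(T ^^ k) x = (T ^^ (k mod p + p * (k div p))) x"
      by (rule arg_cong[where f = "\<lambda>n. (T ^^ n) x"]) simp
    also have "\<dots> = (T ^^ (k mod p)) x" by (simp only: funpow_add comp_apply mult)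
    finally show ?thesis .
  qed
  have "full_orbit X T x \<subseteq> (\<lambda>k. (T ^^ k) x) ` {..<p}"
  proof
    fix y assume "y \<in> full_orbit X T x"
    then obtain k where y: "y \<in> topspace X" "y = (T ^^ k) x \<or> x = (T ^^ k) y"
      by (auto simp: full_orbit_def)
    have "\<exists>j. y = (T ^^ j) x"
      using y(2)
    proof
      assume xk: "x = (T ^^ k) y"
      have "k \<le> p * k" using p by simp
      then have "(T ^^ k) ((T ^^ (p * k - k)) x) = (T ^^ (p * k)) x"
        by (metis comp_apply funpow_add le_add_diff_inverse)
      also have "\<dots> = (T ^^ k) y" using mult xk by simp
      finally show ?thesis using injT[OF _ inT[OF x] y(1)] by metis
    qed blast
    then obtain j where "y = (T ^^ (j mod p)) x" using red by blast
    then show "y \<in> (\<lambda>k. (T ^^ k) x) ` {..<p}" using p by auto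
  qed
  then show ?thesis by (rule finite_subset) simp
qed

text \<open>All forward iterates of an atom carry the same mass, so they cannot be pairwise distinct
  and the point is periodic. Its full orbit is then finite, hence closed, and being dense it would
  be the whole infinite space.\<close>

lemma invariant_prob_no_atoms:
  assumes min: "minimal_cantor_system X T" and inv: "invariant_prob X T \<mu>" and x: "x \<in> topspace X"
  shows "{x} \<in> sets \<mu>" "measure \<mu> {x} = 0"
proof -
  interpret prob_space \<mu> using inv by (simp add: invariant_prob_def)
  have C: "cantor_space X" and hom: "homeomorphic_map X X T"
    and dense: "\<And>y. y \<in> topspace X \<Longrightarrow> X closure_of (full_orbit X T y) = topspace X"
    using min by (auto simp: minimal_cantor_system_def)
  have sp: "space \<mu> = topspace X" and sets: "sets \<mu> = sigma_sets (topspace X) {U. openin X U}"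
    and Tm: "T \<in> measurable \<mu> \<mu>" and dist: "distr \<mu> \<mu> T = \<mu>"
    using inv by (auto simp: invariant_prob_def)
  have T1: "t1_space X" using cantor_space_Hausdorff[OF C] by (rule Hausdorff_imp_t1_space)
  have single: "{y} \<in> sets \<mu>" if "y \<in> topspace X" for y
  proof -
    have "openin X (topspace X - {y})"
      using T1 that by (simp add: closedin_t1_singleton openin_diff)
    then have "topspace X - (topspace X - {y}) \<in> sets \<mu>"
      unfolding sets by (intro sigma_sets.Compl sigma_sets.Basic) simp
    moreover have "topspace X - (topspace X - {y}) = {y}" using that by auto
    ultimately show ?thesis by simp
  qed
  show "{x} \<in> sets \<mu>" using single[OF x] .
  have injT: "inj_on T (topspace X)" and surjT: "T ` topspace X = topspace X"
    using homeomorphic_imp_injective_map[OF hom] homeomorphic_imp_surjective_map[OF hom] by auto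
  have inT: "(T ^^ k) x \<in> topspace X" for k
    by (induction k) (use x surjT in auto)
  have atom: "measure \<mu> {(T ^^ k) x} = measure \<mu> {x}" for k
  proof (induction k)
    case (Suc k)
    have "measure \<mu> {T ((T ^^ k) x)} = measure (distr \<mu> \<mu> T) {T ((T ^^ k) x)}" by (simp only: dist)
    also have "\<dots> = measure \<mu> (T -` {T ((T ^^ k) x)} \<inter> space \<mu>)"
      using Tm single[of "T ((T ^^ k) x)"] inT[of "Suc k"] by (intro measure_distr) auto
    also have "T -` {T ((T ^^ k) x)} \<inter> space \<mu> = {(T ^^ k) x}"
      using inT[of k] inj_onD[OF injT] by (auto simp: sp)
    finally show ?case using Suc by simp
  qed simp
  show "measure \<mu> {x} = 0"
  proof (rule ccontr)
    assume nz: "measure \<mu> {x} \<noteq> 0"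
    have "\<not> inj (\<lambda>k. (T ^^ k) x)"
    proof
      assume inj: "inj (\<lambda>k. (T ^^ k) x)"
      have "N * measure \<mu> {x} \<le> 1" for N :: nat
      proof -
        let ?S = "(\<lambda>k. (T ^^ k) x) ` {..<N}"
        have "measure \<mu> ?S = (\<Sum>y\<in>?S. measure \<mu> {y})"
          using inT single by (intro finite_measure_eq_sum_singleton) auto
        also have "\<dots> = (\<Sum>k<N. measure \<mu> {(T ^^ k) x})"
          using inj by (subst sum.reindex) (auto intro: inj_on_subset)
        also have "\<dots> = N * measure \<mu> {x}" by (simp add: atom)
        finally show ?thesis using prob_le_1[of ?S] by simp
      qed
      moreover obtain N :: nat where "1 / measure \<mu> {x} < N" using reals_Archimedean2 by blast
      moreover have "measure \<mu> {x} > 0" using nz by (simp add: zero_less_measure_iff)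
      ultimately show False by (metis divide_less_eq not_le)
    qed
    then obtain i j where ij: "i < j" "(T ^^ i) x = (T ^^ j) x"
      unfolding inj_def by (metis linorder_neqE_nat)
    have "(T ^^ (j - i)) x = x"
      using ij
    proof (induction i arbitrary: j)
      case (Suc i)
      then obtain j' where j': "j = Suc j'" by (cases j) auto
      then have "(T ^^ i) x = (T ^^ j') x" using Suc.prems inj_onD[OF injT] inT by simp
      then show ?case using Suc.IH[of j'] Suc.prems j' by simp
    qed simp
    then have fin: "finite (full_orbit X T x)"
      using periodic_full_orbit_finite[OF injT _ x, of "j - i"] surjT ij by simp
    have "full_orbit X T x \<subseteq> topspace X" by (auto simp: full_orbit_def)
    then have "closedin X (full_orbit X T x)" using T1 fin by (simp add: t1_space_closedin_finite)
    then have "full_orbit X T x = topspace X" using dense[OF x] by (simp add: closure_of_closedin)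
    then show False using fin cantor_space_infinite[OF C] by simp
  qed
qed

context ordered_diagram
begin

section \<open>Cylinders in the path space\<close>

lemma topspace_path_topology: "topspace (path_topology B) = inf_paths B"
  by (auto simp: path_topology_def topspace_product_topology inf_paths_def)

lemma openin_prefix:
  assumes y: "y \<in> inf_paths B"
  shows "openin (path_topology B) {z \<in> inf_paths B. \<forall>i. 1 \<le> i \<and> i \<le> n \<longrightarrow> z i = y i}"
proof (induction n)
  case 0
  have "{z \<in> inf_paths B. \<forall>i. 1 \<le> i \<and> i \<le> 0 \<longrightarrow> z i = y i} = topspace (path_topology B)"
    by (auto simp: topspace_path_topology)
  then show ?case using openin_topspace by simp
next
  case (Suc n)
  have "continuous_map (path_topology B) (discrete_topology (edges B (Suc n))) (\<lambda>z. z (Suc n))"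
    unfolding path_topology_def
    by (intro continuous_map_from_subtopology continuous_map_product_projection) simp
  moreover have "openin (discrete_topology (edges B (Suc n))) {y (Suc n)}"
    using inf_paths_edge[OF y, of "Suc n"] by simp
  ultimately have "openin (path_topology B) {z \<in> topspace (path_topology B). z (Suc n) \<in> {y (Suc n)}}"
    by (rule openin_continuous_map_preimage)
  from openin_Int[OF Suc this] show ?case
    by (rule back_subst[where P = "openin (path_topology B)"])
       (auto simp: topspace_path_topology le_Suc_eq)
qed

lemma open_contains_prefix:
  assumes U: "openin (path_topology B) U" and y: "y \<in> U"
  shows "\<exists>n\<ge>1. \<forall>z\<in>inf_paths B. (\<forall>i. 1 \<le> i \<and> i \<le> n \<longrightarrow> z i = y i) \<longrightarrow> z \<in> U"
proof -
  let ?X = "\<lambda>i. discrete_topology (edges B i)"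
  obtain W where W: "openin (product_topology ?X {1..}) W" "U = W \<inter> inf_paths B"
    using U by (auto simp: path_topology_def openin_subtopology)
  then have "y \<in> W" using y by blast
  from bspec[OF iffD1[OF openin_product_topology_alt W(1)] this] obtain V
    where V: "finite {i \<in> {1..}. V i \<noteq> topspace (?X i)}" "y \<in> Pi\<^sub>E {1..} V" "Pi\<^sub>E {1..} V \<subseteq> W"
    by (elim exE conjE)
  \<comment> \<open>Beyond N the basic open set leaves all coordinates free. The length
    \<open>Suc N\<close> used below is positive even if no coordinate is restricted.\<close>
  obtain N where N: "\<And>i. i \<in> {i \<in> {1..}. V i \<noteq> topspace (?X i)} \<Longrightarrow> i \<le> N"
    using iffD1[OF finite_nat_set_iff_bounded_le V(1)] by auto
  show ?thesis
  proof (intro exI[of _ "Suc N"] conjI ballI impI)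
    fix z assume z: "z \<in> inf_paths B" and agree: "\<forall>i. 1 \<le> i \<and> i \<le> Suc N \<longrightarrow> z i = y i"
    have "z \<in> Pi\<^sub>E {1..} V"
    proof (rule PiE_I)
      fix i :: nat assume i: "i \<in> {1..}"
      show "z i \<in> V i"
      proof (cases "i \<le> N")
        case True
        then show ?thesis using agree i V(2) by (auto simp: PiE_iff)
      next
        case False
        then have "V i = edges B i" using N[of i] i by auto
        then show ?thesis using inf_paths_edge[OF z] i by simp
      qed
    next
      fix i :: nat assume "i \<notin> {1..}"
      then show "z i = undefined" using z by (auto simp: inf_paths_def PiE_def extensional_def)
    qed
    then show "z \<in> U" using V(3) W(2) z by blast
  qed simp
qed

end

section \<open>Passage to the abstract towers, and conclusion\<close>

lemma converges_uniformly_above_cong: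
  assumes "\<And>m n. 1 \<le> m \<Longrightarrow> m < n \<Longrightarrow> a m n = b m n"
  shows "converges_uniformly_above a l \<longleftrightarrow> converges_uniformly_above b l"
  \<comment> \<open>Level 0 never matters because the threshold is at least 1.\<close>
  unfolding converges_uniformly_above_def using assms
  by (metis (no_types, lifting) order_trans)

text \<open>Under \<phi> the cells become cylinders. This makes them open, hence measurable, and
  lets every open set be exhausted by cells, as \<open>G_open\<close> requires of the generating
  family of open sets.\<close>

lemma ergodic_towers_of_representation:
  assumes min: "minimal_cantor_system X T" and rep: "proper_representation B X T \<phi> d"
    and erg: "ergodic_prob X T \<mu>"
  shows "ergodic_towers \<mu> T d (\<lambda>n x. tau B n (\<phi> x)) (\<lambda>n x. depth B n (\<phi> x))
    (tower_height B) (offsets B) {U. openin X U}"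
proof -
  have inv: "invariant_prob X T \<mu>" using erg by (simp add: ergodic_prob_def)
  have po: "properly_ordered B"
    and conj: "homeomorphic_map X (path_topology B) \<phi>" "\<And>x. x \<in> topspace X \<Longrightarrow> \<phi> (T x) = vershik_map B (\<phi> x)"
    and V: "\<And>n. n \<ge> 1 \<Longrightarrow> verts B n = {1..d}"
    using rep by (auto simp: proper_representation_def bratteli_vershik_representation_def topological_conjugacy_def)
  interpret ordered_diagram B
    using po by unfold_locales (simp add: properly_ordered_def)
  have sp: "space \<mu> = topspace X" and sets: "sets \<mu> = sigma_sets (topspace X) {U. openin X U}"
    and Tm: "T \<in> measurable \<mu> \<mu>"
    using inv by (auto simp: invariant_prob_def)
  have \<phi>: "\<phi> x \<in> inf_paths B" if "x \<in> topspace X" for x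
    using homeomorphic_imp_surjective_map[OF conj(1)] that by (auto simp: topspace_path_topology)
  have T: "T x \<in> topspace X" if "x \<in> topspace X" for x
    using measurable_space[OF Tm] that by (simp add: sp)
  have V\<phi>: "vershik_map B (\<phi> x) \<in> inf_paths B" if "x \<in> topspace X" for x
    using \<phi>[OF T[OF that]] conj(2)[OF that] by simp
  have inj: "inj_on \<phi> (topspace X)" using homeomorphic_imp_injective_map[OF conj(1)] .
  have prefix: "\<forall>i. 1 \<le> i \<and> i \<le> n \<longrightarrow> \<phi> y i = \<phi> x i"
    if "n \<ge> 1" "x \<in> topspace X" "y \<in> topspace X" "tau B n (\<phi> y) = tau B n (\<phi> x)"
      "depth B n (\<phi> y) = depth B n (\<phi> x)" for n x y
  proof (intro allI impI)
    fix i assume "1 \<le> i \<and> i \<le> n"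
    then show "\<phi> y i = \<phi> x i"
      using fun_cong[OF depth_inj[OF \<phi>[OF that(3)] \<phi>[OF that(2)] that(1,4,5)], of i] by simp
  qed
  show ?thesis
  proof (intro ergodic_towers.intro ergodic_towers_axioms.intro)
    show "prob_space \<mu>" using inv by (simp add: invariant_prob_def)
    show "T \<in> measurable \<mu> \<mu>" by fact
    show "distr \<mu> \<mu> T = \<mu>" using inv by (simp add: invariant_prob_def)
    show "measure \<mu> A = 0 \<or> measure \<mu> A = 1" if "A \<in> sets \<mu>" "T -` A \<inter> space \<mu> = A" for A
      using erg that by (simp add: ergodic_prob_def)
    show "{x \<in> space \<mu>. tau B n (\<phi> x) = v \<and> depth B n (\<phi> x) = k} \<in> sets \<mu>" if n: "n \<ge> 1" for n v k
    proof -
      let ?A = "{x \<in> space \<mu>. tau B n (\<phi> x) = v \<and> depth B n (\<phi> x) = k}"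
      have "openin X ?A"
      proof (subst openin_subopen, intro ballI)
        fix x assume x: "x \<in> ?A"
        let ?P = "{z \<in> inf_paths B. \<forall>i. 1 \<le> i \<and> i \<le> n \<longrightarrow> z i = \<phi> x i}"
        let ?U = "{y \<in> topspace X. \<phi> y \<in> ?P}"
        have "openin X ?U"
          using openin_continuous_map_preimage[OF homeomorphic_imp_continuous_map[OF conj(1)]
            openin_prefix[OF \<phi>, of x n]] x by (simp add: sp)
        moreover have "x \<in> ?U" using x \<phi> by (simp add: sp)
        moreover have "?U \<subseteq> ?A"
        proof
          fix y assume y: "y \<in> ?U"
          have "restrict (\<phi> y) {0<..n} = restrict (\<phi> x) {0<..n}" using y by (auto simp: restrict_def fun_eq_iff)
          from prefix_eq_imp[OF this n order_refl] show "y \<in> ?A" using x y by (simp add: sp)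
        qed
        ultimately show "\<exists>U. openin X U \<and> x \<in> U \<and> U \<subseteq> ?A" by blast
      qed
      then show ?thesis unfolding sets by (intro sigma_sets.Basic) simp
    qed
    show "tau B n (\<phi> x) \<in> {1..d}" if "n \<ge> 1" "x \<in> space \<mu>" for n x
      using tau_in[OF \<phi> that(1)] that V by (simp add: sp)
    show "depth B n (\<phi> x) < tower_height B n (tau B n (\<phi> x))" if "n \<ge> 1" "x \<in> space \<mu>" for n x
      using depth_less[OF \<phi>] that by (simp add: sp)
    show "0 < tower_height B n v" if "n \<ge> 1" "v \<in> {1..d}" for n v
      using tower_height_pos that V by simp
    show "depth B n (\<phi> x) = Suc (depth B n (\<phi> (T x))) \<and> tau B n (\<phi> (T x)) = tau B n (\<phi> x)"
      if "n \<ge> 1" "x \<in> space \<mu>" "0 < depth B n (\<phi> x)" for n x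
      using depth_vershik_pos[OF \<phi> V\<phi>] that conj(2) by (simp add: sp)
    show "depth B n (\<phi> (T x)) = tower_height B n (tau B n (\<phi> (T x))) - 1"
      if "n \<ge> 1" "x \<in> space \<mu>" "depth B n (\<phi> x) = 0" for n x
      using depth_vershik_top[OF \<phi> V\<phi>] that conj(2) po by (simp add: sp properly_ordered_def)
    show "finite (offsets B m n u v)" for m n u v by (rule finite_offsets)
    show "\<exists>\<sigma>\<in>offsets B m n (tau B m (\<phi> x)) (tau B n (\<phi> x)). depth B n (\<phi> x) = depth B m (\<phi> x) + \<sigma>"
      if "1 \<le> m" "m < n" "x \<in> space \<mu>" for m n x
      using depth_split_offsets[OF \<phi>] that by (simp add: sp)
    show "\<exists>x\<in>space \<mu>. tau B m (\<phi> x) = u \<and> depth B m (\<phi> x) = j \<and> tau B n (\<phi> x) = v \<and> depth B n (\<phi> x) = j + \<sigma>"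
      if "1 \<le> m" "m < n" "\<sigma> \<in> offsets B m n u v" "j < tower_height B m u" for m n \<sigma> u v j
    proof -
      obtain y where y: "y \<in> inf_paths B" "tau B m y = u" "depth B m y = j" "tau B n y = v" "depth B n y = j + \<sigma>"
        using realize_offset[OF \<open>1 \<le> m\<close> \<open>m < n\<close> \<open>\<sigma> \<in> offsets B m n u v\<close> \<open>j < tower_height B m u\<close>] by blast
      have "y \<in> \<phi> ` topspace X"
        using homeomorphic_imp_surjective_map[OF conj(1)] y(1) by (simp add: topspace_path_topology)
      then obtain x where "x \<in> topspace X" "\<phi> x = y" by blast
      then show ?thesis using y by (auto simp: sp)
    qed
    show "tau B m (\<phi> x) = tau B m (\<phi> y) \<and> depth B m (\<phi> x) = depth B m (\<phi> y)"
      if "1 \<le> m" "m \<le> n" "x \<in> space \<mu>" "y \<in> space \<mu>" "tau B n (\<phi> x) = tau B n (\<phi> y)"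
        "depth B n (\<phi> x) = depth B n (\<phi> y)" for m n x y
      using prefix_eq_imp[OF depth_inj[OF \<phi> \<phi>, of x y n]] that by (simp add: sp)
    show "AE x in \<mu>. \<exists>n0. \<forall>n\<ge>n0. 0 < depth B n (\<phi> x)"
    proof -
      have "\<exists>!x. max_path B x" using po by (simp only: properly_ordered_def)
      then obtain xm where xm: "max_path B xm" "\<forall>y. max_path B y \<longrightarrow> y = xm" by (rule ex1E)
      have "xm \<in> \<phi> ` topspace X"
        using homeomorphic_imp_surjective_map[OF conj(1)] xm(1)
        by (simp add: topspace_path_topology max_path_def)
      then obtain x0 where x0: "x0 \<in> topspace X" "\<phi> x0 = xm" by blast
      interpret prob_space \<mu> using inv by (simp add: invariant_prob_def)
      have "AE x in \<mu>. x \<notin> {x0}"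
        using invariant_prob_no_atoms[OF min inv x0(1)] by (simp only: prob_eq_0)
      then show ?thesis
        using AE_space
      proof eventually_elim
        case (elim x)
        then have x: "x \<in> topspace X" by (simp add: sp)
        show ?case
        proof (rule ccontr)
          assume "\<not> ?thesis"
          then have *: "\<exists>n\<ge>n0. depth B n (\<phi> x) = 0" for n0 by auto
          \<comment> \<open>Depth 0 at a single level n \<ge> i already makes the edge at i maximal.
            So only the maximal path has depth 0 at arbitrarily high levels, and its preimage is not
            an atom.\<close>
          have "maximal_edge B (\<phi> x i)" if i: "i \<ge> 1" for i
          proof -
            obtain n where "n \<ge> i" "depth B n (\<phi> x) = 0" using * by blast
            then show ?thesis using depth_eq_0_iff[OF \<phi>[OF x], of n] i by auto
          qed
          then have "max_path B (\<phi> x)" using \<phi>[OF x] by (simp add: max_path_def)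
          then have "\<phi> x = \<phi> x0" using xm(2) x0(2) by blast
          then show False using inj_onD[OF inj _ x x0(1)] elim by simp
        qed
      qed
    qed
    show "Int_stable {U. openin X U}" by (auto simp: Int_stable_def)
    show "{U. openin X U} \<subseteq> Pow (space \<mu>)" using openin_subset by (auto simp: sp)
    show "sets \<mu> = sigma_sets (space \<mu>) {U. openin X U}" by (simp add: sets sp)
    show "\<exists>n\<ge>1. \<forall>y\<in>space \<mu>. tau B n (\<phi> y) = tau B n (\<phi> x) \<and> depth B n (\<phi> y) = depth B n (\<phi> x) \<longrightarrow> y \<in> U"
      if "U \<in> {U. openin X U}" "x \<in> U" for U x
    proof -
      have U: "openin X U" "U \<subseteq> topspace X" using that openin_subset by auto
      have "openin (path_topology B) (\<phi> ` U)"
        using homeomorphic_imp_open_map[OF conj(1)] U by (simp add: open_map_def)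
      from open_contains_prefix[OF this, of "\<phi> x"] that obtain n where n: "n \<ge> 1"
        "\<forall>z\<in>inf_paths B. (\<forall>i. 1 \<le> i \<and> i \<le> n \<longrightarrow> z i = \<phi> x i) \<longrightarrow> z \<in> \<phi> ` U" by blast
      show ?thesis
      proof (intro exI[of _ n] conjI n(1) ballI impI)
        fix y assume y: "y \<in> space \<mu>" "tau B n (\<phi> y) = tau B n (\<phi> x) \<and> depth B n (\<phi> y) = depth B n (\<phi> x)"
        then have "\<phi> y \<in> \<phi> ` U"
          using n \<phi>[of y] prefix[of n x y] U that by (auto simp: sp)
        then show "y \<in> U" using inj_onD[OF inj] U(2) y(1) by (auto simp: sp)
      qed
    qed
  qed
qed

theorem theorem10:
  fixes B :: "'e ordered_bratteli"
    and X :: "'x topology" and T :: "'x \<Rightarrow> 'x" and \<phi> :: "'x \<Rightarrow> nat \<Rightarrow> 'e"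
    and d :: nat and \<delta> \<alpha> :: real and I :: "'x measure \<Rightarrow> nat set"
    and \<mu> :: "'x measure" and lam :: complex
  assumes "minimal_cantor_system X T"
    and "proper_representation B X T \<phi> d"
    and "clean_via B X T \<phi> d \<delta> I"
    and "ergodic_prob X T \<mu>"
    and "lam = exp (2 * \<i> * complex_of_real pi * complex_of_real \<alpha>)"
  defines "cond1 \<equiv> \<forall>v \<in> I \<mu>.
      converges_uniformly_above
        (\<lambda>m n. \<Sum>u \<in> I \<mu>. real (tower_height B m u) / real (tower_height B n v) *
           norm (\<Sum>s \<in> suffix_set B m n u v. lam ^ height_inner B m s)) 1"
    and "cond2 \<equiv> \<forall>u \<in> {1..d}. \<forall>v \<in> I \<mu>.
      converges_uniformly_above
        (\<lambda>m n. real (tower_height B m u) / real (tower_height B n v) *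
           (real (incidence_prod B m n u v) -
            norm (\<Sum>s \<in> suffix_set B m n u v. lam ^ height_inner B m s))) 0"
  shows "(cond1 \<longleftrightarrow> cond2) \<and> (eigenvalue_for T \<mu> lam \<longleftrightarrow> cond1 \<and> cond2)"
proof -
  interpret ergodic_towers \<mu> T d "\<lambda>n x. tau B n (\<phi> x)" "\<lambda>n x. depth B n (\<phi> x)"
    "tower_height B" "offsets B" "{U. openin X U}"
    using assms(1,2,4) by (rule ergodic_towers_of_representation)
  have po: "properly_ordered B" and V: "\<And>n. n \<ge> 1 \<Longrightarrow> verts B n = {1..d}"
    using assms(2) by (auto simp: proper_representation_def bratteli_vershik_representation_def)
  interpret ordered_diagram B
    using po by unfold_locales (simp add: properly_ordered_def)
  have "space \<mu> = topspace X" using assms(4) by (simp add: ergodic_prob_def invariant_prob_def)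
  then have tower: "{x \<in> topspace X. tau B n (\<phi> x) = v} = tower n v" for n v by (simp add: tower_def)
  have \<delta>: "\<delta> > 0" and I: "I \<mu> \<subseteq> {1..d}"
    and big: "\<And>v n. v \<in> I \<mu> \<Longrightarrow> n \<ge> 1 \<Longrightarrow> \<delta> \<le> measure \<mu> (tower n v)"
    and small: "\<And>v. v \<in> {1..d} - I \<mu> \<Longrightarrow> (\<lambda>n. measure \<mu> (tower n v)) \<longlonglongrightarrow> 0"
    using assms(3,4) unfolding clean_via_def tower by auto
  have c: "norm lam = 1" by (simp add: assms(5) norm_exp_eq_Re)
  have suffix: "(\<Sum>s \<in> suffix_set B m n u v. lam ^ height_inner B m s) = (\<Sum>\<sigma>\<in>offsets B m n u v. lam ^ \<sigma>)"
    if "1 \<le> m" "m < n" "u \<in> {1..d}" for m n u v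
    using sum_suffix_set[of m n u "\<lambda>k. lam ^ k" v] that V by simp
  have cond1_iff: "cond1 \<longleftrightarrow> (\<forall>v\<in>I \<mu>. converges_uniformly_above (\<lambda>m n. \<Sum>u\<in>I \<mu>. osc lam m n u v) 1)"
    unfolding cond1_def
  proof (intro ball_cong refl converges_uniformly_above_cong sum.cong)
    fix v m n u :: nat assume "1 \<le> m" "m < n" "u \<in> I \<mu>"
    then show "real (tower_height B m u) / real (tower_height B n v) *
           norm (\<Sum>s \<in> suffix_set B m n u v. lam ^ height_inner B m s) = osc lam m n u v"
      using suffix[of m n u v] I by (auto simp: osc_def)
  qed
  have cond2_iff: "cond2 \<longleftrightarrow> (\<forall>u\<in>{1..d}. \<forall>v\<in>I \<mu>.
      converges_uniformly_above (\<lambda>m n. weight m n u v - osc lam m n u v) 0)"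
    unfolding cond2_def
  proof (intro ball_cong refl converges_uniformly_above_cong)
    fix v m n u :: nat assume "1 \<le> m" "m < n" "u \<in> {1..d}"
    then show "real (tower_height B m u) / real (tower_height B n v) *
           (real (incidence_prod B m n u v) - norm (\<Sum>s \<in> suffix_set B m n u v. lam ^ height_inner B m s))
         = weight m n u v - osc lam m n u v"
      using suffix[of m n u v] card_offsets[of m n u v] V
      by (simp add: osc_def weight_def right_diff_distrib)
  qed
  have equiv: "cond1 \<longleftrightarrow> cond2"
    unfolding cond1_iff cond2_iff
    using cond_sum_iff_cond_each[OF c I \<delta> big small] by blast
  have "cond2" if ev: "eigenvalue_for T \<mu> lam"
    unfolding cond2_iff converges_uniformly_above_def
  proof (intro ballI allI impI)
    fix u v and \<epsilon> :: real assume u: "u \<in> {1..d}" and v: "v \<in> I \<mu>" and "\<epsilon> > 0"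
    \<comment> \<open>The defect is controlled only after weighting by the measure of tower v, which
      is at least \<delta>; dividing it out turns this tolerance into \<epsilon>.\<close>
    then have "\<epsilon> * \<delta> > 0" using \<delta> by simp
    from eigenvalue_imp_small_defect[OF ev c this] obtain m0 where m0: "m0 \<ge> 1"
      "\<forall>m\<ge>m0. \<forall>n>m. \<forall>u\<in>{1..d}. \<forall>v\<in>{1..d}.
        measure \<mu> (tower n v) * (weight m n u v - osc lam m n u v) \<le> \<epsilon> * \<delta>" by blast
    show "\<exists>m0\<ge>1. \<forall>m\<ge>m0. \<forall>n>m. \<bar>weight m n u v - osc lam m n u v - 0\<bar> \<le> \<epsilon>"
    proof (intro exI[of _ m0] conjI m0(1) allI impI)
      fix m n assume mn: "m0 \<le> m" "m < n"
      have D0: "0 \<le> weight m n u v - osc lam m n u v" using osc_le_weight[OF c] by simp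
      have "\<delta> * (weight m n u v - osc lam m n u v) \<le> measure \<mu> (tower n v) * (weight m n u v - osc lam m n u v)"
        using big[OF v, of n] mn D0 by (intro mult_right_mono) auto
      also have "\<dots> \<le> \<epsilon> * \<delta>" using m0 mn u v I by blast
      finally have "weight m n u v - osc lam m n u v \<le> \<epsilon>"
        using \<delta> by (simp add: mult.commute)
      then show "\<bar>weight m n u v - osc lam m n u v - 0\<bar> \<le> \<epsilon>" using D0 by simp
    qed
  qed
  moreover have "eigenvalue_for T \<mu> lam" if c1: cond1
  proof -
    \<comment> \<open>An empty set would make (1) vacuous. It is excluded because the measures of
      the finitely many towers add up to 1 at each level and cannot all tend to 0.\<close>
    have "I \<mu> \<noteq> {}"
    proof
      assume "I \<mu> = {}"
      then have "(\<lambda>n. \<Sum>v\<in>{1..d}. measure \<mu> (tower n v)) \<longlonglongrightarrow> (\<Sum>v\<in>{1..d}. 0)"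
        by (intro tendsto_sum small) simp
      moreover have "\<forall>\<^sub>F n in sequentially. (\<Sum>v\<in>{1..d}. measure \<mu> (tower n v)) = 1"
        using eventually_ge_at_top[of 1] by eventually_elim (rule sum_tower)
      then have "(\<lambda>n. \<Sum>v\<in>{1..d}. measure \<mu> (tower n v)) \<longlonglongrightarrow> 1" by (rule tendsto_eventually)
      ultimately show False using LIMSEQ_unique by fastforce
    qed
    then obtain v where v: "v \<in> I \<mu>" by blast
    have "converges_uniformly_above (\<lambda>m n. \<Sum>u\<in>I \<mu>. osc lam m n u v) 1"
      using c1 v by (simp add: cond1_iff)
    then have "\<exists>m0\<ge>1. \<forall>m\<ge>m0. \<forall>n>m. \<bar>(\<Sum>u\<in>I \<mu>. osc lam m n u v) - 1\<bar> \<le> 1 / 2"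
      unfolding converges_uniformly_above_def by (meson half_gt_zero zero_less_one)
    then obtain m where m: "m \<ge> 1" "\<forall>n>m. \<bar>(\<Sum>u\<in>I \<mu>. osc lam m n u v) - 1\<bar> \<le> 1 / 2" by blast
    show ?thesis
    proof (rule cond_imp_eigenvalue[OF c \<delta> big[OF v] _ m(1) I])
      show "v \<in> {1..d}" using v I by blast
      show "1 / 2 \<le> (\<Sum>u\<in>I \<mu>. osc lam m n u v)" if "n > m" for n
        using m(2)[rule_format, OF that] by (simp add: abs_if split: if_splits)
    qed
  qed
  ultimately show ?thesis using equiv by blast
qed

end
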